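(* Let $k$ be a field of characteristic different from $7$, with separable closure $k^{\mathrm s}$ and $G_k=\mathrm{Gal}(k^{\mathrm s}/k)$. Suppose that $\psi:G_k\to\mathbf{F}_7^\times$ is a (continuous) homomorphism. Let $A_v$ be the family of curves attached in the context to the character $\chi=\psi^4$ (which satisfies $\chi^3=1$). If $E$ is an elliptic curve over $k$, then $E$ has a $k$-rational subgroup of order $7$ on which $G_k$ acts via $\psi$ if and only if there is a $v\in k$ such that $E$ is isomorphic over $k$ to the twist of $A_v$ by $\psi^3$. In particular, if $\mathrm{char}(k)\neq2$ and $k(\sqrt d)$ is the field cut out by $\psi^3$, then the twist of $A_v$ by $\psi^3$ is $$A_v^{(d)}: y^2=x^3+d\,b_2(v)x^2+8d^2b_4(v)x+16d^3b_6(v),$$ where $b_2=a_1^2+4a_2$, $b_4=2a_4+a_1a_3$, $b_6=a_3^2+4a_6$ are the usual invariants of the curve $A_v$.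
   Context: A $k$-rational subgroup of $E$ is a $G_k$-stable subgroup of $E(k^{\mathrm s})$. For a homomorphism $\epsilon:G_k\to\{\pm1\}\subseteq\mathrm{Aut}(E)$, the (quadratic) twist of $E$ by $\epsilon$ is an elliptic curve $E^{(\epsilon)}$ over $k$ with an isomorphism $\lambda:E^{(\epsilon)}\to E$ over $k^{\mathrm s}$ such that $\lambda^\sigma\circ\lambda^{-1}=\epsilon(\sigma)$ for all $\sigma\in G_k$. The field cut out by a character is the fixed field of its kernel. Definition of $A_v$ for a character $\chi:G_k\to\mathbf{F}_7^\times$ with $\chi^3=1$: $$A_v: y^2+a_1(v)xy+a_3(v)y=x^3+a_2(v)x^2+a_4(v)x+a_6(v).$$ If $\chi=1$: $a_1(v)=-v^2+v+1$, $a_2(v)=a_3(v)=-v^3+v^2$, $a_4(v)=a_6(v)=0$. If $\chi\ne1$: let $K$ be the cubic extension of $k$ cut out by $\chi$, let $\sigma\in\mathrm{Gal}(K/k)$ be the element with $\chi(\sigma)=4$, and fix $t\in k$ such that $K$ is the splitting field over $k$ of $f(x)=x^3-(t+3)x^2+tx+1$ and $\gamma^\sigma=1/(1-\gamma)$ for every root $\gamma$ of $f$ (such $t$ exists by a lemma of Washington). Put \begin{align*} c&=t^2+3t+9,\qquad f(v)=v^3-(t+3)v^2+tv+1,\\ a_1(v)&=c(v^2-v+1),\qquad a_2(v)=c f(v)\,t(2v-1),\\ a_3(v)&=c f(v)\,[(t^3-1)v^3+(t^3-1)v+t^2-t+1],\\ a_4(v)&=-c^2f(v)\,[(-3t^2-5t-2)v^5+(2t^3+8t^2+8t-7)v^4-(3t^3+6t^2+5t-20)v^3\\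 &\qquad+(2t^3-t-23)v^2+2(t^2+2t+7)v-t-1],\\ a_6(v)&=c^2f(v)^2\,[(2t^5+9t^4+23t^3+35t^2+24t+11)v^6\\ &\qquad+(-t^6-6t^5-23t^4-38t^3-33t^2+36t)v^5\\ &\qquad+(t^6+6t^5+18t^4-6t^3-60t^2-180t+13)v^4\\ &\qquad+(-t^6-2t^5+46t^3+84t^2+142t-139)v^3\\ &\qquad+(-t^5-5t^4-27t^3-15t^2+9t+182)v^2\\ &\qquad+(2t^4+3t^3-10t^2-32t-67)v+2t^3+5t^2+11t+11]. \end{align*} Statements about "the twist of $A_v$" are for $v$ with $A_v$ nonsingular (an elliptic curve). *)

theory Defs
  imports "HOL-Analysis.Function_Topology" "HOL-Library.Numeral_Type"
    "HOL-Computational_Algebra.Computational_Algebra"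
begin

section \<open>Fields, separable closures and Galois groups\<close>

text \<open>
  The base field \<open>k\<close> is a subfield \<open>K\<close> of a field type \<open>'s\<close>; the whole type plays the role of
  the separable closure of \<open>k\<close>.
\<close>

definition is_subfield :: "'s::field set \<Rightarrow> bool" where
  "is_subfield K \<longleftrightarrow> 0 \<in> K \<and> 1 \<in> K \<and>
     (\<forall>x\<in>K. \<forall>y\<in>K. x + y \<in> K \<and> x * y \<in> K) \<and> (\<forall>x\<in>K. - x \<in> K \<and> inverse x \<in> K)"

definition separable_poly :: "'s::field poly \<Rightarrow> bool" where
  "separable_poly p \<longleftrightarrow> coprime p (pderiv p)"

definition separable_element :: "'s::field set \<Rightarrow> 's \<Rightarrow> bool" where
  "separable_element K x \<longleftrightarrow>
     (\<exists>p. (\<forall>i. coeff p i \<in> K) \<and> separable_poly p \<and> poly p x = 0)"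

definition separably_closed :: "'s::field itself \<Rightarrow> bool" where
  "separably_closed _ \<longleftrightarrow>
     (\<forall>p::'s poly. separable_poly p \<and> degree p > 0 \<longrightarrow> (\<exists>x. poly p x = 0))"

definition separable_closure_of :: "'s::field set \<Rightarrow> bool" where
  "separable_closure_of K \<longleftrightarrow>
     is_subfield K \<and> (\<forall>x. separable_element K x) \<and> separably_closed TYPE('s)"

definition adjoin :: "'s::field set \<Rightarrow> 's set \<Rightarrow> 's set" where
  "adjoin K S = \<Inter> {L. is_subfield L \<and> K \<subseteq> L \<and> S \<subseteq> L}"

definition splitting_field_of :: "'s::field set \<Rightarrow> 's poly \<Rightarrow> 's set \<Rightarrow> bool" where
  "splitting_field_of K p L \<longleftrightarrow>
     (\<exists>xs. p = smult (lead_coeff p) (\<Prod>x\<leftarrow>xs. [:- x, 1:])) \<and> L = adjoin K {x. poly p x = 0}"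

definition galois_group :: "'s::field set \<Rightarrow> ('s \<Rightarrow> 's) set" where
  "galois_group K = {\<sigma>. bij \<sigma> \<and> (\<forall>x y. \<sigma> (x + y) = \<sigma> x + \<sigma> y) \<and>
     (\<forall>x y. \<sigma> (x * y) = \<sigma> x * \<sigma> y) \<and> (\<forall>x\<in>K. \<sigma> x = x)}"

text \<open>The Krull topology is the topology of pointwise convergence, \<open>'s\<close> being discrete.\<close>

definition krull_topology :: "'s::field set \<Rightarrow> ('s \<Rightarrow> 's) topology" where
  "krull_topology K =
     subtopology (product_topology (\<lambda>_. discrete_topology UNIV) UNIV) (galois_group K)"

lemma topspace_krull_topology: "topspace (krull_topology K) = galois_group K"
  by (simp add: krull_topology_def)

text \<open>
  The field with seven elements is the type \<open>7\<close> of integers modulo seven; its unit group consists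
  of the nonzero elements.
\<close>

definition continuous_character :: "'s::field set \<Rightarrow> (('s \<Rightarrow> 's) \<Rightarrow> 7) \<Rightarrow> bool" where
  "continuous_character K \<psi> \<longleftrightarrow>
     continuous_map (krull_topology K) (discrete_topology (- {0})) \<psi> \<and>
     (\<forall>\<sigma>\<in>galois_group K. \<forall>\<tau>\<in>galois_group K. \<psi> (\<sigma> \<circ> \<tau>) = \<psi> \<sigma> * \<psi> \<tau>)"

definition trivial_character :: "'s::field set \<Rightarrow> (('s \<Rightarrow> 's) \<Rightarrow> 7) \<Rightarrow> bool" where
  "trivial_character K \<chi> \<longleftrightarrow> (\<forall>\<sigma>\<in>galois_group K. \<chi> \<sigma> = 1)"

definition cut_out_field :: "'s::field set \<Rightarrow> (('s \<Rightarrow> 's) \<Rightarrow> 7) \<Rightarrow> 's set" where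
  "cut_out_field K \<chi> = {x. \<forall>\<sigma>\<in>galois_group K. \<chi> \<sigma> = 1 \<longrightarrow> \<sigma> x = x}"


section \<open>Weierstrass curves and their points\<close>

datatype 's weierstrass = Weierstrass (a1: 's) (a2: 's) (a3: 's) (a4: 's) (a6: 's)

definition b2 :: "'s::field weierstrass \<Rightarrow> 's" where
  "b2 W = a1 W ^ 2 + 4 * a2 W"

definition b4 :: "'s::field weierstrass \<Rightarrow> 's" where
  "b4 W = 2 * a4 W + a1 W * a3 W"

definition b6 :: "'s::field weierstrass \<Rightarrow> 's" where
  "b6 W = a3 W ^ 2 + 4 * a6 W"

definition b8 :: "'s::field weierstrass \<Rightarrow> 's" where
  "b8 W = a1 W ^ 2 * a6 W + 4 * a2 W * a6 W - a1 W * a3 W * a4 W + a2 W * a3 W ^ 2 - a4 W ^ 2"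

definition discriminant :: "'s::field weierstrass \<Rightarrow> 's" where
  "discriminant W =
     - (b2 W ^ 2 * b8 W) - 8 * b4 W ^ 3 - 27 * b6 W ^ 2 + 9 * b2 W * b4 W * b6 W"

definition elliptic_curve :: "'s::field set \<Rightarrow> 's weierstrass \<Rightarrow> bool" where
  "elliptic_curve K W \<longleftrightarrow> set_weierstrass W \<subseteq> K \<and> discriminant W \<noteq> 0"

definition weierstrass_poly :: "'s::field weierstrass \<Rightarrow> 's \<Rightarrow> 's \<Rightarrow> 's" where
  "weierstrass_poly W x y =
     y ^ 2 + a1 W * x * y + a3 W * y - (x ^ 3 + a2 W * x ^ 2 + a4 W * x + a6 W)"

datatype 's point = Infinity | Affine 's 's

definition curve_points :: "'s::field weierstrass \<Rightarrow> 's point set" where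
  "curve_points W = insert Infinity {Affine x y | x y. weierstrass_poly W x y = 0}"

fun point_neg :: "'s::field weierstrass \<Rightarrow> 's point \<Rightarrow> 's point" where
  "point_neg W Infinity = Infinity"
| "point_neg W (Affine x y) = Affine x (- y - a1 W * x - a3 W)"

text \<open>Chord and tangent addition; only meaningful for points on the curve.\<close>

fun point_add :: "'s::field weierstrass \<Rightarrow> 's point \<Rightarrow> 's point \<Rightarrow> 's point" where
  "point_add W Infinity Q = Q"
| "point_add W P Infinity = P"
| "point_add W (Affine x1 y1) (Affine x2 y2) =
     (if Affine x2 y2 = point_neg W (Affine x1 y1) then Infinity
      else
        let l = (if x1 = x2
                 then (3 * x1 ^ 2 + 2 * a2 W * x1 + a4 W - a1 W * y1) / (2 * y1 + a1 W * x1 + a3 W)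
                 else (y2 - y1) / (x2 - x1));
            x3 = l ^ 2 + a1 W * l - a2 W - x1 - x2
        in point_neg W (Affine x3 (y1 + l * (x3 - x1))))"

definition point_mult :: "'s::field weierstrass \<Rightarrow> nat \<Rightarrow> 's point \<Rightarrow> 's point" where
  "point_mult W n P = (point_add W P ^^ n) Infinity"

definition point_subgroup :: "'s::field weierstrass \<Rightarrow> 's point set \<Rightarrow> bool" where
  "point_subgroup W C \<longleftrightarrow> C \<subseteq> curve_points W \<and> Infinity \<in> C \<and>
     (\<forall>P\<in>C. point_neg W P \<in> C) \<and> (\<forall>P\<in>C. \<forall>Q\<in>C. point_add W P Q \<in> C)"

text \<open>An automorphism \<open>\<sigma>\<close> acts on points by \<open>map_point \<sigma>\<close>.\<close>

definition rational_subgroup :: "'s::field set \<Rightarrow> 's weierstrass \<Rightarrow> 's point set \<Rightarrow> bool" where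
  "rational_subgroup K W C \<longleftrightarrow>
     point_subgroup W C \<and> (\<forall>\<sigma>\<in>galois_group K. map_point \<sigma> ` C = C)"

text \<open>Here \<open>n\<close> ranges over all representatives of the residue class \<open>\<psi> \<sigma>\<close>.\<close>

definition acts_via ::
  "'s::field set \<Rightarrow> 's weierstrass \<Rightarrow> 's point set \<Rightarrow> (('s \<Rightarrow> 's) \<Rightarrow> 7) \<Rightarrow> bool" where
  "acts_via K W C \<psi> \<longleftrightarrow>
     (\<forall>\<sigma>\<in>galois_group K. \<forall>P\<in>C. \<forall>n. of_nat n = \<psi> \<sigma> \<longrightarrow> map_point \<sigma> P = point_mult W n P)"


section \<open>Isomorphisms and quadratic twists\<close>

text \<open>
  An isomorphism of elliptic curves in Weierstrass form is a change of coordinates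
  \<open>(x, y) \<mapsto> (u\<^sup>2 x + r, u\<^sup>3 y + s u\<^sup>2 x + t)\<close> with \<open>u \<noteq> 0\<close>, and is represented by \<open>(u, r, s, t)\<close>.
\<close>

datatype 's coord_change = CC (cc_u: 's) (cc_r: 's) (cc_s: 's) (cc_t: 's)

fun cc_apply :: "'s::field coord_change \<Rightarrow> 's point \<Rightarrow> 's point" where
  "cc_apply (CC u r s t) Infinity = Infinity"
| "cc_apply (CC u r s t) (Affine x y) = Affine (u^2 * x + r) (u^3 * y + s * u^2 * x + t)"

definition cc_id :: "'s::field coord_change" where
  "cc_id = CC 1 0 0 0"

fun cc_comp :: "'s::field coord_change \<Rightarrow> 's coord_change \<Rightarrow> 's coord_change" where
  "cc_comp (CC u' r' s' t') (CC u r s t) =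
     CC (u' * u) (u'^2 * r + r') (u' * s + s') (u'^3 * t + s' * u'^2 * r + t')"

fun cc_inv :: "'s::field coord_change \<Rightarrow> 's coord_change" where
  "cc_inv (CC u r s t) = CC (1 / u) (- r / u^2) (- s / u) ((r * s - t) / u^3)"

text \<open>The automorphism \<open>-1\<close> of a Weierstrass curve.\<close>

definition cc_neg :: "'s::field weierstrass \<Rightarrow> 's coord_change" where
  "cc_neg W = CC (- 1) 0 (- a1 W) (- a3 W)"

text \<open>
  \<open>is_isomorphism \<phi> W' W\<close>: \<open>\<phi>\<close> carries \<open>W'\<close> to \<open>W\<close>, that is, the substitution given by \<open>\<phi>\<close> turns
  the equation of \<open>W\<close> into \<open>u\<^sup>6\<close> times the equation of \<open>W'\<close>.
\<close>

definition is_isomorphism ::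
  "'s::field coord_change \<Rightarrow> 's weierstrass \<Rightarrow> 's weierstrass \<Rightarrow> bool" where
  "is_isomorphism \<phi> W' W \<longleftrightarrow>
     (case \<phi> of CC u r s t \<Rightarrow>
        u \<noteq> 0 \<and>
        u * a1 W' = a1 W + 2 * s \<and>
        u^2 * a2 W' = a2 W - s * a1 W + 3 * r - s^2 \<and>
        u^3 * a3 W' = a3 W + r * a1 W + 2 * t \<and>
        u^4 * a4 W' = a4 W - s * a3 W + 2 * r * a2 W - (t + r * s) * a1 W + 3 * r^2 - 2 * s * t \<and>
        u^6 * a6 W' = a6 W + r * a4 W + r^2 * a2 W + r^3 - t * a3 W - t^2 - r * t * a1 W)"

definition isomorphic_over :: "'s::field set \<Rightarrow> 's weierstrass \<Rightarrow> 's weierstrass \<Rightarrow> bool" where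
  "isomorphic_over K W' W \<longleftrightarrow> (\<exists>\<phi>. set_coord_change \<phi> \<subseteq> K \<and> is_isomorphism \<phi> W' W)"

lemma cc_apply_comp: "cc_apply (cc_comp \<phi> \<theta>) P = cc_apply \<phi> (cc_apply \<theta> P)"
  by (cases \<phi>; cases \<theta>; cases P) (simp_all add: algebra_simps power2_eq_square power3_eq_cube)

lemma cc_comp_inv: "cc_u \<phi> \<noteq> 0 \<Longrightarrow> cc_comp \<phi> (cc_inv \<phi>) = cc_id \<and> cc_comp (cc_inv \<phi>) \<phi> = cc_id"
  by (cases \<phi>) (simp add: cc_id_def field_simps power2_eq_square power3_eq_cube)

lemma cc_apply_neg: "cc_apply (cc_neg W) P = point_neg W P"
  by (cases P) (simp_all add: cc_neg_def)

lemma is_isomorphism_equation: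
  assumes "is_isomorphism (CC u r s t) W' W"
  shows "weierstrass_poly W (u^2 * x + r) (u^3 * y + s * u^2 * x + t) =
    u^6 * weierstrass_poly W' x y"
proof -
  have "u^6 * weierstrass_poly W' x y =
    u^6 * y^2 + (u * a1 W') * u^5 * x * y + (u^3 * a3 W') * u^3 * y
      - (u^6 * x^3 + (u^2 * a2 W') * u^4 * x^2 + (u^4 * a4 W') * u^2 * x + u^6 * a6 W')"
    unfolding weierstrass_poly_def by algebra
  also have "\<dots> = weierstrass_poly W (u^2 * x + r) (u^3 * y + s * u^2 * x + t)"
    using assms unfolding is_isomorphism_def weierstrass_poly_def coord_change.case by algebra
  finally show ?thesis by simp
qed

text \<open>
  The automorphism \<open>\<plusminus>1\<close> of \<open>W\<close> attached to \<open>e = \<plusminus>1\<close> in the field with seven elements.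
\<close>

definition sign_automorphism :: "'s::field weierstrass \<Rightarrow> 7 \<Rightarrow> 's coord_change" where
  "sign_automorphism W e = (if e = 1 then cc_id else cc_neg W)"

text \<open>
  \<open>is_twist K W \<epsilon> W'\<close>: \<open>W'\<close> is the twist of \<open>W\<close> by the character \<open>\<epsilon>\<close>, which takes values in
  \<open>{1, -1}\<close>. The isomorphism \<open>\<lambda>\<close> is defined over \<open>'s\<close>, and its conjugate \<open>\<lambda>\<^sup>\<sigma>\<close> is
  \<open>map_coord_change \<sigma> \<lambda>\<close>.
\<close>

definition is_twist ::
  "'s::field set \<Rightarrow> 's weierstrass \<Rightarrow> (('s \<Rightarrow> 's) \<Rightarrow> 7) \<Rightarrow> 's weierstrass \<Rightarrow> bool" where
  "is_twist K W \<epsilon> W' \<longleftrightarrow> elliptic_curve K W' \<and>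
     (\<exists>lam. is_isomorphism lam W' W \<and>
        (\<forall>\<sigma>\<in>galois_group K. \<epsilon> \<sigma> \<in> {1, - 1} \<and>
           cc_comp (map_coord_change \<sigma> lam) (cc_inv lam) = sign_automorphism W (\<epsilon> \<sigma>)))"

definition explicit_twist :: "'s::field \<Rightarrow> 's weierstrass \<Rightarrow> 's weierstrass" where
  "explicit_twist d W =
     Weierstrass 0 (d * b2 W) 0 (8 * d^2 * b4 W) (16 * d^3 * b6 W)"


section \<open>The family\<close>

definition simplest_cubic :: "'s::field \<Rightarrow> 's poly" where
  "simplest_cubic t = [:1, t, - (t + 3), 1:]"

text \<open>
  Any \<open>\<sigma>\<close> with \<open>\<chi> \<sigma> = 4\<close> restricts to the element of the Galois group of the field cut out
  by \<open>\<chi>\<close> at which \<open>\<chi>\<close> has the value \<open>4\<close>.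
\<close>

definition admissible_parameter ::
  "'s::field set \<Rightarrow> (('s \<Rightarrow> 's) \<Rightarrow> 7) \<Rightarrow> 's \<Rightarrow> bool" where
  "admissible_parameter K \<chi> t \<longleftrightarrow> t \<in> K \<and>
     splitting_field_of K (simplest_cubic t) (cut_out_field K \<chi>) \<and>
     (\<forall>\<sigma>\<in>galois_group K. \<chi> \<sigma> = 4 \<longrightarrow>
        (\<forall>g. poly (simplest_cubic t) g = 0 \<longrightarrow> \<sigma> g = 1 / (1 - g)))"

definition trivial_family :: "'s::field \<Rightarrow> 's weierstrass" where
  "trivial_family v = Weierstrass (- (v^2) + v + 1) (- (v^3) + v^2) (- (v^3) + v^2) 0 0"

definition cubic_family :: "'s::field \<Rightarrow> 's \<Rightarrow> 's weierstrass" where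
  "cubic_family t v =
    (let c = t^2 + 3*t + 9;
         f = v^3 - (t + 3) * v^2 + t * v + 1
     in Weierstrass
       (c * (v^2 - v + 1))
       (c * f * t * (2*v - 1))
       (c * f * ((t^3 - 1) * v^3 + (t^3 - 1) * v + t^2 - t + 1))
       (- (c^2 * f * ((-3*t^2 - 5*t - 2) * v^5 + (2*t^3 + 8*t^2 + 8*t - 7) * v^4
           - (3*t^3 + 6*t^2 + 5*t - 20) * v^3 + (2*t^3 - t - 23) * v^2
           + 2 * (t^2 + 2*t + 7) * v - t - 1)))
       (c^2 * f^2 * ((2*t^5 + 9*t^4 + 23*t^3 + 35*t^2 + 24*t + 11) * v^6
           + (- (t^6) - 6*t^5 - 23*t^4 - 38*t^3 - 33*t^2 + 36*t) * v^5
           + (t^6 + 6*t^5 + 18*t^4 - 6*t^3 - 60*t^2 - 180*t + 13) * v^4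
           + (- (t^6) - 2*t^5 + 46*t^3 + 84*t^2 + 142*t - 139) * v^3
           + (- (t^5) - 5*t^4 - 27*t^3 - 15*t^2 + 9*t + 182) * v^2
           + (2*t^4 + 3*t^3 - 10*t^2 - 32*t - 67) * v + 2*t^3 + 5*t^2 + 11*t + 11)))"

definition curve_family ::
  "'s::field set \<Rightarrow> (('s \<Rightarrow> 's) \<Rightarrow> 7) \<Rightarrow> 's \<Rightarrow> 's \<Rightarrow> 's weierstrass" where
  "curve_family K \<chi> t v = (if trivial_character K \<chi> then trivial_family v else cubic_family t v)"

end

theory Submission
  imports Defs
begin

text \<open>
  Write \<open>T w\<close> for \<open>trivial_family w\<close>. A point \<open>P\<close> of order seven on a curve \<open>E\<close> determines exactly one
  parameter \<open>w\<close> and exactly one isomorphism \<open>T w \<rightarrow> E\<close> that carries the origin to \<open>P\<close>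
  (\<open>marking_exists\<close>, \<open>marking_unique\<close>); that is, \<open>w\<close> is a coordinate on the modular curve
  \<open>X\<^sub>1(7)\<close>. Multiples of \<open>P\<close> are always computed by transport from \<open>T w\<close>, whose seven marked points
  form an explicit table (\<open>tate_point_add\<close>).

  A stable subgroup of order seven with action \<open>\<psi>\<close> is the same thing as a point \<open>P\<close> of order seven
  with \<open>\<sigma> P = \<psi>(\<sigma>) P\<close>, here called a level structure. Put \<open>\<chi> = \<psi>\<^sup>4\<close>. Since \<open>\<psi> = \<psi>\<^sup>3 \<chi>\<close> and \<open>\<psi>\<^sup>3\<close> is a
  sign, the automorphism \<open>-1\<close> lets a twist by \<open>\<psi>\<^sup>3\<close> turn a level structure for \<open>\<chi>\<close> into one for \<open>\<psi>\<close>
  (\<open>twist_level_structure\<close>). In the other direction, suppose that \<open>(E, P)\<close> has a level structure for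
  \<open>\<psi>\<close>, that \<open>(A, Q)\<close> has one for \<open>\<chi>\<close>, and that both have the same parameter. Then the isomorphism
  \<open>E \<rightarrow> A\<close> with \<open>P \<mapsto> Q\<close> has no other choice than to satisfy the cocycle condition of a twist, because
  it is unique (\<open>level_structure_twist\<close>). So the theorem says that the curves of the family carry a
  level structure for \<open>\<chi>\<close> and that their parameters exhaust those of the pairs \<open>(E, P)\<close>.

  Replacing \<open>P\<close> by \<open>-P\<close> keeps the parameter, and replacing it by \<open>4P\<close> changes \<open>w\<close> into \<open>1/(1 - w)\<close>
  (\<open>marking_quadruple\<close>). Hence \<open>\<sigma> w = w\<close> if \<open>\<chi>(\<sigma>) = 1\<close>, and \<open>\<sigma> w = 1/(1 - w)\<close> if \<open>\<chi>(\<sigma>) = 4\<close>. For trivial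
  \<open>\<chi>\<close> this puts \<open>w\<close> into the base field. Otherwise a root \<open>g\<close> of the simplest cubic is moved by the same
  rule, so that \<open>v = (g - w)/(1 + w (g - 1))\<close> is invariant and therefore rational. Conversely the curve
  \<open>cubic_family t v\<close> becomes isomorphic to \<open>T w\<close> with \<open>w = (g - v)/((g - 1) v + 1)\<close> once \<open>g\<close> is adjoined,
  and its marked point \<open>P\<^sub>g\<close> satisfies \<open>P\<^bsub>1/(1-g)\<^esub> = 4 P\<^sub>g\<close> (\<open>cubic_level.marking\<close>); since \<open>g\<close> is conjugated by
  \<open>\<chi>\<close> this is a level structure for \<open>\<chi>\<close>. At \<open>w = 1/(1 - g)\<close> the formula for \<open>v\<close> has its pole; there \<open>4P\<close>
  is used in place of \<open>P\<close>.

  Two facts of Galois theory enter, both for the separable closure as a whole: the invariants of the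
  Galois group are the base field (\<open>galois_fixed_field\<close>), and an automorphism that fixes the field cut
  out by a continuous character lies in the kernel of that character (\<open>fixes_cut_out_field\<close>).
\<close>

section \<open>Ring homomorphisms and Galois groups\<close>

definition is_ring_hom :: "('a::comm_ring_1 \<Rightarrow> 'b::comm_ring_1) \<Rightarrow> bool" where
  "is_ring_hom h \<longleftrightarrow> h 0 = 0 \<and> h 1 = 1 \<and>
     (\<forall>x y. h (x + y) = h x + h y) \<and> (\<forall>x y. h (x * y) = h x * h y)"

lemma is_ring_hom_simps:
  assumes "is_ring_hom h"
  shows "h 0 = 0" "h 1 = 1" "h (x + y) = h x + h y" "h (x * y) = h x * h y"
    "h (- x) = - h x" "h (x - y) = h x - h y" "h (x ^ n) = h x ^ n" "h (of_nat n) = of_nat n"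
    "h (numeral k) = numeral k"
proof -
  show 0: "h 0 = 0" and "h 1 = 1" and "h (x * y) = h x * h y"
    using assms by (simp_all add: is_ring_hom_def)
  show add: "h (x + y) = h x + h y" for x y
    using assms by (simp add: is_ring_hom_def)
  show neg: "h (- x) = - h x" for x
    using add[of x "- x"] 0 by (simp add: eq_neg_iff_add_eq_0 add.commute)
  show "h (x - y) = h x - h y"
    using add[of x "- y"] neg[of y] by simp
  show "h (x ^ n) = h x ^ n"
    using assms by (induction n) (simp_all add: is_ring_hom_def)
  show of_nat: "h (of_nat n) = of_nat n" for n
    using assms by (induction n) (simp_all add: is_ring_hom_def)
  show "h (numeral k) = numeral k"
    using of_nat[of "numeral k"] by simp
qed

lemma is_ring_hom_sum:
  assumes "is_ring_hom h"
  shows "h (sum f A) = (\<Sum>x\<in>A. h (f x))"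
  by (induction A rule: infinite_finite_induct) (simp_all add: is_ring_hom_simps[OF assms])

lemma is_ring_hom_prod:
  assumes "is_ring_hom h"
  shows "h (prod f A) = (\<Prod>x\<in>A. h (f x))"
  by (induction A rule: infinite_finite_induct) (simp_all add: is_ring_hom_simps[OF assms])

text \<open>
  Stated for commutative rings so that it can be applied twice: \<open>fixes_cut_out_field\<close> uses the action
  of an automorphism on polynomials whose coefficients are polynomials.
\<close>

lemma is_ring_hom_map_poly:
  assumes "is_ring_hom h"
  shows "is_ring_hom (map_poly h)"
  unfolding is_ring_hom_def
proof (intro conjI allI)
  note h = is_ring_hom_simps[OF assms]
  show "map_poly h 0 = 0" "map_poly h 1 = 1" by (simp_all add: h)
  show "map_poly h (p + q) = map_poly h p + map_poly h q" for p q
    by (intro poly_eqI) (simp add: coeff_map_poly h)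
  show "map_poly h (p * q) = map_poly h p * map_poly h q" for p q
    by (intro poly_eqI) (simp add: coeff_map_poly h coeff_mult is_ring_hom_sum[OF assms])
qed

lemma poly_map_poly_hom:
  assumes "is_ring_hom h"
  shows "poly (map_poly h p) (h x) = h (poly p x)"
proof (induction p)
  case 0
  then show ?case by (simp add: is_ring_hom_simps[OF assms])
next
  case (pCons a p)
  then show ?case
    by (simp add: map_poly_pCons is_ring_hom_simps[OF assms])
qed

lemma galois_ring_hom:
  assumes "\<sigma> \<in> galois_group K"
  shows "is_ring_hom \<sigma>"
proof -
  have s: "bij \<sigma>" "\<sigma> (x + y) = \<sigma> x + \<sigma> y" "\<sigma> (x * y) = \<sigma> x * \<sigma> y" for x y
    using assms by (auto simp: galois_group_def)
  have "\<sigma> 0 + \<sigma> 0 = \<sigma> 0" using s(2)[of 0 0, unfolded add_0] by (rule sym)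
  then have 0: "\<sigma> 0 = 0" unfolding add_cancel_left_right .
  have "\<sigma> 1 \<noteq> \<sigma> 0" using s(1) by (simp add: bij_is_inj inj_eq)
  then have "\<sigma> 1 \<noteq> 0" using 0 by simp
  then have "\<sigma> 1 = 1" using s(3)[of 1 1] by simp
  then show ?thesis using 0 s by (simp add: is_ring_hom_def)
qed

lemmas galois_simps = is_ring_hom_simps[OF galois_ring_hom]

lemma galois_eq_iff: "\<sigma> \<in> galois_group K \<Longrightarrow> \<sigma> x = \<sigma> y \<longleftrightarrow> x = y"
  unfolding galois_group_def by (elim CollectE conjE) (rule inj_eq[OF bij_is_inj])

lemma galois_fixes: "\<sigma> \<in> galois_group K \<Longrightarrow> x \<in> K \<Longrightarrow> \<sigma> x = x"
  unfolding galois_group_def by blast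

lemma galois_inverse:
  assumes "\<sigma> \<in> galois_group K"
  shows "\<sigma> (inverse x) = inverse (\<sigma> x)"
proof (cases "x = 0")
  case False
  have "\<sigma> x * \<sigma> (inverse x) = 1"
    using False by (simp add: galois_simps[OF assms] flip: galois_simps(4)[OF assms])
  then show ?thesis by (simp add: inverse_unique)
qed (simp add: galois_simps[OF assms])

lemma galois_divide:
  assumes "\<sigma> \<in> galois_group K"
  shows "\<sigma> (x / y) = \<sigma> x / \<sigma> y"
  by (simp add: divide_inverse galois_simps[OF assms] galois_inverse[OF assms])

lemma galois_comp:
  "\<sigma> \<in> galois_group K \<Longrightarrow> \<tau> \<in> galois_group K \<Longrightarrow> \<sigma> \<circ> \<tau> \<in> galois_group K"
  by (simp add: galois_group_def bij_comp)

lemma galois_id: "id \<in> galois_group K"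
  by (simp add: galois_group_def)

lemma galois_inv:
  assumes "\<sigma> \<in> galois_group K"
  shows "inv \<sigma> \<in> galois_group K" and "\<sigma> (inv \<sigma> x) = x" and "inv \<sigma> (\<sigma> x) = x"
proof -
  have b: "bij \<sigma>" using assms by (simp add: galois_group_def)
  show 1: "\<sigma> (inv \<sigma> x) = x" and 2: "inv \<sigma> (\<sigma> x) = x" for x
    using b by (simp_all add: bij_is_surj surj_f_inv_f bij_is_inj)
  show "inv \<sigma> \<in> galois_group K"
    unfolding galois_group_def
  proof (intro CollectI conjI allI ballI)
    show "bij (inv \<sigma>)" using b by (rule bij_imp_bij_inv)
    show "inv \<sigma> (x + y) = inv \<sigma> x + inv \<sigma> y" for x y
      using galois_eq_iff[OF assms] galois_simps(3)[OF assms] 1 by metis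
    show "inv \<sigma> (x * y) = inv \<sigma> x * inv \<sigma> y" for x y
      using galois_eq_iff[OF assms] galois_simps(4)[OF assms] 1 by metis
    show "inv \<sigma> x = x" if "x \<in> K" for x
      using 2 galois_fixes[OF assms that] by metis
  qed
qed

lemma galois_fixed_points_subfield:
  assumes "\<sigma> \<in> galois_group K"
  shows "is_subfield {x. \<sigma> x = x}"
  by (simp add: is_subfield_def galois_simps[OF assms] galois_inverse[OF assms])

lemma galois_root:
  assumes "\<sigma> \<in> galois_group K" "\<forall>i. coeff p i \<in> K" "poly p x = 0"
  shows "poly p (\<sigma> x) = 0"
proof -
  have "map_poly \<sigma> p = p"
    by (intro poly_eqI) (simp add: coeff_map_poly galois_simps[OF assms(1)] galois_fixes[OF assms(1)] assms(2))
  then show ?thesis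
    using poly_map_poly_hom[OF galois_ring_hom[OF assms(1)], of p x] assms(3)
    by (simp add: galois_simps[OF assms(1)])
qed

lemma separable_poly_nonzero: "separable_poly p \<Longrightarrow> p \<noteq> 0"
  by (auto simp: separable_poly_def)

lemma separable_poly_dvd:
  fixes p m :: "'s::field poly"
  assumes "separable_poly p" "m dvd p"
  shows "separable_poly m"
proof -
  obtain r where r: "p = m * r" using assms(2) by auto
  show ?thesis unfolding separable_poly_def
  proof (rule coprimeI)
    fix c assume "c dvd m" "c dvd pderiv m"
    then have "c dvd p" "c dvd pderiv p"
      by (simp_all add: r pderiv_mult)
    then show "is_unit c" using assms(1) by (auto simp: separable_poly_def coprime_def)
  qed
qed

text \<open>
  The conjugates of \<open>x\<close> are roots of the separable polynomial that \<open>x\<close> satisfies over \<open>K\<close>.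
\<close>

lemma galois_orbit_finite:
  assumes "separable_element K x"
  shows "finite ((\<lambda>\<sigma>. \<sigma> x) ` galois_group K)"
proof -
  obtain p where p: "\<forall>i. coeff p i \<in> K" "separable_poly p" "poly p x = 0"
    using assms by (auto simp: separable_element_def)
  have "(\<lambda>\<sigma>. \<sigma> x) ` galois_group K \<subseteq> {y. poly p y = 0}"
    using galois_root p by blast
  then show ?thesis
    using poly_roots_finite[OF separable_poly_nonzero[OF p(2)]] finite_subset by blast
qed

section \<open>Characters with values in the field with seven elements\<close>

lemma F7_cases: "(a::7) = 0 \<or> a = 1 \<or> a = 2 \<or> a = 3 \<or> a = 4 \<or> a = 5 \<or> a = 6"
proof (cases a)
  case (of_int z)
  then have "z = 0 \<or> z = 1 \<or> z = 2 \<or> z = 3 \<or> z = 4 \<or> z = 5 \<or> z = 6" by auto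
  then show ?thesis using of_int(1) by auto
qed

text \<open>
  Facts that depend on the type \<open>7\<close> being a field are checked on its seven elements.
\<close>

lemma F7_idem: "(a::7) * a = a \<Longrightarrow> a \<noteq> 0 \<Longrightarrow> a = 1"
  using F7_cases[of a] by auto

lemma F7_of_nat_eq_iff: "(of_nat m :: 7) = of_nat n \<longleftrightarrow> m mod 7 = n mod 7"
proof -
  have zero: "(of_nat k :: 7) = 0 \<longleftrightarrow> k mod 7 = 0" for k
    using of_nat_eq_0_iff_char_dvd[of k, where 'a = 7] by (simp add: mod_eq_0_iff_dvd)
  have *: "(of_nat m :: 7) = of_nat n \<longleftrightarrow> m mod 7 = n mod 7" if "n \<le> m" for m n
  proof -
    have "(of_nat m :: 7) = of_nat n \<longleftrightarrow> (of_nat (m - n) :: 7) = 0"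
      using that by (simp add: of_nat_diff)
    also have "\<dots> \<longleftrightarrow> m mod 7 = n mod 7"
      unfolding zero using that by (simp add: mod_eq_dvd_iff_nat mod_eq_0_iff_dvd)
    finally show ?thesis .
  qed
  show ?thesis
  proof (cases "n \<le> m")
    case False
    then show ?thesis using *[of m n] by (metis nat_le_linear)
  qed (rule *)
qed

lemma F7_power_3: "(a::7) \<noteq> 0 \<Longrightarrow> a ^ 3 = 1 \<or> a ^ 3 = - 1"
  using F7_cases[of a] by auto

lemma F7_power_4: "(a::7) \<noteq> 0 \<Longrightarrow> a ^ 4 = 1 \<or> a ^ 4 = 2 \<or> a ^ 4 = 4"
  using F7_cases[of a] by auto

lemma F7_of_nat_surj: "\<exists>n. of_nat n = (a::7)"
  using F7_cases[of a] by (metis of_nat_0 of_nat_1 of_nat_numeral)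

text \<open>
  For \<open>a = \<psi>(\<sigma>)\<close>: \<open>a = a\<^sup>3 a\<^sup>4\<close> with \<open>a\<^sup>3\<close> a sign, and \<open>a\<^sup>4\<close> is a cube root of unity. Multiplication by
  \<open>-1\<close> appears as multiplication by \<open>6\<close>, because multiples of points are indexed by natural numbers.
\<close>

lemma F7_sign:
  assumes "(a::7) \<noteq> 0" "of_nat n = a" "of_nat m = a ^ 4"
  shows "a ^ 3 = 1 \<and> (of_nat n :: 7) = of_nat m \<or> a ^ 3 = - 1 \<and> (of_nat n :: 7) = of_nat (6 * m)"
    and "(of_nat (m * m * m) :: 7) = 1"
  using assms F7_cases[of a] by auto

lemma character_nonzero:
  assumes "continuous_character K \<chi>" "\<sigma> \<in> galois_group K"
  shows "\<chi> \<sigma> \<noteq> 0"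
proof -
  have "\<chi> ` topspace (krull_topology K) \<subseteq> topspace (discrete_topology (- {0}))"
    using assms(1) unfolding continuous_character_def
    by (intro continuous_map_image_subset_topspace) blast
  then show ?thesis using assms(2) by (auto simp: topspace_krull_topology)
qed

lemma character_comp:
  assumes "continuous_character K \<chi>" "\<sigma> \<in> galois_group K" "\<tau> \<in> galois_group K"
  shows "\<chi> (\<sigma> \<circ> \<tau>) = \<chi> \<sigma> * \<chi> \<tau>"
  using assms by (simp add: continuous_character_def)

lemma character_id:
  assumes "continuous_character K \<chi>"
  shows "\<chi> id = 1"
  using F7_idem[of "\<chi> id"] character_comp[OF assms galois_id galois_id]
    character_nonzero[OF assms galois_id] by simp

lemma F7_power_nonzero: "(a::7) \<noteq> 0 \<Longrightarrow> a ^ n \<noteq> 0"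
proof (induction n)
  case (Suc n)
  have "a * b \<noteq> 0" if "b \<noteq> 0" for b
    using that \<open>a \<noteq> 0\<close> F7_cases[of a] F7_cases[of b] by auto
  then show ?case using Suc by simp
qed simp

lemma character_power:
  assumes "continuous_character K \<psi>"
  shows "continuous_character K (\<lambda>\<sigma>. \<psi> \<sigma> ^ n)"
  unfolding continuous_character_def
proof (intro conjI ballI)
  have "continuous_map (discrete_topology (- {0})) (discrete_topology (- {0})) (\<lambda>a::7. a ^ n)"
    by (auto simp: F7_power_nonzero)
  moreover have "continuous_map (krull_topology K) (discrete_topology (- {0})) \<psi>"
    using assms by (simp add: continuous_character_def)
  ultimately show "continuous_map (krull_topology K) (discrete_topology (- {0})) (\<lambda>\<sigma>. \<psi> \<sigma> ^ n)"
    using continuous_map_compose[of _ _ \<psi> _ "\<lambda>a. a ^ n"] by (simp add: o_def)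
  show "\<psi> (\<sigma> \<circ> \<tau>) ^ n = \<psi> \<sigma> ^ n * \<psi> \<tau> ^ n"
    if "\<sigma> \<in> galois_group K" "\<tau> \<in> galois_group K" for \<sigma> \<tau>
    by (simp add: character_comp[OF assms that] power_mult_distrib)
qed

section \<open>The kernel of a character and the field it cuts out\<close>

text \<open>
  A basic neighbourhood of the identity in the topology of pointwise convergence constrains only
  finitely many values.
\<close>

lemma continuous_character_nbhd:
  assumes "continuous_character K \<chi>"
  obtains S where "finite S"
    and "\<And>\<sigma>. \<sigma> \<in> galois_group K \<Longrightarrow> (\<And>x. x \<in> S \<Longrightarrow> \<sigma> x = x) \<Longrightarrow> \<chi> \<sigma> = \<chi> id"
proof -
  have cont: "continuous_map (krull_topology K) (discrete_topology (- {0})) \<chi>"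
    using assms by (simp add: continuous_character_def)
  have id: "id \<in> topspace (krull_topology K)"
    by (simp add: topspace_krull_topology galois_id)
  have "\<chi> id \<in> topspace (discrete_topology (- {0}))"
    using cont id continuous_map_image_subset_topspace by blast
  then have "openin (discrete_topology (- {0})) {\<chi> id}" by simp
  then have "openin (krull_topology K) {\<sigma> \<in> topspace (krull_topology K). \<chi> \<sigma> \<in> {\<chi> id}}"
    using cont openin_continuous_map_preimage by blast
  then obtain U where U: "openin (product_topology (\<lambda>_. discrete_topology UNIV) UNIV) U"
    and eq: "{\<sigma> \<in> galois_group K. \<chi> \<sigma> = \<chi> id} = U \<inter> galois_group K"
    unfolding topspace_krull_topology unfolding krull_topology_def openin_subtopology by auto
  have "id \<in> U" using eq galois_id by blast
  then obtain V where V: "finite {x. V x \<noteq> topspace (discrete_topology UNIV)}"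
      "id \<in> Pi\<^sub>E UNIV V" "Pi\<^sub>E UNIV V \<subseteq> U"
    using U unfolding openin_product_topology_alt by fastforce
  show thesis
  proof
    show "finite {x. V x \<noteq> UNIV}" using V(1) by simp
    fix \<sigma> assume \<sigma>: "\<sigma> \<in> galois_group K" and fixes_S: "\<And>x. x \<in> {x. V x \<noteq> UNIV} \<Longrightarrow> \<sigma> x = x"
    have "\<sigma> x \<in> V x" for x
    proof (cases "V x = UNIV")
      case False
      then have "\<sigma> x = x" using fixes_S by simp
      moreover have "id x \<in> V x" using V(2) by blast
      ultimately show ?thesis by simp
    qed simp
    then have "\<sigma> \<in> Pi\<^sub>E UNIV V" by (simp add: PiE_UNIV_domain)
    then show "\<chi> \<sigma> = \<chi> id" using V(3) eq \<sigma> by blast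
  qed
qed

text \<open>
  Let \<open>H\<close> be the kernel of \<open>\<chi>\<close> and let \<open>x\<^sub>0, x\<^sub>1, \<dots>\<close> be finitely many elements such that every
  automorphism fixing them is in \<open>H\<close>. The polynomial \<open>y = \<Sum> x\<^sub>i X\<^sup>i\<close> has a finite orbit under \<open>H\<close>, and
  the coefficients of \<open>\<Prod> (Y - h y)\<close>, the product over that orbit, are invariant under \<open>H\<close>. They lie in
  the field cut out by \<open>\<chi>\<close>, so \<open>\<rho>\<close> fixes them and permutes the roots. Thus \<open>\<rho> y = h y\<close> for some \<open>h\<close> in
  \<open>H\<close>, that is, \<open>\<rho>\<close> and \<open>h\<close> agree on all \<open>x\<^sub>i\<close>.
\<close>

lemma fixes_cut_out_field:
  assumes sep: "\<forall>x. separable_element K x" and chi: "continuous_character K \<chi>"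
    and rho: "\<rho> \<in> galois_group K" "\<And>x. x \<in> cut_out_field K \<chi> \<Longrightarrow> \<rho> x = x"
  shows "\<chi> \<rho> = 1"
proof -
  define H where "H = {\<sigma> \<in> galois_group K. \<chi> \<sigma> = 1}"
  obtain S where S: "finite S"
      "\<And>\<sigma>. \<sigma> \<in> galois_group K \<Longrightarrow> (\<And>x. x \<in> S \<Longrightarrow> \<sigma> x = x) \<Longrightarrow> \<chi> \<sigma> = \<chi> id"
    using continuous_character_nbhd[OF chi] by metis
  obtain xs where xs: "set xs = S" using finite_list[OF S(1)] by blast
  define y where "y \<sigma> = Poly (map \<sigma> xs)" for \<sigma> :: "'a \<Rightarrow> 'a"
  have H: "id \<in> H" "\<And>\<sigma> \<tau>. \<sigma> \<in> H \<Longrightarrow> \<tau> \<in> H \<Longrightarrow> \<sigma> \<circ> \<tau> \<in> H" and HG: "H \<subseteq> galois_group K"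
    by (auto simp: H_def galois_id galois_comp character_id[OF chi] character_comp[OF chi])
  have fin: "finite (y ` H)"
  proof -
    define R where "R = (\<Union>x\<in>S. (\<lambda>\<sigma>. \<sigma> x) ` galois_group K)"
    have "finite R" unfolding R_def using S(1) sep galois_orbit_finite by blast
    then have "finite {l. set l \<subseteq> R \<and> length l = length xs}" by (rule finite_lists_length_eq)
    moreover have "\<sigma> x \<in> R" if "\<sigma> \<in> H" "x \<in> S" for \<sigma> x
      using imageI[of \<sigma> "galois_group K" "\<lambda>\<sigma>. \<sigma> x"] that HG unfolding R_def by blast
    then have "(\<lambda>\<sigma>. map \<sigma> xs) ` H \<subseteq> {l. set l \<subseteq> R \<and> length l = length xs}"
      using xs by auto
    ultimately have "finite ((\<lambda>\<sigma>. map \<sigma> xs) ` H)" by (rule rev_finite_subset)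
    then have "finite (Poly ` (\<lambda>\<sigma>. map \<sigma> xs) ` H)" by (rule finite_imageI)
    then show ?thesis by (simp add: image_image y_def)
  qed
  define \<Omega> where "\<Omega> = (\<Prod>a\<in>y ` H. [:- a, 1:])"
  have map_y: "map_poly \<sigma> (y \<tau>) = y (\<sigma> \<circ> \<tau>)" if "\<sigma> \<in> galois_group K" for \<sigma> \<tau>
  proof (rule poly_eqI)
    have "\<sigma> 0 = 0" using that by (rule galois_simps)
    then show "coeff (map_poly \<sigma> (y \<tau>)) i = coeff (y (\<sigma> \<circ> \<tau>)) i" for i
      by (simp add: y_def coeff_map_poly coeff_Poly_eq nth_default_def)
  qed
  have inj: "inj (map_poly \<sigma>)" if "\<sigma> \<in> galois_group K" for \<sigma>
  proof (rule injI)
    fix p q assume eq: "map_poly \<sigma> p = map_poly \<sigma> q"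
    have 0: "\<sigma> 0 = 0" using that by (rule galois_simps)
    have "\<sigma> (coeff p i) = \<sigma> (coeff q i)" for i
      using arg_cong[OF eq, of "\<lambda>p. coeff p i"] by (simp add: coeff_map_poly 0)
    then show "p = q" using galois_eq_iff[OF that] by (intro poly_eqI) metis
  qed
  have invariant: "map_poly (map_poly \<sigma>) \<Omega> = \<Omega>" if "\<sigma> \<in> H" for \<sigma>
  proof -
    have G: "\<sigma> \<in> galois_group K" using that HG by blast
    note h1 = is_ring_hom_map_poly[OF galois_ring_hom[OF G]]
    note h2 = is_ring_hom_map_poly[OF h1]
    have "map_poly \<sigma> ` y ` H \<subseteq> y ` H"
      using map_y[OF G] H(2)[OF that] by auto
    moreover have i: "inj_on (map_poly \<sigma>) (y ` H)" using inj[OF G] inj_on_subset by blast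
    ultimately have im: "map_poly \<sigma> ` y ` H = y ` H" using endo_inj_surj[OF fin] by blast
    have "map_poly (map_poly \<sigma>) \<Omega> = (\<Prod>a\<in>y ` H. [:- map_poly \<sigma> a, 1:])"
      unfolding \<Omega>_def is_ring_hom_prod[OF h2]
      by (intro prod.cong refl)
        (simp add: map_poly_pCons is_ring_hom_simps[OF h1] galois_simps[OF G])
    also have "\<dots> = (\<Prod>a\<in>map_poly \<sigma> ` y ` H. [:- a, 1:])"
      using prod.reindex[OF i, of "\<lambda>a. [:- a, 1:]"] by (simp add: o_def)
    finally show ?thesis by (simp add: im \<Omega>_def)
  qed
  have "coeff (coeff \<Omega> i) j \<in> cut_out_field K \<chi>" for i j
    unfolding cut_out_field_def
  proof (intro CollectI ballI impI)
    fix \<sigma> assume \<sigma>: "\<sigma> \<in> galois_group K" "\<chi> \<sigma> = 1"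
    then have "map_poly (map_poly \<sigma>) \<Omega> = \<Omega>" using invariant by (simp add: H_def)
    from arg_cong[OF this, of "\<lambda>P. coeff (coeff P i) j"]
    show "\<sigma> (coeff (coeff \<Omega> i) j) = coeff (coeff \<Omega> i) j"
      by (simp add: coeff_map_poly galois_simps[OF \<sigma>(1)])
  qed
  then have fixed: "map_poly (map_poly \<rho>) \<Omega> = \<Omega>"
    by (intro poly_eqI) (simp add: coeff_map_poly galois_simps[OF rho(1)] rho(2))
  note h = is_ring_hom_map_poly[OF galois_ring_hom[OF rho(1)]]
  have "poly \<Omega> (y id) = 0"
    using H(1) fin by (auto simp: \<Omega>_def poly_prod)
  then have "poly \<Omega> (map_poly \<rho> (y id)) = 0"
    using poly_map_poly_hom[OF h, of \<Omega> "y id"] fixed by (simp add: is_ring_hom_simps[OF h])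
  then have "poly \<Omega> (y \<rho>) = 0" using map_y[OF rho(1), of id] by simp
  then obtain \<sigma> where \<sigma>: "\<sigma> \<in> H" "y \<rho> = y \<sigma>"
    using fin by (auto simp: \<Omega>_def poly_prod)
  have agree: "\<rho> x = \<sigma> x" if "x \<in> S" for x
  proof -
    have "x \<in> set xs" using that xs by simp
    then obtain i where i: "i < length xs" "xs ! i = x"
      unfolding in_set_conv_nth by blast
    from arg_cong[OF \<sigma>(2), of "\<lambda>p. coeff p i"] show ?thesis
      using i by (simp add: y_def coeff_Poly_eq nth_default_def)
  qed
  have G: "\<sigma> \<in> galois_group K" and s1: "\<chi> \<sigma> = 1" using \<sigma>(1) by (simp_all add: H_def)
  have G': "inv \<sigma> \<circ> \<rho> \<in> galois_group K" using galois_comp[OF galois_inv(1)[OF G] rho(1)] .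
  have "\<chi> (inv \<sigma> \<circ> \<rho>) = \<chi> id"
    by (rule S(2)[OF G']) (simp add: agree galois_inv(3)[OF G])
  then have "\<chi> (\<sigma> \<circ> (inv \<sigma> \<circ> \<rho>)) = 1"
    using character_comp[OF chi G G'] s1 character_id[OF chi] by simp
  moreover have "\<sigma> \<circ> (inv \<sigma> \<circ> \<rho>) = \<rho>" by (auto simp: galois_inv(2)[OF G])
  ultimately show ?thesis by simp
qed

section \<open>The fixed field of the Galois group\<close>

text \<open>
  The graph of a homomorphism over \<open>K\<close> from a subring that contains \<open>K\<close> into the whole field. As a
  graph it is a subring of the product ring in which \<open>0\<close> has only the partner \<open>0\<close>, and extension is
  inclusion, so that unions of chains are immediate.
\<close>

definition partial_automorphism :: "'s::field set \<Rightarrow> ('s \<times> 's) set \<Rightarrow> bool" where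
  "partial_automorphism K g \<longleftrightarrow> (\<forall>k\<in>K. (k, k) \<in> g) \<and>
     (\<forall>x y x' y'. (x, y) \<in> g \<and> (x', y') \<in> g \<longrightarrow> (x + x', y + y') \<in> g \<and> (x * x', y * y') \<in> g) \<and>
     (\<forall>y. (0, y) \<in> g \<longrightarrow> y = 0)"

text \<open>
  \<open>Q\<close> is the image of \<open>P\<close> under the homomorphism with graph \<open>g\<close>, applied to the coefficients.
\<close>

definition poly_pair :: "('s::field \<times> 's) set \<Rightarrow> 's poly \<Rightarrow> 's poly \<Rightarrow> bool" where
  "poly_pair g P Q \<longleftrightarrow> (\<forall>i. (coeff P i, coeff Q i) \<in> g)"

locale partial_aut =
  fixes K :: "'s::field set" and g :: "('s \<times> 's) set"
  assumes K: "is_subfield K" and g: "partial_automorphism K g"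
begin

lemma in_K: "0 \<in> K" "1 \<in> K" "x \<in> K \<Longrightarrow> - x \<in> K" "x \<in> K \<Longrightarrow> inverse x \<in> K"
  using K by (auto simp: is_subfield_def)

lemma const: "k \<in> K \<Longrightarrow> (k, k) \<in> g"
  and add: "(x, y) \<in> g \<Longrightarrow> (x', y') \<in> g \<Longrightarrow> (x + x', y + y') \<in> g"
  and mult: "(x, y) \<in> g \<Longrightarrow> (x', y') \<in> g \<Longrightarrow> (x * x', y * y') \<in> g"
  and zero: "(0, y) \<in> g \<Longrightarrow> y = 0"
  using g by (auto simp: partial_automorphism_def)

lemma minus: "(x, y) \<in> g \<Longrightarrow> (- x, - y) \<in> g"
  using mult[OF const[OF in_K(3)[OF in_K(2)]], of x y] by simp

lemma diff: "(x, y) \<in> g \<Longrightarrow> (x', y') \<in> g \<Longrightarrow> (x - x', y - y') \<in> g"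
  using add[OF _ minus, of x y x' y'] by simp

lemma unique: "(x, y) \<in> g \<Longrightarrow> (x, y') \<in> g \<Longrightarrow> y = y'"
  using diff[of x y x y'] zero[of "y - y'"] by simp

lemma sum: "(\<And>i. i \<in> A \<Longrightarrow> (p i, q i) \<in> g) \<Longrightarrow> (sum p A, sum q A) \<in> g"
  by (induction A rule: infinite_finite_induct) (auto intro: add const in_K)

lemma pair_add: "poly_pair g P Q \<Longrightarrow> poly_pair g P' Q' \<Longrightarrow> poly_pair g (P + P') (Q + Q')"
  by (simp add: poly_pair_def add)

lemma pair_diff: "poly_pair g P Q \<Longrightarrow> poly_pair g P' Q' \<Longrightarrow> poly_pair g (P - P') (Q - Q')"
  by (simp add: poly_pair_def diff)

lemma pair_mult: "poly_pair g P Q \<Longrightarrow> poly_pair g P' Q' \<Longrightarrow> poly_pair g (P * P') (Q * Q')"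
  by (auto simp: poly_pair_def coeff_mult intro!: sum mult)

lemma pair_smult: "(a, b) \<in> g \<Longrightarrow> poly_pair g P Q \<Longrightarrow> poly_pair g (smult a P) (smult b Q)"
  by (simp add: poly_pair_def mult)

lemma pair_monom: "(a, b) \<in> g \<Longrightarrow> poly_pair g (monom a n) (monom b n)"
  by (simp add: poly_pair_def const in_K)

lemma pair_const: "(a, b) \<in> g \<Longrightarrow> poly_pair g [:a:] [:b:]"
  using pair_monom[of a b 0] by (simp add: monom_0)

lemma pair_X: "poly_pair g [:0, 1:] [:0, 1:]"
  using pair_monom[OF const[OF in_K(2)], of 1] by (simp add: monom_altdef)

lemma pair_K: "(\<And>i. coeff P i \<in> K) \<Longrightarrow> poly_pair g P P"
  by (simp add: poly_pair_def const)

lemma pair_0: "poly_pair g 0 Q \<Longrightarrow> Q = 0"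
  by (auto simp: poly_pair_def poly_eq_iff dest: zero)

lemma pair_eval:
  assumes xy: "(x, y) \<in> g"
  shows "poly_pair g P Q \<Longrightarrow> (poly P x, poly Q y) \<in> g"
proof (induction P arbitrary: Q)
  case 0
  then show ?case using pair_0[of Q] const in_K by auto
next
  case (pCons a P)
  obtain b Q' where Q: "Q = pCons b Q'" by (cases Q)
  have c: "(coeff (pCons a P) i, coeff Q i) \<in> g" for i
    using pCons.prems by (simp add: poly_pair_def)
  have "(a, b) \<in> g" using c[of 0] by (simp add: Q)
  moreover have "poly_pair g P Q'"
    unfolding poly_pair_def using c[of "Suc _"] by (simp add: Q)
  then have "(poly P x, poly Q' y) \<in> g" by (rule pCons.IH)
  ultimately show ?case by (simp add: Q add mult xy)
qed

text \<open>
  A subring of an algebraic extension that contains the base field is a field: in a relation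
  \<open>a + x r(x) = 0\<close> of least degree the constant \<open>a\<close> is not zero, and \<open>1/x = - r(x)/a\<close>. The same
  relation holds for the partner \<open>y\<close>.
\<close>

lemma inverse_pair:
  assumes "separable_element K x" and xy: "(x, y) \<in> g" and x: "x \<noteq> 0"
  shows "(inverse x, inverse y) \<in> g"
proof -
  define A where "A p \<longleftrightarrow> (\<forall>i. coeff p i \<in> K) \<and> p \<noteq> 0 \<and> poly p x = 0" for p
  have "\<exists>p. A p"
    using assms(1) separable_poly_nonzero by (auto simp: separable_element_def A_def)
  then obtain p where p: "A p" and min: "\<And>q. degree q < degree p \<Longrightarrow> \<not> A q"
    using ex_has_least_nat[of A _ degree] by (metis leD)
  obtain a r where pr: "p = pCons a r" by (cases p)
  have K': "coeff r i \<in> K" for i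
    using p coeff_pCons_Suc[of a r i] unfolding A_def pr by metis
  have aK: "a \<in> K" using p coeff_pCons_0[of a r] unfolding A_def pr by metis
  have a0: "a \<noteq> 0"
  proof
    assume "a = 0"
    then have "r \<noteq> 0" "poly r x = 0" using p x by (auto simp: A_def pr)
    then have "A r" using K' by (simp add: A_def)
    moreover have "degree r < degree p" using \<open>r \<noteq> 0\<close> by (simp add: pr)
    ultimately show False using min by blast
  qed
  have r: "(poly r x, poly r y) \<in> g" by (rule pair_eval[OF xy pair_K[OF K']])
  have "(poly p x, poly p y) \<in> g"
    by (rule pair_eval[OF xy pair_K]) (use p in \<open>simp add: A_def\<close>)
  moreover have "poly p x = 0" using p by (simp add: A_def)
  ultimately have "poly p y = 0" using zero by simp
  then have "a + x * poly r x = 0" "a + y * poly r y = 0"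
    using \<open>poly p x = 0\<close> by (simp_all add: pr)
  then have xr: "x * poly r x = - a" and yr: "y * poly r y = - a"
    by (simp_all add: eq_neg_iff_add_eq_0 add.commute)
  have "x * (poly r x * - inverse a) = 1" "y * (poly r y * - inverse a) = 1"
    using xr yr a0 by (simp_all flip: mult.assoc)
  then have "inverse x = poly r x * - inverse a" "inverse y = poly r y * - inverse a"
    by (simp_all only: inverse_unique)
  moreover have "(- inverse a, - inverse a) \<in> g" using aK by (intro const in_K)
  ultimately show ?thesis
    using mult[OF r, of "- inverse a" "- inverse a"] by (simp only:)
qed

lemma zero_iff:
  assumes "separable_element K x" "(x, 0) \<in> g"
  shows "x = 0"
proof (rule ccontr)
  assume "x \<noteq> 0"
  then have "(inverse x * x, inverse 0 * 0) \<in> g"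
    by (intro mult inverse_pair[OF assms] assms(2))
  then have "(1 - 1, 0 - 1) \<in> g" using \<open>x \<noteq> 0\<close> by (intro diff const in_K) simp
  then show False using zero[of "- 1"] by simp
qed

text \<open>
  \<open>M\<close> is the minimal polynomial of \<open>z\<close> over the domain of the homomorphism, and \<open>M'\<close> is its image.
  Division by \<open>M\<close> can be carried out on both coordinates at once, so the image of every polynomial
  that vanishes at \<open>z\<close> is a multiple of \<open>M'\<close>. In particular \<open>M'\<close> divides the separable polynomial over
  \<open>K\<close> that has \<open>z\<close> as a root.
\<close>

lemma minimal_pair:
  assumes sep: "\<forall>x. separable_element K x"
  obtains M M' where "poly_pair g M M'" "poly M z = 0" "separable_poly M'"
    "degree M' = degree M" "degree M > 0" "lead_coeff M = 1"
    "\<forall>P Q. poly_pair g P Q \<longrightarrow> poly P z = 0 \<longrightarrow> M' dvd Q"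
proof -
  define A where "A P \<longleftrightarrow> P \<noteq> 0 \<and> poly P z = 0 \<and> (\<exists>Q. poly_pair g P Q)" for P
  obtain p where pK: "\<And>i. coeff p i \<in> K" and p: "separable_poly p" "poly p z = 0"
    using sep by (auto simp: separable_element_def)
  have "A p" using separable_poly_nonzero[OF p(1)] p(2) pair_K[OF pK] by (auto simp: A_def)
  then obtain P0 where P0: "A P0" and min: "\<And>P. degree P < degree P0 \<Longrightarrow> \<not> A P"
    using ex_has_least_nat[of A _ degree] by (metis leD)
  obtain Q0 where Q0: "poly_pair g P0 Q0" using P0 by (auto simp: A_def)
  define a where "a = lead_coeff P0"
  define b where "b = coeff Q0 (degree P0)"
  have a0: "a \<noteq> 0" using P0 by (simp add: a_def A_def)
  have ab: "(a, b) \<in> g" using Q0 by (simp add: poly_pair_def a_def b_def)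
  have inv: "(inverse a, inverse b) \<in> g" using sep ab a0 by (intro inverse_pair) auto
  define M where "M = smult (inverse a) P0"
  define M' where "M' = smult (inverse b) Q0"
  have pair: "poly_pair g M M'" unfolding M_def M'_def by (rule pair_smult[OF inv Q0])
  have dM: "degree M = degree P0" using a0 by (simp add: M_def)
  have lM: "lead_coeff M = 1" using a0 by (simp add: M_def a_def)
  have zM: "poly M z = 0" using P0 by (simp add: M_def A_def)
  \<comment> \<open>the leading coefficient of the monic polynomial survives, so the degree does not drop\<close>
  have lM': "coeff M' (degree M) = 1"
  proof -
    have "(lead_coeff M, coeff M' (degree M)) \<in> g" using pair by (simp add: poly_pair_def)
    then show ?thesis using unique[OF _ const[OF in_K(2)]] by (simp add: lM)
  qed
  have hM': "coeff M' i = 0" if "i > degree M" for i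
    using zero[of "coeff M' i"] pair coeff_eq_0[OF that] by (metis poly_pair_def)
  have dM': "degree M' = degree M"
    using lM' hM' by (intro antisym degree_le le_degree) auto
  have dvd: "M' dvd Q" if "poly_pair g P Q" "poly P z = 0" for P Q
    using that
  proof (induction "degree P" arbitrary: P Q rule: less_induct)
    case less
    show ?case
    proof (cases "P = 0")
      case True
      then have "Q = 0" using less.prems(1) pair_0 by blast
      then show ?thesis by simp
    next
      case False
      have "degree M \<le> degree P"
        using min[of P] False less.prems dM by (auto simp: A_def not_less[symmetric])
      define k where "k = degree P - degree M"
      define c where "c = lead_coeff P"
      define d where "d = coeff Q (degree P)"
      have cd: "(c, d) \<in> g" using less.prems(1) by (simp add: c_def d_def poly_pair_def)
      define P2 where "P2 = P - monom c k * M"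
      define Q2 where "Q2 = Q - monom d k * M'"
      have pair2: "poly_pair g P2 Q2"
        unfolding P2_def Q2_def by (intro pair_diff pair_mult pair_monom less.prems cd pair)
      have z2: "poly P2 z = 0" using less.prems(2) zM by (simp add: P2_def)
      have "M' dvd Q2"
      proof (cases "P2 = 0")
        case True
        then have "Q2 = 0" using pair2 pair_0 by blast
        then show ?thesis by simp
      next
        case nz: False
        have "degree (monom c k * M) \<le> degree P"
          using degree_mult_le[of "monom c k" M] degree_monom_le[of c k] \<open>degree M \<le> degree P\<close>
          by (simp add: k_def)
        then have le: "degree P2 \<le> degree P" unfolding P2_def by (intro degree_diff_le) simp_all
        have "coeff P2 (degree P) = 0"
          using \<open>degree M \<le> degree P\<close> lM by (simp add: P2_def coeff_monom_mult k_def c_def)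
        then have "degree P2 \<noteq> degree P" using nz by (metis leading_coeff_0_iff)
        then have "degree P2 < degree P" using le by simp
        then show ?thesis using less.hyps pair2 z2 by blast
      qed
      then have "M' dvd Q2 + monom d k * M'" by (intro dvd_add) simp_all
      then show ?thesis by (simp add: Q2_def)
    qed
  qed
  have "M' dvd p" by (rule dvd[OF pair_K[OF pK] p(2)])
  then have sepM': "separable_poly M'" by (rule separable_poly_dvd[OF p(1)])
  have "degree M > 0"
  proof (rule ccontr)
    assume "\<not> degree M > 0"
    then have "M = [:1:]" using lM by (metis degree_eq_zeroE lead_coeff_pCons(2) neq0_conv pCons_0_0 coeff_pCons_0)
    then show False using zM by simp
  qed
  with pair zM sepM' dM' lM dvd show thesis using that[of M M'] by blast
qed

definition adjoin_pair :: "'s \<Rightarrow> 's \<Rightarrow> ('s \<times> 's) set" where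
  "adjoin_pair z y = {(poly P z, poly Q y) | P Q. poly_pair g P Q}"

text \<open>
  Sending \<open>P(z)\<close> to \<open>Q(y)\<close> is well defined as soon as relations on \<open>z\<close> go to relations on \<open>y\<close>.
\<close>

lemma adjoin_pair:
  assumes "\<And>P Q. poly_pair g P Q \<Longrightarrow> poly P z = 0 \<Longrightarrow> poly Q y = 0"
  shows "partial_automorphism K (adjoin_pair z y)" "g \<subseteq> adjoin_pair z y" "(z, y) \<in> adjoin_pair z y"
proof -
  have intro: "(poly P z, poly Q y) \<in> adjoin_pair z y" if "poly_pair g P Q" for P Q
    using that by (auto simp: adjoin_pair_def)
  show sub: "g \<subseteq> adjoin_pair z y"
    using intro[OF pair_const] by auto
  show "(z, y) \<in> adjoin_pair z y" using intro[OF pair_X] by simp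
  have "(x + x', w + w') \<in> adjoin_pair z y" "(x * x', w * w') \<in> adjoin_pair z y"
    if xw: "(x, w) \<in> adjoin_pair z y" "(x', w') \<in> adjoin_pair z y" for x w x' w'
  proof -
    obtain P Q P' Q' where "x = poly P z" "w = poly Q y" "x' = poly P' z" "w' = poly Q' y"
      and "poly_pair g P Q" "poly_pair g P' Q'"
      using xw by (auto simp: adjoin_pair_def)
    then show "(x + x', w + w') \<in> adjoin_pair z y" "(x * x', w * w') \<in> adjoin_pair z y"
      using intro[OF pair_add] intro[OF pair_mult] by (auto simp: poly_add poly_mult)
  qed
  moreover have "w = 0" if "(0, w) \<in> adjoin_pair z y" for w
    using that assms by (auto simp: adjoin_pair_def)
  moreover have "(k, k) \<in> adjoin_pair z y" if "k \<in> K" for k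
    using sub const[OF that] by blast
  ultimately show "partial_automorphism K (adjoin_pair z y)"
    unfolding partial_automorphism_def by blast
qed

end

text \<open>
  A maximal extension is defined everywhere, since the image \<open>M'\<close> of a minimal polynomial is separable
  and so has a root. It is surjective because it permutes the finite set of roots of each polynomial
  over \<open>K\<close>.
\<close>

lemma partial_automorphism_extends:
  fixes K :: "'s::field set"
  assumes S: "separable_closure_of K" and g: "partial_automorphism K g"
  shows "\<exists>\<sigma>\<in>galois_group K. \<forall>(x, y)\<in>g. \<sigma> x = y"
proof -
  have K: "is_subfield K" and sep: "\<forall>x. separable_element K x"
    and closed: "\<And>p::'s poly. separable_poly p \<Longrightarrow> degree p > 0 \<Longrightarrow> \<exists>x. poly p x = 0"
    using S by (auto simp: separable_closure_of_def separably_closed_def)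
  define A where "A = {h. partial_automorphism K h \<and> g \<subseteq> h}"
  have "\<exists>m\<in>A. \<forall>h\<in>A. m \<subseteq> h \<longrightarrow> h = m"
  proof (rule subset_Zorn_nonempty)
    show "A \<noteq> {}" using g by (auto simp: A_def)
    fix C assume C: "C \<noteq> {}" "subset.chain A C"
    have CA: "C \<subseteq> A" and chain: "\<And>X Y. X \<in> C \<Longrightarrow> Y \<in> C \<Longrightarrow> X \<subseteq> Y \<or> Y \<subseteq> X"
      using C(2) by (auto simp: subset_chain_def)
    have pa: "partial_automorphism K h" if "h \<in> C" for h using CA that by (auto simp: A_def)
    obtain h0 where h0: "h0 \<in> C" using C(1) by blast
    have two: "\<exists>h\<in>C. a \<in> h \<and> b \<in> h" if ab: "a \<in> \<Union>C" "b \<in> \<Union>C" for a b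
    proof -
      obtain X Y where XY: "X \<in> C" "Y \<in> C" "a \<in> X" "b \<in> Y" using ab by blast
      then show ?thesis using chain[of X Y] by blast
    qed
    have "partial_automorphism K (\<Union>C)"
      unfolding partial_automorphism_def
    proof (intro conjI allI ballI impI)
      show "(k, k) \<in> \<Union>C" if "k \<in> K" for k
        using pa[OF h0] h0 that by (auto simp: partial_automorphism_def)
      show "(x + x', y + y') \<in> \<Union>C" "(x * x', y * y') \<in> \<Union>C"
        if "(x, y) \<in> \<Union>C \<and> (x', y') \<in> \<Union>C" for x y x' y'
      proof -
        have "\<exists>h\<in>C. (x, y) \<in> h \<and> (x', y') \<in> h" using that by (intro two) auto
        then obtain h where h: "h \<in> C" "(x, y) \<in> h" "(x', y') \<in> h" by blast
        have "(x + x', y + y') \<in> h" "(x * x', y * y') \<in> h"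
          using pa[OF h(1)] h(2,3) by (simp_all add: partial_automorphism_def)
        then show "(x + x', y + y') \<in> \<Union>C" "(x * x', y * y') \<in> \<Union>C" using h(1) by blast+
      qed
      show "y = 0" if "(0, y) \<in> \<Union>C" for y
        using that pa by (auto simp: partial_automorphism_def)
    qed
    moreover have "g \<subseteq> \<Union>C" using h0 CA by (auto simp: A_def)
    ultimately show "\<Union>C \<in> A" by (simp add: A_def)
  qed
  then obtain m where "m \<in> A" and maxA: "\<And>h. h \<in> A \<Longrightarrow> m \<subseteq> h \<Longrightarrow> h = m" by blast
  then have m: "partial_automorphism K m" "g \<subseteq> m" by (simp_all add: A_def)
  have max: "h = m" if "partial_automorphism K h" "m \<subseteq> h" for h
    using maxA[of h] that m(2) by (simp add: A_def)
  interpret partial_aut K m using K m(1) by unfold_locales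
  have total: "\<exists>y. (z, y) \<in> m" for z
  proof -
    obtain M M' where "poly_pair m M M'" "poly M z = 0"
      and M: "separable_poly M'" "degree M' = degree M" "degree M > 0" and "lead_coeff M = 1"
      and dvd: "\<forall>P Q. poly_pair m P Q \<longrightarrow> poly P z = 0 \<longrightarrow> M' dvd Q"
      using minimal_pair[OF sep, of z] by blast
    obtain y where "poly M' y = 0" using closed[OF M(1)] M(2,3) by auto
    then have *: "poly Q y = 0" if "M' dvd Q" for Q
      using that by (auto elim!: dvdE)
    have root: "poly Q y = 0" if "poly_pair m P Q" "poly P z = 0" for P Q
      by (rule *) (use dvd that in blast)
    have "adjoin_pair z y = m" by (rule max; rule adjoin_pair; rule root)
    moreover have "(z, y) \<in> adjoin_pair z y" by (rule adjoin_pair; rule root)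
    ultimately show ?thesis by blast
  qed
  define \<sigma> where "\<sigma> z = (SOME y. (z, y) \<in> m)" for z
  have graph: "(z, \<sigma> z) \<in> m" for z
    unfolding \<sigma>_def using someI_ex[OF total] .
  have val: "\<sigma> z = y" if "(z, y) \<in> m" for z y using unique[OF graph that] .
  have add\<sigma>: "\<sigma> (x + y) = \<sigma> x + \<sigma> y" and mult\<sigma>: "\<sigma> (x * y) = \<sigma> x * \<sigma> y" for x y
    using val add[OF graph graph] mult[OF graph graph] by blast+
  have fix\<sigma>: "\<sigma> x = x" if "x \<in> K" for x using val const[OF that] by blast
  have inj: "inj \<sigma>"
  proof (rule injI)
    fix x y assume "\<sigma> x = \<sigma> y"
    then have "(x - y, 0) \<in> m" using diff[OF graph graph, of x y] by simp
    then show "x = y" using zero_iff[of "x - y"] sep by simp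
  qed
  have "y \<in> range \<sigma>" for y
  proof -
    obtain p where pK: "\<And>i. coeff p i \<in> K" and p: "separable_poly p" "poly p y = 0"
      using sep by (auto simp: separable_element_def)
    define R where "R = {x. poly p x = 0}"
    have fin: "finite R" unfolding R_def
      by (rule poly_roots_finite[OF separable_poly_nonzero[OF p(1)]])
    have "\<sigma> ` R \<subseteq> R"
    proof
      fix w assume "w \<in> \<sigma> ` R"
      then obtain x where x: "w = \<sigma> x" "poly p x = 0" by (auto simp: R_def)
      have "(poly p x, poly p w) \<in> m" unfolding x(1) by (rule pair_eval[OF graph pair_K[OF pK]])
      then show "w \<in> R" using x(2) zero by (simp add: R_def)
    qed
    then have "\<sigma> ` R = R" using fin inj by (intro endo_inj_surj) (auto intro: inj_on_subset)
    moreover have "y \<in> R" using p by (simp add: R_def)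
    ultimately show ?thesis by blast
  qed
  then have "bij \<sigma>" using inj by (auto simp: bij_def)
  then have "\<sigma> \<in> galois_group K" using add\<sigma> mult\<sigma> fix\<sigma> by (simp add: galois_group_def)
  then show ?thesis using val m(2) by (intro bexI) auto
qed

text \<open>
  If \<open>x\<close> is not in \<open>K\<close>, its minimal polynomial is separable of degree at least two and has a second
  root \<open>y\<close>; the homomorphism \<open>x \<mapsto> y\<close> over \<open>K\<close> extends to an automorphism.
\<close>

lemma galois_fixed_field:
  fixes K :: "'s::field set"
  assumes S: "separable_closure_of K" and fixed: "\<And>\<sigma>. \<sigma> \<in> galois_group K \<Longrightarrow> \<sigma> x = x"
  shows "x \<in> K"
proof (rule ccontr)
  assume x: "x \<notin> K"
  have K: "is_subfield K" and sep: "\<forall>x. separable_element K x"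
    and closed: "\<And>p::'s poly. separable_poly p \<Longrightarrow> degree p > 0 \<Longrightarrow> \<exists>x. poly p x = 0"
    using S by (auto simp: separable_closure_of_def separably_closed_def)
  interpret partial_aut K "Id_on K"
    using K by unfold_locales (auto simp: partial_automorphism_def is_subfield_def)
  obtain M M' where pair: "poly_pair (Id_on K) M M'" and M: "poly M x = 0" "separable_poly M'"
      "degree M' = degree M" "degree M > 0" "lead_coeff M = 1"
      "\<forall>P Q. poly_pair (Id_on K) P Q \<longrightarrow> poly P x = 0 \<longrightarrow> M' dvd Q"
    using minimal_pair[OF sep, of x] by blast
  have in_Id: "(coeff M i, coeff M' i) \<in> Id_on K" for i using pair by (simp add: poly_pair_def)
  have MK: "coeff M i \<in> K" for i using in_Id[of i] by blast
  have "coeff M' i = coeff M i" for i using in_Id[of i] by blast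
  then have M': "M' = M" by (rule poly_eqI)
  obtain r where r: "M = [:- x, 1:] * r" using M(1) by (auto simp: poly_eq_0_iff_dvd)
  have "r \<noteq> 0" using M(4) r by auto
  then have deg: "degree M = Suc (degree r)" unfolding r by (subst degree_mult_eq) auto
  have "degree r > 0"
  proof (rule ccontr)
    assume "\<not> degree r > 0"
    then obtain a where "r = [:a:]" by (metis degree_eq_zeroE neq0_conv)
    moreover from this have "a = 1" using M(5) \<open>r \<noteq> 0\<close> by (simp add: r)
    ultimately have "coeff M 0 = - x" by (simp add: r)
    then show False using MK[of 0] in_K(3)[of "- x"] x by simp
  qed
  moreover have "separable_poly r"
    using separable_poly_dvd[OF M(2)[unfolded M']] dvd_triv_right unfolding r by blast
  ultimately obtain y where y: "poly r y = 0" using closed by blast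
  have "y \<noteq> x"
  proof
    assume "y = x"
    then have "[:- x, 1:] dvd r" using y by (simp add: poly_eq_0_iff_dvd)
    moreover have "pderiv M = [:- x, 1:] * pderiv r + r"
      unfolding r pderiv_mult by (simp add: pderiv_pCons)
    ultimately have "[:- x, 1:] dvd pderiv M" by (simp only: dvd_add dvd_triv_left)
    moreover have "[:- x, 1:] dvd M" unfolding r by (rule dvd_triv_left)
    ultimately have "is_unit [:- x, 1:]"
      using M(2) unfolding M' separable_poly_def coprime_def by blast
    then show False by (simp add: is_unit_iff_degree)
  qed
  have root: "poly Q y = 0" if "poly_pair (Id_on K) P Q" "poly P x = 0" for P Q
  proof -
    have "M dvd Q" using M(6) that M' by blast
    then show ?thesis using y by (auto simp: r elim!: dvdE)
  qed
  have ext: "partial_automorphism K (adjoin_pair x y)" "(x, y) \<in> adjoin_pair x y"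
    by (rule adjoin_pair, rule root, assumption, assumption)
      (rule adjoin_pair, rule root, assumption, assumption)
  obtain \<sigma> where "\<sigma> \<in> galois_group K" "\<forall>(a, b)\<in>adjoin_pair x y. \<sigma> a = b"
    using partial_automorphism_extends[OF S ext(1)] by blast
  then have "\<sigma> x = y" using ext(2) by auto
  moreover have "\<sigma> x = x" using fixed \<open>\<sigma> \<in> galois_group K\<close> by blast
  ultimately show False using \<open>y \<noteq> x\<close> by simp
qed

section \<open>Chords, tangents and addition of points\<close>

lemma Affine_in_curve_points [simp]:
  "Affine x y \<in> curve_points W \<longleftrightarrow> weierstrass_poly W x y = 0"
  by (auto simp: curve_points_def)

lemma Infinity_in_curve_points [simp]: "Infinity \<in> curve_points W"
  by (simp add: curve_points_def)

lemma point_neg_in_curve_points [simp]: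
  "point_neg W P \<in> curve_points W \<longleftrightarrow> P \<in> curve_points W"
proof (cases P)
  case (Affine x y)
  have "weierstrass_poly W x (- y - a1 W * x - a3 W) = weierstrass_poly W x y"
    unfolding weierstrass_poly_def by algebra
  then show ?thesis by (simp add: Affine)
qed simp

lemma point_neg_neg [simp]: "point_neg W (point_neg W P) = P"
  by (cases P) simp_all

lemma same_abscissa:
  assumes "weierstrass_poly W x y = 0" "weierstrass_poly W x y' = 0"
  shows "y' = y \<or> y' = - y - a1 W * x - a3 W"
proof -
  have "(y' - y) * (y' - (- y - a1 W * x - a3 W)) = 0"
    using assms unfolding weierstrass_poly_def by algebra
  then show ?thesis by auto
qed

text \<open>
  The result of adding the points with abscissas \<open>x1\<close> and \<open>x2\<close> on the line of slope \<open>l\<close> through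
  \<open>(x1, y1)\<close>. Chords and tangents share this formula; they differ only in the equation for \<open>l\<close>, which
  is kept free of division.
\<close>

definition chord_point :: "'s::field weierstrass \<Rightarrow> 's \<Rightarrow> 's \<Rightarrow> 's \<Rightarrow> 's \<Rightarrow> 's point" where
  "chord_point W l x1 y1 x2 =
    (let x3 = l ^ 2 + a1 W * l - a2 W - x1 - x2
     in point_neg W (Affine x3 (y1 + l * (x3 - x1))))"

lemma point_add_chord:
  assumes "x1 \<noteq> x2" "l * (x2 - x1) = y2 - y1"
  shows "point_add W (Affine x1 y1) (Affine x2 y2) = chord_point W l x1 y1 x2"
proof -
  have "(y2 - y1) / (x2 - x1) = l" using assms by (simp add: field_simps)
  then show ?thesis using assms(1) by (simp add: chord_point_def Let_def)
qed

lemma point_add_tangent: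
  assumes "2 * y + a1 W * x + a3 W \<noteq> 0"
    and "l * (2 * y + a1 W * x + a3 W) = 3 * x ^ 2 + 2 * a2 W * x + a4 W - a1 W * y"
  shows "point_add W (Affine x y) (Affine x y) = chord_point W l x y x"
proof -
  have "(3 * x ^ 2 + 2 * a2 W * x + a4 W - a1 W * y) / (2 * y + a1 W * x + a3 W) = l"
    using assms by (simp add: field_simps)
  moreover have "y \<noteq> - y - a1 W * x - a3 W"
    using assms(1) by (auto simp: algebra_simps)
  ultimately show ?thesis by (simp add: chord_point_def Let_def)
qed

lemma point_add_cases:
  assumes "P \<in> curve_points W" "Q \<in> curve_points W"
  obtains "P = Infinity" | "Q = Infinity" | "Q = point_neg W P"
  | x1 y1 x2 y2 l where "P = Affine x1 y1" "Q = Affine x2 y2" "x1 \<noteq> x2" "l * (x2 - x1) = y2 - y1"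
  | x y l where "P = Affine x y" "Q = Affine x y" "2 * y + a1 W * x + a3 W \<noteq> 0"
      "l * (2 * y + a1 W * x + a3 W) = 3 * x ^ 2 + 2 * a2 W * x + a4 W - a1 W * y"
proof (cases P)
  case P: (Affine x1 y1)
  show thesis
  proof (cases Q)
    case Q: (Affine x2 y2)
    show thesis
    proof (cases "x1 = x2")
      case False
      then have "(y2 - y1) / (x2 - x1) * (x2 - x1) = y2 - y1" by simp
      then show thesis using that(4) P Q False by blast
    next
      case True
      then have y: "y2 = y1 \<or> y2 = - y1 - a1 W * x1 - a3 W"
        using same_abscissa[of W x1 y1 y2] assms P Q by simp
      show thesis
      proof (cases "y2 = - y1 - a1 W * x1 - a3 W")
        case True
        then show thesis using that(3) P Q \<open>x1 = x2\<close> by simp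
      next
        case neq: False
        then have "y2 = y1" using y by simp
        with neq have nz: "2 * y1 + a1 W * x1 + a3 W \<noteq> 0" by algebra
        then have "(3 * x1 ^ 2 + 2 * a2 W * x1 + a4 W - a1 W * y1) / (2 * y1 + a1 W * x1 + a3 W)
            * (2 * y1 + a1 W * x1 + a3 W) = 3 * x1 ^ 2 + 2 * a2 W * x1 + a4 W - a1 W * y1"
          by simp
        then show thesis using that(5) P Q \<open>y2 = y1\<close> \<open>x1 = x2\<close> nz by blast
      qed
    qed
  qed (use that in simp)
qed (use that in simp)

lemma point_add_Infinity_right [simp]: "point_add W P Infinity = P"
  by (cases P) simp_all

lemma point_add_neg [simp]: "point_add W P (point_neg W P) = Infinity"
  by (cases P) simp_all

lemma point_add_commute:
  assumes "P \<in> curve_points W" "Q \<in> curve_points W"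
  shows "point_add W P Q = point_add W Q P"
  using assms
proof (cases rule: point_add_cases)
  case 3
  then show ?thesis using point_add_neg[of W Q] by simp
next
  case (4 x1 y1 x2 y2 l)
  have "l * (x1 - x2) = y1 - y2" using 4(4) by algebra
  then have "point_add W Q P = chord_point W l x2 y2 x1"
    unfolding 4(1,2) using 4(3) by (intro point_add_chord) auto
  also have "\<dots> = chord_point W l x1 y1 x2"
  proof -
    have "y2 = y1 + l * (x2 - x1)" using 4(4) by simp
    then show ?thesis by (simp add: chord_point_def Let_def algebra_simps)
  qed
  finally show ?thesis using point_add_chord[OF 4(3,4), of W] by (simp only: 4(1,2))
qed auto

text \<open>
  Restricted to the line, the equation of the curve becomes a monic cubic in \<open>x\<close> up to sign. The
  hypothesis \<open>key\<close> compares its linear coefficient, which is what both a chord and a tangent provide; then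
  \<open>x1\<close>, \<open>x2\<close> and the third abscissa are the roots.
\<close>

lemma chord_point_on_curve:
  fixes W :: "'s::field weierstrass"
  assumes P: "weierstrass_poly W x1 y1 = 0"
    and key: "2 * l * (y1 - l * x1) + a1 W * (y1 - l * x1) + a3 W * l - a4 W
      = x1^2 + x1 * x2 + x2^2 - (l^2 + a1 W * l - a2 W) * (x1 + x2)"
  shows "chord_point W l x1 y1 x2 \<in> curve_points W"
proof -
  define x3 where "x3 = l^2 + a1 W * l - a2 W - x1 - x2"
  have "weierstrass_poly W x3 (y1 + l * (x3 - x1)) = 0"
    using P key unfolding weierstrass_poly_def x3_def by algebra
  then show ?thesis
    unfolding chord_point_def Let_def x3_def[symmetric]
    by (simp only: point_neg_in_curve_points Affine_in_curve_points)
qed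

lemma point_add_in_curve_points:
  assumes "P \<in> curve_points W" "Q \<in> curve_points W"
  shows "point_add W P Q \<in> curve_points W"
  using assms
proof (cases rule: point_add_cases)
  case (4 x1 y1 x2 y2 l)
  have on: "weierstrass_poly W x1 y1 = 0" "weierstrass_poly W x2 y2 = 0"
    using assms 4 by simp_all
  have "(x2 - x1) * (2 * l * (y1 - l * x1) + a1 W * (y1 - l * x1) + a3 W * l - a4 W
      - (x1^2 + x1 * x2 + x2^2 - (l^2 + a1 W * l - a2 W) * (x1 + x2)))
      = weierstrass_poly W x2 y2 - weierstrass_poly W x1 y1"
    using 4(4) unfolding weierstrass_poly_def by algebra
  then have "2 * l * (y1 - l * x1) + a1 W * (y1 - l * x1) + a3 W * l - a4 W
      = x1^2 + x1 * x2 + x2^2 - (l^2 + a1 W * l - a2 W) * (x1 + x2)"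
    using 4(3) on by simp
  then show ?thesis
    unfolding 4(1,2) point_add_chord[OF 4(3,4)] by (rule chord_point_on_curve[OF on(1)])
next
  case (5 x y l)
  have "weierstrass_poly W x y = 0" using assms 5 by simp
  moreover have "2 * l * (y - l * x) + a1 W * (y - l * x) + a3 W * l - a4 W
      = x^2 + x * x + x^2 - (l^2 + a1 W * l - a2 W) * (x + x)"
    using 5(4) by algebra
  ultimately show ?thesis
    unfolding 5(1,2) point_add_tangent[OF 5(3,4)] by (rule chord_point_on_curve)
qed (use assms in auto)

lemma point_mult_0 [simp]: "point_mult W 0 P = Infinity"
  and point_mult_Suc: "point_mult W (Suc n) P = point_add W P (point_mult W n P)"
  by (simp_all add: point_mult_def)

lemma point_mult_in_curve_points:
  assumes "P \<in> curve_points W"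
  shows "point_mult W n P \<in> curve_points W"
  by (induction n) (simp_all add: point_mult_Suc point_add_in_curve_points assms)

lemma point_mult_1 [simp]: "point_mult W (Suc 0) P = P"
  by (simp add: point_mult_Suc)

section \<open>Isomorphisms of Weierstrass curves\<close>

lemma isomorphism_equations:
  assumes "is_isomorphism (CC u r s t) W' W"
  shows "u \<noteq> 0" and
       "u * a1 W' = a1 W + 2 * s"
       "u^2 * a2 W' = a2 W - s * a1 W + 3 * r - s^2"
       "u^3 * a3 W' = a3 W + r * a1 W + 2 * t"
       "u^4 * a4 W' = a4 W - s * a3 W + 2 * r * a2 W - (t + r * s) * a1 W + 3 * r^2 - 2 * s * t"
       "u^6 * a6 W' = a6 W + r * a4 W + r^2 * a2 W + r^3 - t * a3 W - t^2 - r * t * a1 W"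
  using assms by (simp_all add: is_isomorphism_def)

lemma isomorphism_u: "is_isomorphism \<phi> W' W \<Longrightarrow> cc_u \<phi> \<noteq> 0"
  by (auto simp: is_isomorphism_def split: coord_change.splits)

lemma cc_id_isomorphism: "is_isomorphism cc_id W W"
  by (simp add: cc_id_def is_isomorphism_def)

lemma cc_neg_isomorphism: "is_isomorphism (cc_neg W) W W"
  by (simp add: cc_neg_def is_isomorphism_def power2_eq_square algebra_simps)

lemma cc_comp_isomorphism:
  assumes "is_isomorphism \<phi> W' W" "is_isomorphism \<theta> W'' W'"
  shows "is_isomorphism (cc_comp \<phi> \<theta>) W'' W"
proof -
  obtain u r s t u' r' s' t' where e: "\<phi> = CC u r s t" "\<theta> = CC u' r' s' t'"
    by (cases \<phi>; cases \<theta>)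
  note A = isomorphism_equations(2-)[OF assms(1)[unfolded e]]
  note B = isomorphism_equations(2-)[OF assms(2)[unfolded e]]
  have nz: "u \<noteq> 0" "u' \<noteq> 0" using assms by (simp_all add: e is_isomorphism_def)
  have "(u * u') * a1 W'' = a1 W + 2 * (u * s' + s)"
    using A(1) B(1) by algebra
  moreover have "(u * u')^2 * a2 W'' =
      a2 W - (u * s' + s) * a1 W + 3 * (u^2 * r' + r) - (u * s' + s)^2"
    using A(1,2) B(2) by algebra
  moreover have "(u * u')^3 * a3 W'' =
      a3 W + (u^2 * r' + r) * a1 W + 2 * (u^3 * t' + s * u^2 * r' + t)"
    using A(1,3) B(3) by algebra
  moreover have "(u * u')^4 * a4 W'' = a4 W - (u * s' + s) * a3 W + 2 * (u^2 * r' + r) * a2 W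
      - ((u^3 * t' + s * u^2 * r' + t) + (u^2 * r' + r) * (u * s' + s)) * a1 W
      + 3 * (u^2 * r' + r)^2 - 2 * (u * s' + s) * (u^3 * t' + s * u^2 * r' + t)"
  proof -
    have "(u * u')^4 * a4 W'' = u^4 * a4 W' - u * s' * (u^3 * a3 W') + 2 * u^2 * r' * (u^2 * a2 W')
       - (u^3 * t' + u^2 * r' * u * s') * (u * a1 W') + 3 * u^4 * r'^2 - 2 * u^4 * s' * t'"
      using B(4) by algebra
    then show ?thesis unfolding A by algebra
  qed
  moreover have "(u * u')^6 * a6 W'' = a6 W + (u^2 * r' + r) * a4 W + (u^2 * r' + r)^2 * a2 W
      + (u^2 * r' + r)^3 - (u^3 * t' + s * u^2 * r' + t) * a3 W - (u^3 * t' + s * u^2 * r' + t)^2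
      - (u^2 * r' + r) * (u^3 * t' + s * u^2 * r' + t) * a1 W"
  proof -
    have "(u * u')^6 * a6 W'' = u^6 * a6 W' + u^2 * r' * (u^4 * a4 W') + u^4 * r'^2 * (u^2 * a2 W')
       + u^6 * r'^3 - u^3 * t' * (u^3 * a3 W') - u^6 * t'^2 - u^5 * r' * t' * (u * a1 W')"
      using B(5) by algebra
    then show ?thesis unfolding A by algebra
  qed
  ultimately show ?thesis using nz by (simp add: e is_isomorphism_def)
qed

lemma cc_inv_isomorphism:
  assumes "is_isomorphism \<phi> W' W"
  shows "is_isomorphism (cc_inv \<phi>) W W'"
proof -
  obtain u r s t where e: "\<phi> = CC u r s t" by (cases \<phi>)
  note nz = isomorphism_equations(1)[OF assms[unfolded e]]
    and A = isomorphism_equations(2-)[OF assms[unfolded e]]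
  define i where "i = 1 / u"
  have i: "u * i = 1" using nz by (simp add: i_def)
  have eq: "cc_inv \<phi> = CC i (- r * i^2) (- s * i) ((r * s - t) * i^3)"
    by (simp add: e i_def power_divide)
  have 1: "i * a1 W = a1 W' + 2 * (- s * i)" using A(1) i by algebra
  have 2: "i^2 * a2 W = a2 W' - (- s * i) * a1 W' + 3 * (- r * i^2) - (- s * i)^2"
    using A(1,2) i by algebra
  have 3: "i^3 * a3 W = a3 W' + (- r * i^2) * a1 W' + 2 * ((r * s - t) * i^3)"
    using A(1,3) i by algebra
  have 4: "i^4 * a4 W = a4 W' - (- s * i) * a3 W' + 2 * (- r * i^2) * a2 W'
      - ((r * s - t) * i^3 + (- r * i^2) * (- s * i)) * a1 W' + 3 * (- r * i^2)^2
      - 2 * (- s * i) * ((r * s - t) * i^3)"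
  proof -
    have "a4 W' - (- s * i) * a3 W' + 2 * (- r * i^2) * a2 W'
      - ((r * s - t) * i^3 + (- r * i^2) * (- s * i)) * a1 W'
      = i^4 * (u^4 * a4 W' + s * (u^3 * a3 W') - 2 * r * (u^2 * a2 W')
      - ((r * s - t) + r * s) * (u * a1 W'))" using i by algebra
    then show ?thesis unfolding A by algebra
  qed
  have 5: "i^6 * a6 W = a6 W' + (- r * i^2) * a4 W' + (- r * i^2)^2 * a2 W' + (- r * i^2)^3
      - ((r * s - t) * i^3) * a3 W' - ((r * s - t) * i^3)^2 - (- r * i^2) * ((r * s - t) * i^3) * a1 W'"
  proof -
    have "a6 W' + (- r * i^2) * a4 W' + (- r * i^2)^2 * a2 W'
      - ((r * s - t) * i^3) * a3 W' - (- r * i^2) * ((r * s - t) * i^3) * a1 W'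
      = i^6 * (u^6 * a6 W' - r * (u^4 * a4 W') + r^2 * (u^2 * a2 W')
       - (r * s - t) * (u^3 * a3 W') + r * (r * s - t) * (u * a1 W'))" using i by algebra
    then show ?thesis unfolding A by algebra
  qed
  have "i \<noteq> 0" using i by auto
  then show ?thesis using 1 2 3 4 5 by (simp add: eq is_isomorphism_def)
qed

lemma cc_comp_assoc: "cc_comp \<phi> (cc_comp \<theta> \<eta>) = cc_comp (cc_comp \<phi> \<theta>) \<eta>"
  by (cases \<phi>; cases \<theta>; cases \<eta>) (simp add: algebra_simps power2_eq_square power3_eq_cube)

lemma cc_comp_id [simp]: "cc_comp cc_id \<phi> = \<phi>" "cc_comp \<phi> cc_id = \<phi>"
  by (cases \<phi>, simp add: cc_id_def)+

lemma cc_apply_id [simp]: "cc_apply cc_id P = P"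
  by (cases P) (simp_all add: cc_id_def)

lemma cc_apply_eq_iff:
  assumes "cc_u \<phi> \<noteq> 0"
  shows "cc_apply \<phi> P = cc_apply \<phi> Q \<longleftrightarrow> P = Q"
  using assms by (metis cc_apply_comp cc_apply_id cc_comp_inv)

lemma isomorphism_curve_points:
  assumes "is_isomorphism \<phi> W' W"
  shows "cc_apply \<phi> P \<in> curve_points W \<longleftrightarrow> P \<in> curve_points W'"
proof (cases P)
  case (Affine x y)
  obtain u r s t where e: "\<phi> = CC u r s t" by (cases \<phi>)
  have "u \<noteq> 0" using isomorphism_u[OF assms] by (simp add: e)
  then show ?thesis
    using is_isomorphism_equation[OF assms[unfolded e], of x y] by (simp add: e Affine)
qed (cases \<phi>; simp)

lemma isomorphism_neg:
  assumes "is_isomorphism \<phi> W' W"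
  shows "cc_apply \<phi> (point_neg W' P) = point_neg W (cc_apply \<phi> P)"
proof (cases P)
  case (Affine x y)
  obtain u r s t where e: "\<phi> = CC u r s t" by (cases \<phi>)
  have "u * a1 W' = a1 W + 2 * s" "u^3 * a3 W' = a3 W + r * a1 W + 2 * t"
    using assms by (simp_all add: e is_isomorphism_def)
  then have "u^3 * (- y - a1 W' * x - a3 W') + s * u^2 * x + t
      = - (u^3 * y + s * u^2 * x + t) - a1 W * (u^2 * x + r) - a3 W"
    by algebra
  then show ?thesis by (simp add: e Affine)
qed (cases \<phi>; simp)

text \<open>
  Lines go to lines, with the slope \<open>l\<close> becoming \<open>u l + s\<close>.
\<close>

lemma isomorphism_chord_point:
  assumes "is_isomorphism (CC u r s t) W' W"
  shows "chord_point W (u * l + s) (u^2 * x1 + r) (u^3 * y1 + s * u^2 * x1 + t) (u^2 * x2 + r)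
    = cc_apply (CC u r s t) (chord_point W' l x1 y1 x2)"
proof -
  have A: "u * a1 W' = a1 W + 2 * s" "u^2 * a2 W' = a2 W - s * a1 W + 3 * r - s^2"
    using assms by (simp_all add: is_isomorphism_def)
  define x3 where "x3 = l ^ 2 + a1 W' * l - a2 W' - x1 - x2"
  have "u^2 * x3 = u^2 * l^2 + u * l * (u * a1 W') - u^2 * a2 W' - u^2 * x1 - u^2 * x2"
    unfolding x3_def by algebra
  then have x: "(u * l + s) ^ 2 + a1 W * (u * l + s) - a2 W - (u^2 * x1 + r) - (u^2 * x2 + r)
      = u^2 * x3 + r"
    unfolding A by algebra
  have "chord_point W (u * l + s) (u^2 * x1 + r) (u^3 * y1 + s * u^2 * x1 + t) (u^2 * x2 + r)
    = point_neg W (Affine (u^2 * x3 + r)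
        (u^3 * y1 + s * u^2 * x1 + t + (u * l + s) * (u^2 * x3 + r - (u^2 * x1 + r))))"
    unfolding chord_point_def x Let_def ..
  also have "u^3 * y1 + s * u^2 * x1 + t + (u * l + s) * (u^2 * x3 + r - (u^2 * x1 + r))
     = u^3 * (y1 + l * (x3 - x1)) + s * u^2 * x3 + t"
    by algebra
  also have "point_neg W (Affine (u^2 * x3 + r) \<dots>)
      = cc_apply (CC u r s t) (point_neg W' (Affine x3 (y1 + l * (x3 - x1))))"
    unfolding isomorphism_neg[OF assms] by simp
  finally show ?thesis by (simp add: chord_point_def x3_def Let_def)
qed

lemma isomorphism_add:
  assumes iso: "is_isomorphism \<phi> W' W" and P: "P \<in> curve_points W'" and Q: "Q \<in> curve_points W'"
  shows "cc_apply \<phi> (point_add W' P Q) = point_add W (cc_apply \<phi> P) (cc_apply \<phi> Q)"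
proof -
  obtain u r s t where e: "\<phi> = CC u r s t" by (cases \<phi>)
  have u: "u \<noteq> 0" using isomorphism_u[OF iso] by (simp add: e)
  from P Q show ?thesis
  proof (cases rule: point_add_cases)
    case 1
    then show ?thesis by (simp add: e)
  next
    case 2
    then show ?thesis by (simp add: e)
  next
    case 3
    then show ?thesis using isomorphism_neg[OF iso, of P] by (simp add: e)
  next
    case (4 x1 y1 x2 y2 l)
    let ?x1 = "u^2 * x1 + r" and ?y1 = "u^3 * y1 + s * u^2 * x1 + t"
    let ?x2 = "u^2 * x2 + r" and ?y2 = "u^3 * y2 + s * u^2 * x2 + t"
    have "?x1 \<noteq> ?x2" using u 4 by simp
    moreover have "(u * l + s) * (?x2 - ?x1) = ?y2 - ?y1"
    proof -
      have "(u * l + s) * (?x2 - ?x1) = u^3 * (l * (x2 - x1)) + s * u^2 * (x2 - x1)" by algebra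
      then show ?thesis unfolding 4(4) by algebra
    qed
    ultimately have "point_add W (Affine ?x1 ?y1) (Affine ?x2 ?y2)
        = chord_point W (u * l + s) ?x1 ?y1 ?x2" by (rule point_add_chord)
    also have "\<dots> = cc_apply \<phi> (point_add W' P Q)"
      unfolding 4(1,2) point_add_chord[OF 4(3,4)] e
      by (rule isomorphism_chord_point[OF iso[unfolded e]])
    finally show ?thesis by (simp add: e 4(1,2))
  next
    case (5 x y l)
    let ?x = "u^2 * x + r" and ?y = "u^3 * y + s * u^2 * x + t"
    note A = isomorphism_equations(2-)[OF iso[unfolded e]]
    have den: "2 * ?y + a1 W * ?x + a3 W = u^3 * (2 * y + a1 W' * x + a3 W')"
      using A(1,3) by algebra
    have "u^4 * (l * (2 * y + a1 W' * x + a3 W')) = 3 * u^4 * x^2 + 2 * (u^2 * a2 W') * u^2 * x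
        + u^4 * a4 W' - (u * a1 W') * u^3 * y"
      unfolding 5(4) by algebra
    then have num: "u^4 * (l * (2 * y + a1 W' * x + a3 W')) + s * (2 * ?y + a1 W * ?x + a3 W)
      = 3 * ?x ^ 2 + 2 * a2 W * ?x + a4 W - a1 W * ?y"
      unfolding A by algebra
    have "2 * ?y + a1 W * ?x + a3 W \<noteq> 0" unfolding den using u 5(3) by simp
    moreover have "(u * l + s) * (2 * ?y + a1 W * ?x + a3 W)
        = 3 * ?x ^ 2 + 2 * a2 W * ?x + a4 W - a1 W * ?y"
      unfolding num[symmetric] den by algebra
    ultimately have "point_add W (Affine ?x ?y) (Affine ?x ?y)
        = chord_point W (u * l + s) ?x ?y ?x" by (rule point_add_tangent)
    also have "\<dots> = cc_apply \<phi> (point_add W' P Q)"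
      unfolding 5(1,2) point_add_tangent[OF 5(3,4)] e
      by (rule isomorphism_chord_point[OF iso[unfolded e]])
    finally show ?thesis by (simp add: e 5(1,2))
  qed
qed

lemma cc_apply_Infinity [simp]: "cc_apply \<phi> Infinity = Infinity"
  by (cases \<phi>) simp

text \<open>
  The invariants \<open>b2\<close>, \<open>b4\<close>, \<open>b6\<close>, \<open>b8\<close> do not see \<open>s\<close> and \<open>t\<close>, which keeps the computation small.
\<close>

lemma isomorphism_discriminant:
  assumes "is_isomorphism \<phi> W' W"
  shows "cc_u \<phi> ^ 12 * discriminant W' = discriminant W"
proof -
  obtain u r s t where e: "\<phi> = CC u r s t" by (cases \<phi>)
  note A = isomorphism_equations(2-)[OF assms[unfolded e]]
  have "u^2 * b2 W' = (u * a1 W')^2 + 4 * (u^2 * a2 W')"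
    unfolding b2_def by algebra
  then have B2: "u^2 * b2 W' = b2 W + 12 * r" unfolding A b2_def by algebra
  have "u^4 * b4 W' = 2 * (u^4 * a4 W') + (u * a1 W') * (u^3 * a3 W')"
    unfolding b4_def by algebra
  then have B4: "u^4 * b4 W' = b4 W + r * b2 W + 6 * r^2" unfolding A b2_def b4_def by algebra
  have "u^6 * b6 W' = (u^3 * a3 W')^2 + 4 * (u^6 * a6 W')"
    unfolding b6_def by algebra
  then have B6: "u^6 * b6 W' = b6 W + 2 * r * b4 W + r^2 * b2 W + 4 * r^3"
    unfolding A b2_def b4_def b6_def by algebra
  have "u^8 * b8 W' = (u * a1 W')^2 * (u^6 * a6 W') + 4 * (u^2 * a2 W') * (u^6 * a6 W')
      - (u * a1 W') * (u^3 * a3 W') * (u^4 * a4 W') + (u^2 * a2 W') * (u^3 * a3 W')^2 - (u^4 * a4 W')^2"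
    unfolding b8_def by algebra
  then have B8: "u^8 * b8 W' = b8 W + 3 * r * b6 W + 3 * r^2 * b4 W + r^3 * b2 W + 3 * r^4"
    unfolding A b2_def b4_def b6_def b8_def by algebra
  have rel: "4 * b8 W = b2 W * b6 W - b4 W ^ 2"
    unfolding b2_def b4_def b6_def b8_def by algebra
  have "u^12 * discriminant W' = - ((u^2 * b2 W')^2 * (u^8 * b8 W')) - 8 * (u^4 * b4 W')^3
      - 27 * (u^6 * b6 W')^2 + 9 * (u^2 * b2 W') * (u^4 * b4 W') * (u^6 * b6 W')"
    unfolding discriminant_def by algebra
  also have "\<dots> = discriminant W"
    unfolding B2 B4 B6 B8 discriminant_def using rel by algebra
  finally show ?thesis by (simp add: e)
qed

lemma cc_inv_inv: "is_isomorphism \<phi> W' W \<Longrightarrow> cc_apply \<phi> (cc_apply (cc_inv \<phi>) P) = P"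
  using cc_comp_inv isomorphism_u by (metis cc_apply_comp cc_apply_id)

lemma isomorphism_mult:
  assumes "is_isomorphism \<phi> W' W" "P \<in> curve_points W'"
  shows "cc_apply \<phi> (point_mult W' n P) = point_mult W n (cc_apply \<phi> P)"
  by (induction n)
    (simp_all add: point_mult_Suc isomorphism_add[OF assms(1)] assms(2) point_mult_in_curve_points)

section \<open>The seven marked points of the Tate normal form\<close>

text \<open>
  Tate's normal form for a curve with a point of order at least four, placed at the origin with a
  horizontal tangent.
\<close>

definition tate_form :: "'s::field \<Rightarrow> 's \<Rightarrow> 's weierstrass" where
  "tate_form b c = Weierstrass (1 - c) (- b) (- b) 0 0"

lemma tate_form_chord:
  assumes "x3 = l^2 + (1 - c) * l + b - x1 - x2"
    and "y3 = - (y1 + l * (x3 - x1)) - (1 - c) * x3 + b"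
  shows "chord_point (tate_form b c) l x1 y1 x2 = Affine x3 y3"
proof -
  let ?T = "tate_form b c"
  have "l^2 + a1 ?T * l - a2 ?T - x1 - x2 = x3"
    unfolding tate_form_def weierstrass.sel assms(1) by algebra
  then have "chord_point ?T l x1 y1 x2 = point_neg ?T (Affine x3 (y1 + l * (x3 - x1)))"
    by (simp only: chord_point_def Let_def)
  moreover have "- (y1 + l * (x3 - x1)) - a1 ?T * x3 - a3 ?T = y3"
    unfolding tate_form_def weierstrass.sel assms(2) by algebra
  ultimately show ?thesis by simp
qed

lemma tate_form_add:
  fixes b c :: "'s::field"
  assumes "x1 \<noteq> x2" "l * (x2 - x1) = y2 - y1"
    and "x3 = l^2 + (1 - c) * l + b - x1 - x2"
    and "y3 = - (y1 + l * (x3 - x1)) - (1 - c) * x3 + b"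
  shows "point_add (tate_form b c) (Affine x1 y1) (Affine x2 y2) = Affine x3 y3"
  unfolding point_add_chord[OF assms(1,2)] by (rule tate_form_chord) fact+

lemma tate_form_double:
  fixes b c :: "'s::field"
  assumes "2 * y + (1 - c) * x - b \<noteq> 0"
    and "l * (2 * y + (1 - c) * x - b) = 3 * x^2 - 2 * b * x - (1 - c) * y"
    and "x3 = l^2 + (1 - c) * l + b - x - x"
    and "y3 = - (y + l * (x3 - x)) - (1 - c) * x3 + b"
  shows "point_add (tate_form b c) (Affine x y) (Affine x y) = Affine x3 y3"
proof -
  have "2 * y + a1 (tate_form b c) * x + a3 (tate_form b c) \<noteq> 0"
    using assms(1) by (simp add: tate_form_def)
  moreover have "l * (2 * y + a1 (tate_form b c) * x + a3 (tate_form b c))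
     = 3 * x^2 + 2 * a2 (tate_form b c) * x + a4 (tate_form b c) - a1 (tate_form b c) * y"
    using assms(2) by (simp add: tate_form_def)
  ultimately have "point_add (tate_form b c) (Affine x y) (Affine x y) = chord_point (tate_form b c) l x y x"
    by (rule point_add_tangent)
  then show ?thesis using tate_form_chord[OF assms(3,4)] by simp
qed

text \<open>
  The multiples of the origin on \<open>trivial_family w\<close>.
\<close>

definition tate_point :: "'s::field \<Rightarrow> nat \<Rightarrow> 's point" where
  "tate_point w n =
    [Infinity, Affine 0 0, Affine (w^3 - w^2) ((w^3 - w^2) * (w^2 - w)),
     Affine (w^2 - w) (w * (w - 1)^2), Affine (w^2 - w) ((w^2 - w)^2),
     Affine (w^3 - w^2) 0, Affine 0 (w^3 - w^2)] ! (n mod 7)"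

lemma tate_point_mod [simp]: "tate_point w (n mod 7) = tate_point w n"
  by (simp add: tate_point_def)

lemma tate_point_values:
  "tate_point w 0 = Infinity"
  "tate_point w 1 = Affine 0 0"
  "tate_point w 2 = Affine (w^3 - w^2) ((w^3 - w^2) * (w^2 - w))"
  "tate_point w 3 = Affine (w^2 - w) (w * (w - 1)^2)"
  "tate_point w 4 = Affine (w^2 - w) ((w^2 - w)^2)"
  "tate_point w 5 = Affine (w^3 - w^2) 0"
  "tate_point w 6 = Affine 0 (w^3 - w^2)"
  by (simp_all add: tate_point_def)

lemma less_7_cases:
  "i < (7::nat) \<Longrightarrow> i = 0 \<or> i = 1 \<or> i = 2 \<or> i = 3 \<or> i = 4 \<or> i = 5 \<or> i = 6"
  by arith

lemma tate_point_cases: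
  assumes "Q (tate_point w 0) 0" "Q (tate_point w 1) 1" "Q (tate_point w 2) 2" "Q (tate_point w 3) 3"
    "Q (tate_point w 4) 4" "Q (tate_point w 5) 5" "Q (tate_point w 6) 6"
  shows "Q (tate_point w n) (n mod 7)"
proof -
  have "Q (tate_point w k) k" if "k < 7" for k
    using less_7_cases[OF that] assms by (elim disjE) simp_all
  from this[of "n mod 7"] show ?thesis by simp
qed

lemma tate_point_curve: "tate_point w n \<in> curve_points (trivial_family w)"
proof (rule tate_point_cases[where Q = "\<lambda>P _. P \<in> curve_points (trivial_family w)"])
  have a: "Affine x y \<in> curve_points (trivial_family w)"
    if "y^2 + (1 + w - w^2) * x * y + (w^2 - w^3) * y = x^3 + (w^2 - w^3) * x^2" for x y
    using that unfolding Affine_in_curve_points weierstrass_poly_def trivial_family_def weierstrass.sel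
    by algebra
  show "tate_point w 0 \<in> curve_points (trivial_family w)" by (simp add: tate_point_values)
  show "tate_point w 1 \<in> curve_points (trivial_family w)"
    "tate_point w 2 \<in> curve_points (trivial_family w)"
    "tate_point w 3 \<in> curve_points (trivial_family w)"
    "tate_point w 4 \<in> curve_points (trivial_family w)"
    "tate_point w 5 \<in> curve_points (trivial_family w)"
    "tate_point w 6 \<in> curve_points (trivial_family w)"
    unfolding tate_point_values by (rule a, ((simp; fail) | algebra | (simp, algebra)))+
qed

lemma tate_point_neg: "point_neg (trivial_family w) (tate_point w n) = tate_point w (6 * n)"
proof -
  let ?T = "trivial_family w"
  have "point_neg ?T (tate_point w n) = tate_point w (6 * (n mod 7) mod 7)"
  proof (rule tate_point_cases[where Q = "\<lambda>P k. point_neg ?T P = tate_point w (6 * k mod 7)"])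
    have a: "point_neg ?T (Affine x y) = Affine x z"
      if "z = - y - (1 + w - w^2) * x - (w^2 - w^3)" for x y z
      using that by (simp add: trivial_family_def algebra_simps)
    show "point_neg ?T (tate_point w 0) = tate_point w (6 * 0 mod 7)"
      by (simp add: tate_point_values)
    have "point_neg ?T (tate_point w 1) = tate_point w 6"
      "point_neg ?T (tate_point w 2) = tate_point w 5" "point_neg ?T (tate_point w 3) = tate_point w 4"
      "point_neg ?T (tate_point w 4) = tate_point w 3" "point_neg ?T (tate_point w 5) = tate_point w 2"
      "point_neg ?T (tate_point w 6) = tate_point w 1"
      unfolding tate_point_values by (rule a, ((simp; fail) | algebra | (simp, algebra)))+
    then show "point_neg ?T (tate_point w 1) = tate_point w (6 * 1 mod 7)"
      "point_neg ?T (tate_point w 2) = tate_point w (6 * 2 mod 7)"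
      "point_neg ?T (tate_point w 3) = tate_point w (6 * 3 mod 7)"
      "point_neg ?T (tate_point w 4) = tate_point w (6 * 4 mod 7)"
      "point_neg ?T (tate_point w 5) = tate_point w (6 * 5 mod 7)"
      "point_neg ?T (tate_point w 6) = tate_point w (6 * 6 mod 7)" by simp_all
  qed
  also have "6 * (n mod 7) mod 7 = (6 * n) mod 7" by (simp add: mod_mult_right_eq)
  finally show ?thesis by simp
qed

lemma tate_point_nonzero:
  fixes w :: "'s::field"
  assumes w: "w \<noteq> 0" "w \<noteq> 1"
  shows "w - 1 \<noteq> 0" "w^2 - w \<noteq> 0" "w^3 - w^2 \<noteq> 0" "w^3 - w^2 \<noteq> w^2 - w"
    "w * (w - 1)^2 \<noteq> (w^2 - w)^2"
proof -
  show 1: "w - 1 \<noteq> 0" using w by simp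
  have "w^2 - w = w * (w - 1)" "w^3 - w^2 = w^2 * (w - 1)"
    "w^3 - w^2 - (w^2 - w) = w * (w - 1)^2" "(w^2 - w)^2 - w * (w - 1)^2 = w * (w - 1)^3"
    by algebra+
  then show "w^2 - w \<noteq> 0" "w^3 - w^2 \<noteq> 0" "w^3 - w^2 \<noteq> w^2 - w"
      "w * (w - 1)^2 \<noteq> (w^2 - w)^2"
    using w 1 by (auto simp del: right_minus_eq)
qed

lemma tate_point_inj:
  fixes w :: "'s::field"
  assumes "w \<noteq> 0" "w \<noteq> 1"
  shows "tate_point w n = tate_point w m \<longleftrightarrow> n mod 7 = m mod 7"
proof -
  define b where "b = w^3 - w^2"
  define c where "c = w^2 - w"
  define e where "e = w * (w - 1)^2"
  have nz: "c \<noteq> 0" "b \<noteq> 0" "b \<noteq> c" "c \<noteq> b" "e \<noteq> c^2" "c^2 \<noteq> e"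
    using tate_point_nonzero[OF assms] by (simp_all add: b_def c_def e_def)
  note val = tate_point_values[of w, folded b_def c_def e_def]
  have "tate_point w i = tate_point w j \<longleftrightarrow> i = j" if "i < 7" "j < 7" for i j
    using less_7_cases[OF that(1)] less_7_cases[OF that(2)]
    by (elim disjE) (simp_all only: val, simp_all add: nz nz[symmetric])
  from this[of "n mod 7" "m mod 7"] show ?thesis by simp
qed

lemma trivial_family_tate_form: "trivial_family w = tate_form (w^3 - w^2) (w^2 - w)"
  by (simp add: trivial_family_def tate_form_def)

text \<open>
  In the table below all slopes are polynomials in \<open>w\<close>; given the slope, only polynomial identities
  remain.
\<close>

lemma tate_point_chord:
  fixes w :: "'s::field"
  assumes "tate_point w i = Affine x1 y1" "tate_point w j = Affine x2 y2"
    "tate_point w k = Affine x3 y3"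
    and "x1 \<noteq> x2" "l * (x2 - x1) = y2 - y1"
    and "x3 = l^2 + (1 - (w^2 - w)) * l + (w^3 - w^2) - x1 - x2"
    and "y3 = - (y1 + l * (x3 - x1)) - (1 - (w^2 - w)) * x3 + (w^3 - w^2)"
  shows "point_add (trivial_family w) (tate_point w i) (tate_point w j) = tate_point w k"
  unfolding trivial_family_tate_form assms(1-3) by (rule tate_form_add) fact+

text \<open>
  The denominator of the tangent slope vanishes only at a point that is its own negative, which is
  excluded because the seven points are distinct.
\<close>

lemma tate_point_double:
  fixes w :: "'s::field"
  assumes w: "w \<noteq> 0" "w \<noteq> 1" and i: "i mod 7 \<noteq> 0"
    and p: "tate_point w i = Affine x y" "tate_point w k = Affine x3 y3"
    and l: "l * (2 * y + (1 - (w^2 - w)) * x - (w^3 - w^2))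
      = 3 * x^2 - 2 * (w^3 - w^2) * x - (1 - (w^2 - w)) * y"
    and x3: "x3 = l^2 + (1 - (w^2 - w)) * l + (w^3 - w^2) - x - x"
    and y3: "y3 = - (y + l * (x3 - x)) - (1 - (w^2 - w)) * x3 + (w^3 - w^2)"
  shows "point_add (trivial_family w) (tate_point w i) (tate_point w i) = tate_point w k"
proof -
  have "6 * k mod 7 \<noteq> k" if "k < 7" "k \<noteq> 0" for k :: nat
    using less_7_cases[OF that(1)] that(2) by (elim disjE) simp_all
  \<comment> \<open>negation is multiplication by six\<close>
  from this[of "i mod 7"] have "(6 * i) mod 7 \<noteq> i mod 7"
    using i by (simp add: mod_mult_right_eq)
  then have "point_neg (trivial_family w) (Affine x y) \<noteq> Affine x y"
    using tate_point_neg[of w i] tate_point_inj[OF w, of "6 * i" i] p by metis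
  then have ne: "- y - (1 - (w^2 - w)) * x - (- (w^3 - w^2)) \<noteq> y"
    by (simp add: trivial_family_tate_form tate_form_def)
  have "2 * y + (1 - (w^2 - w)) * x - (w^3 - w^2) \<noteq> 0"
  proof
    assume "2 * y + (1 - (w^2 - w)) * x - (w^3 - w^2) = 0"
    then have "- y - (1 - (w^2 - w)) * x - (- (w^3 - w^2)) = y" by algebra
    with ne show False ..
  qed
  then show ?thesis
    unfolding trivial_family_tate_form p using l x3 y3 by (rule tate_form_double)
qed

text \<open>
  The map \<open>n \<mapsto> tate_point w n\<close> is a homomorphism from the integers modulo seven.
\<close>

lemma tate_point_add:
  fixes w :: "'s::field"
  assumes w: "w \<noteq> 0" "w \<noteq> 1"
  shows "point_add (trivial_family w) (tate_point w i) (tate_point w j) = tate_point w (i + j)"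
proof -
  define T where "T = trivial_family w"
  define p where "p = tate_point w"
  note tv = tate_point_values(2-7)[of w]
  note nz = tate_point_nonzero[OF w]
  have d1: "point_add T (p 1) (p 1) = p 2" unfolding T_def p_def
    by (rule tate_point_double[OF w _ tv(1) tv(2), where l = "0"]) (simp, ((simp; fail) | algebra | (simp, algebra))+)
  have s12: "point_add T (p 1) (p 2) = p 3" unfolding T_def p_def
    by (rule tate_point_chord[OF tv(1) tv(2) tv(3), where l = "w^2 - w"]) (use nz in simp, ((simp; fail) | algebra | (simp, algebra))+)
  have s13: "point_add T (p 1) (p 3) = p 4" unfolding T_def p_def
    by (rule tate_point_chord[OF tv(1) tv(3) tv(4), where l = "w - 1"]) (use nz in simp, ((simp; fail) | algebra | (simp, algebra))+)
  have s14: "point_add T (p 1) (p 4) = p 5" unfolding T_def p_def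
    by (rule tate_point_chord[OF tv(1) tv(4) tv(5), where l = "w^2 - w"]) (use nz in simp, ((simp; fail) | algebra | (simp, algebra))+)
  have s15: "point_add T (p 1) (p 5) = p 6" unfolding T_def p_def
    by (rule tate_point_chord[OF tv(1) tv(5) tv(6), where l = "0"]) (use nz in simp, ((simp; fail) | algebra | (simp, algebra))+)
  have d2: "point_add T (p 2) (p 2) = p 4" unfolding T_def p_def
    by (rule tate_point_double[OF w _ tv(2) tv(4), where l = "w^2 - 1"]) (simp, ((simp; fail) | algebra | (simp, algebra))+)
  have s23: "point_add T (p 2) (p 3) = p 5" unfolding T_def p_def
    by (rule tate_point_chord[OF tv(2) tv(3) tv(5), where l = "w^2 - 1"]) (use nz in simp, ((simp; fail) | algebra | (simp, algebra))+)
  have s24: "point_add T (p 2) (p 4) = p 6" unfolding T_def p_def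
    by (rule tate_point_chord[OF tv(2) tv(4) tv(6), where l = "w^2 - w"]) (use nz in simp, ((simp; fail) | algebra | (simp, algebra))+)
  have s26: "point_add T (p 2) (p 6) = p 1" unfolding T_def p_def
    by (rule tate_point_chord[OF tv(2) tv(6) tv(1), where l = "w^2 - w - 1"]) (use nz in simp, ((simp; fail) | algebra | (simp, algebra))+)
  have d3: "point_add T (p 3) (p 3) = p 6" unfolding T_def p_def
    by (rule tate_point_double[OF w _ tv(3) tv(6), where l = "w - 1"]) (simp, ((simp; fail) | algebra | (simp, algebra))+)
  have s35: "point_add T (p 3) (p 5) = p 1" unfolding T_def p_def
    by (rule tate_point_chord[OF tv(3) tv(5) tv(1), where l = "- 1"]) (use nz in simp, ((simp; fail) | algebra | (simp, algebra))+)
  have s36: "point_add T (p 3) (p 6) = p 2" unfolding T_def p_def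
    by (rule tate_point_chord[OF tv(3) tv(6) tv(2), where l = "- 1"]) (use nz in simp, ((simp; fail) | algebra | (simp, algebra))+)
  have d4: "point_add T (p 4) (p 4) = p 1" unfolding T_def p_def
    by (rule tate_point_double[OF w _ tv(4) tv(1), where l = "w^2 - 2*w"]) (simp, ((simp; fail) | algebra | (simp, algebra))+)
  have s45: "point_add T (p 4) (p 5) = p 2" unfolding T_def p_def
    by (rule tate_point_chord[OF tv(4) tv(5) tv(2), where l = "- w"]) (use nz in simp, ((simp; fail) | algebra | (simp, algebra))+)
  have s46: "point_add T (p 4) (p 6) = p 3" unfolding T_def p_def
    by (rule tate_point_chord[OF tv(4) tv(6) tv(3), where l = "w^2 - 2*w"]) (use nz in simp, ((simp; fail) | algebra | (simp, algebra))+)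
  have d5: "point_add T (p 5) (p 5) = p 3" unfolding T_def p_def
    by (rule tate_point_double[OF w _ tv(5) tv(3), where l = "- w"]) (simp, ((simp; fail) | algebra | (simp, algebra))+)
  have s56: "point_add T (p 5) (p 6) = p 4" unfolding T_def p_def
    by (rule tate_point_chord[OF tv(5) tv(6) tv(4), where l = "- 1"]) (use nz in simp, ((simp; fail) | algebra | (simp, algebra))+)
  have d6: "point_add T (p 6) (p 6) = p 5" unfolding T_def p_def
    by (rule tate_point_double[OF w _ tv(6) tv(5), where l = "w^2 - w - 1"]) (simp, ((simp; fail) | algebra | (simp, algebra))+)

  have comm: "point_add T (p i) (p j) = point_add T (p j) (p i)" for i j
    unfolding T_def p_def by (intro point_add_commute tate_point_curve)
  have inv: "point_add T (p i) (p (6 * i)) = p 0" for i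
    using tate_point_neg[of w i] by (simp add: T_def p_def tate_point_values flip: tate_point_neg)
  have red: "p k = p (k mod 7)" for k by (simp add: p_def)
  have z: "p 0 = Infinity" by (simp add: p_def tate_point_values)
  have inv': "point_add T (p 1) (p 6) = p 0" "point_add T (p 2) (p 5) = p 0" "point_add T (p 3) (p 4) = p 0"
    using inv[of 1] inv[of 2] inv[of 3] red[of 12] red[of 18] by simp_all
  note table = d1 s12 s13 s14 s15 d2 s23 s24 s26 d3 s35 s36 d4 s45 s46 d5 s56 d6 inv'
  have *: "point_add T (p i) (p j) = p ((i + j) mod 7)" if "i \<le> j" "i < 7" "j < 7" for i j
  proof -
    note ij = that
    have j: "j = 0 \<or> j = 1 \<or> j = 2 \<or> j = 3 \<or> j = 4 \<or> j = 5 \<or> j = 6"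
      using less_7_cases[OF that(3)] .
    consider "i = 0" | "i = 1" | "i = 2" | "i = 3" | "i = 4" | "i = 5" | "i = 6"
      using less_7_cases[OF ij(2)] by metis
    then show ?thesis
    proof cases
      case 1
      then show ?thesis using that(3) by (simp add: z)
    next
      case 2
      then show ?thesis using j that(1)
        by (elim disjE) (simp_all del: One_nat_def add: One_nat_def[symmetric] table(1-5,19))
    next
      case 3
      then show ?thesis using j that(1)
        by (elim disjE) (simp_all del: One_nat_def add: One_nat_def[symmetric] table(6-9,20))
    next
      case 4
      then show ?thesis using j that(1)
        by (elim disjE) (simp_all del: One_nat_def add: One_nat_def[symmetric] table(10-12,21))
    next
      case 5
      then show ?thesis using j that(1)
        by (elim disjE) (simp_all del: One_nat_def add: One_nat_def[symmetric] table(13-15))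
    next
      case 6
      then show ?thesis using j that(1)
        by (elim disjE) (simp_all del: One_nat_def add: One_nat_def[symmetric] table(16,17))
    next
      case 7
      then show ?thesis using j that(1)
        by (elim disjE) (simp_all del: One_nat_def add: One_nat_def[symmetric] table(18))
    qed
  qed
  have "point_add T (p (i mod 7)) (p (j mod 7)) = p ((i mod 7 + j mod 7) mod 7)"
    using *[of "i mod 7" "j mod 7"] *[of "j mod 7" "i mod 7"] comm[of "i mod 7" "j mod 7"]
    by (cases "i mod 7 \<le> j mod 7") (simp_all add: add.commute)
  then show ?thesis by (simp add: p_def T_def mod_add_eq)
qed


lemma tate_point_mult:
  assumes "w \<noteq> 0" "w \<noteq> 1"
  shows "point_mult (trivial_family w) n (tate_point w i) = tate_point w (n * i)"
  by (induction n) (simp_all add: point_mult_def tate_point_add[OF assms] tate_point_values)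

section \<open>Tate markings\<close>

text \<open>
  \<open>P\<close> is a point of order seven on \<open>W\<close>, with parameter \<open>w\<close>: the curve with its point is identified with
  the normal form \<open>trivial_family w\<close> and its origin.
\<close>

definition tate_marking ::
  "'s::field weierstrass \<Rightarrow> 's point \<Rightarrow> 's \<Rightarrow> 's coord_change \<Rightarrow> bool" where
  "tate_marking W P w \<phi> \<longleftrightarrow> w \<noteq> 0 \<and> w \<noteq> 1 \<and>
     is_isomorphism \<phi> (trivial_family w) W \<and> cc_apply \<phi> (Affine 0 0) = P"

lemma tate_point_1: "tate_point w (Suc 0) = Affine 0 0"
  using tate_point_values(2)[of w] by simp

lemma marking_mult:
  assumes "tate_marking W P w \<phi>"
  shows "point_mult W n P = cc_apply \<phi> (tate_point w n)"
proof -
  have "point_mult W n P = cc_apply \<phi> (point_mult (trivial_family w) n (tate_point w (Suc 0)))"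
  proof -
    have "is_isomorphism \<phi> (trivial_family w) W" "cc_apply \<phi> (tate_point w (Suc 0)) = P"
      using assms by (simp_all add: tate_marking_def tate_point_1)
    then show ?thesis using isomorphism_mult[OF _ tate_point_curve] by metis
  qed
  then show ?thesis using assms by (simp add: tate_marking_def tate_point_mult)
qed

lemma marking_on_curve:
  assumes "tate_marking W P w \<phi>"
  shows "point_mult W n P \<in> curve_points W"
  using assms
  by (auto simp: marking_mult tate_marking_def isomorphism_curve_points tate_point_curve)

lemma marking_add:
  assumes "tate_marking W P w \<phi>"
  shows "point_add W (point_mult W m P) (point_mult W n P) = point_mult W (m + n) P"
proof -
  have iso: "is_isomorphism \<phi> (trivial_family w) W" and w: "w \<noteq> 0" "w \<noteq> 1"
    using assms by (simp_all add: tate_marking_def)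
  show ?thesis
    using isomorphism_add[OF iso tate_point_curve tate_point_curve, of m n]
    by (simp add: marking_mult[OF assms] tate_point_add[OF w])
qed

lemma marking_point_neg:
  assumes "tate_marking W P w \<phi>"
  shows "point_neg W (point_mult W n P) = point_mult W (6 * n) P"
proof -
  have iso: "is_isomorphism \<phi> (trivial_family w) W"
    using assms by (simp_all add: tate_marking_def)
  show ?thesis
    using isomorphism_neg[OF iso, of "tate_point w n"]
    by (simp add: marking_mult[OF assms] tate_point_neg)
qed

lemma marking_mult_eq_iff:
  assumes "tate_marking W P w \<phi>"
  shows "point_mult W n P = point_mult W m P \<longleftrightarrow> n mod 7 = m mod 7"
  using assms isomorphism_u[of \<phi> "trivial_family w" W] unfolding marking_mult[OF assms]
  by (simp add: cc_apply_eq_iff tate_marking_def tate_point_inj)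

lemma marking_mult_mult:
  assumes "tate_marking W P w \<phi>"
  shows "point_mult W m (point_mult W n P) = point_mult W (m * n) P"
  by (induction m) (simp_all add: point_mult_Suc marking_add[OF assms])

lemma marking_transport:
  assumes "tate_marking W P w \<phi>" "is_isomorphism \<theta> W V"
  shows "tate_marking V (cc_apply \<theta> P) w (cc_comp \<theta> \<phi>)"
  using assms by (auto simp: tate_marking_def cc_comp_isomorphism cc_apply_comp)

lemma marking_neg:
  assumes "tate_marking W P w \<phi>"
  shows "tate_marking W (point_neg W P) w (cc_comp (cc_neg W) \<phi>)"
  using marking_transport[OF assms cc_neg_isomorphism] by (simp add: cc_apply_neg)

text \<open>
  In the normal form the point is the origin, its tangent is horizontal, and \<open>a2 = a3\<close>. These
  conditions determine the translation, the shear and the scaling in turn.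
\<close>

lemma tate_rigid:
  fixes w w' :: "'s::field"
  assumes w: "w \<noteq> 0" "w \<noteq> 1"
    and iso: "is_isomorphism \<phi> (trivial_family w') (trivial_family w)"
    and fix0: "cc_apply \<phi> (Affine 0 0) = Affine 0 0"
  shows "w' = w \<and> \<phi> = cc_id"
proof -
  obtain u r s t where e: "\<phi> = CC u r s t" by (cases \<phi>)
  have rt: "r = 0" "t = 0" using fix0 by (simp_all add: e)
  have A: "u \<noteq> 0" "u * (- (w'^2) + w' + 1) = - (w^2) + w + 1 + 2 * s"
    "u^2 * (- (w'^3) + w'^2) = - (w^3) + w^2 - s * (- (w^2) + w + 1) - s^2"
    "u^3 * (- (w'^3) + w'^2) = - (w^3) + w^2"
    "s * (- (w^3) + w^2) = 0"
    using iso by (simp_all add: e rt is_isomorphism_def trivial_family_def)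
  have nz: "w^3 - w^2 \<noteq> 0" "w^2 - w \<noteq> 0" using tate_point_nonzero[OF w] by simp_all
  then have s: "s = 0" using A(5) by (auto simp: algebra_simps)
  have A2: "u * (- (w'^2) + w' + 1) = - (w^2) + w + 1"
    "u^2 * (- (w'^3) + w'^2) = - (w^3) + w^2"
    using A(2,3) by (simp_all add: s)
  have "(u - 1) * (w^3 - w^2) = 0"
    using A2(2) A(4) by algebra
  then have u: "u = 1" using nz by simp
  have "(w' - w) * (w^2 - w) = 0"
    using A2[unfolded u power_one mult_1] by algebra
  then have "w' = w" using nz by simp
  then show ?thesis by (simp add: e rt s u cc_id_def)
qed

lemma marking_unique:
  assumes "tate_marking W P w \<phi>" "tate_marking W P w' \<phi>'"
  shows "w' = w \<and> \<phi>' = \<phi>"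
proof -
  have iso: "is_isomorphism \<phi> (trivial_family w) W" "is_isomorphism \<phi>' (trivial_family w') W"
    and w: "w \<noteq> 0" "w \<noteq> 1" and P: "cc_apply \<phi> (Affine 0 0) = P" "cc_apply \<phi>' (Affine 0 0) = P"
    using assms by (simp_all add: tate_marking_def)
  have u: "cc_u \<phi> \<noteq> 0" by (rule isomorphism_u[OF iso(1)])
  have inv: "cc_comp (cc_inv \<phi>) \<phi> = cc_id" "cc_comp \<phi> (cc_inv \<phi>) = cc_id"
    using cc_comp_inv[OF u] by simp_all
  have "is_isomorphism (cc_comp (cc_inv \<phi>) \<phi>') (trivial_family w') (trivial_family w)"
    by (rule cc_comp_isomorphism[OF cc_inv_isomorphism[OF iso(1)] iso(2)])
  moreover have "cc_apply (cc_comp (cc_inv \<phi>) \<phi>') (Affine 0 0) = Affine 0 0"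
    using inv(1) P by (metis cc_apply_comp cc_apply_id)
  ultimately have *: "w' = w" "cc_comp (cc_inv \<phi>) \<phi>' = cc_id"
    using tate_rigid[OF w] by blast+
  then have "\<phi>' = \<phi>" using inv by (metis cc_comp_assoc cc_comp_id)
  with * show ?thesis by simp
qed

text \<open>
  The normal form of \<open>trivial_family w\<close> with its point \<open>4P\<close>. On parameters this is the operator of
  order three on \<open>X\<^sub>1(7)\<close> that corresponds to the element \<open>4\<close> of order three modulo seven.
\<close>

lemma marking_quadruple:
  fixes w :: "'s::field"
  assumes "tate_marking W P w \<phi>"
  shows "\<exists>\<phi>'. tate_marking W (point_mult W 4 P) (1 / (1 - w)) \<phi>'"
proof -
  have w: "w \<noteq> 0" "w \<noteq> 1" and iso: "is_isomorphism \<phi> (trivial_family w) W"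
    using assms by (simp_all add: tate_marking_def)
  define \<delta> where "\<delta> = CC ((w - 1)^2) (w^2 - w) (w^2 - 2 * w) ((w^2 - w)^2)"
  define w' where "w' = 1 / (1 - w)"
  have w': "w' * (1 - w) = 1" using w by (simp add: w'_def)
  have \<delta>: "is_isomorphism \<delta> (trivial_family w') (trivial_family w)"
    unfolding \<delta>_def is_isomorphism_def trivial_family_def coord_change.case weierstrass.sel
  proof (intro conjI)
    show "(w - 1)^2 \<noteq> 0" using w by simp
  qed (use w' in algebra)+
  have "tate_marking (trivial_family w) (tate_point w 4) w' \<delta>"
    using \<delta> w w' by (auto simp: tate_marking_def \<delta>_def tate_point_values w'_def)
  from marking_transport[OF this iso] show ?thesis
    by (auto simp: marking_mult[OF assms] w'_def)
qed

section \<open>Every point of order seven has a Tate marking\<close>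

lemma tate_form_origin:
  fixes b c :: "'s::field"
  assumes b: "b \<noteq> 0"
  defines "T \<equiv> tate_form b c"
  shows "point_neg T (Affine 0 0) = Affine 0 b"
    and "point_add T (Affine 0 0) (Affine 0 0) = Affine b (b * c)"
    and "point_add T (Affine 0 0) (Affine b (b * c)) = Affine c (b - c)"
    and "point_add T (Affine 0 b) (Affine 0 b) = Affine b 0"
    and "point_add T (Affine 0 b) (Affine b 0) = Affine c (c^2)"
proof -
  show "point_neg T (Affine 0 0) = Affine 0 b" by (simp add: T_def tate_form_def)
  show "point_add T (Affine 0 0) (Affine 0 0) = Affine b (b * c)"
    unfolding T_def by (rule tate_form_double[where l = 0]) (use b in \<open>simp_all add: algebra_simps\<close>)
  show "point_add T (Affine 0 0) (Affine b (b * c)) = Affine c (b - c)"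
    unfolding T_def
    by (rule tate_form_add[where l = c]) (use b in \<open>simp_all add: algebra_simps power2_eq_square\<close>)
  show "point_add T (Affine 0 b) (Affine 0 b) = Affine b 0"
    unfolding T_def
    by (rule tate_form_double[where l = "c - 1"])
      (use b in \<open>simp_all add: algebra_simps power2_eq_square\<close>)
  show "point_add T (Affine 0 b) (Affine b 0) = Affine c (c^2)"
    unfolding T_def
    by (rule tate_form_add[where l = "- 1"]) (use b in \<open>simp_all add: algebra_simps power2_eq_square\<close>)
qed

text \<open>
  \<open>-P + (P + Q) = Q\<close> for the origin \<open>P\<close>, by comparing the two lines: the points \<open>P\<close>, \<open>Q\<close> and \<open>-(P + Q)\<close>
  are collinear, and so are their negatives.
\<close>

lemma tate_form_cancel:
  fixes b c :: "'s::field"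
  assumes b: "b \<noteq> 0"
  defines "T \<equiv> tate_form b c"
  assumes Q: "Q \<in> curve_points T"
  shows "point_add T (Affine 0 b) (point_add T (Affine 0 0) Q) = Q"
proof -
  note origin = tate_form_origin[OF b, of c, folded T_def]
  have neg: "point_neg T (Affine 0 b) = Affine 0 0"
    using origin(1) point_neg_neg by metis
  have add_neg: "point_add T (Affine 0 0) (Affine 0 b) = Infinity"
      "point_add T (Affine 0 b) (Affine 0 0) = Infinity"
    using origin(1) neg point_add_neg by metis+
  have on_curve: "Affine 0 0 \<in> curve_points T"
    by (simp add: T_def tate_form_def weierstrass_poly_def)
  from on_curve Q show ?thesis
  proof (cases rule: point_add_cases)
    case 2
    then show ?thesis using add_neg by simp
  next
    case 3
    then have "Q = Affine 0 b" using origin(1) by metis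
    then show ?thesis using add_neg point_add_Infinity_right by metis
  next
    case (4 x1 y1 x y l)
    have [simp]: "x1 = 0" "y1 = 0" using 4(1) by simp_all
    have x: "x \<noteq> 0" using 4(3) by simp
    have y: "y = l * x" using 4(4) by simp
    define x3 where "x3 = l^2 + (1 - c) * l + b - x"
    define y3 where "y3 = b - (l + (1 - c)) * x3"
    have R: "point_add T (Affine 0 0) Q = Affine x3 y3"
      unfolding T_def 4(2)
      by (rule tate_form_add[where l = l]) (use x y in \<open>simp_all add: x3_def y3_def algebra_simps\<close>)
    have on: "y^2 + (1 - c) * x * y - b * y - x^3 + b * x^2 = 0"
      using Q by (simp add: 4(2) T_def tate_form_def weierstrass_poly_def algebra_simps)
    have "x * (x * x3 - b * l) = 0"
      using on y unfolding x3_def by algebra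
    then have rel: "x * x3 = b * l" using x by simp
    show ?thesis
    proof (cases "x3 = 0")
      case False
      have x': "x = (- l - (1 - c))^2 + (1 - c) * (- l - (1 - c)) + b - 0 - x3"
        unfolding x3_def by algebra
      have "point_add T (Affine 0 b) (Affine x3 y3) = Affine x y"
        unfolding T_def
      proof (rule tate_form_add[OF _ _ x'])
        show "y = - (b + (- l - (1 - c)) * (x - 0)) - (1 - c) * x + b"
          using y by algebra
        show "(- l - (1 - c)) * (x3 - 0) = y3 - b" unfolding y3_def by algebra
      qed (use False in simp)
      then show ?thesis using R 4(2) by simp
    next
      case True
      with rel b have l: "l = 0" by simp
      then have "x = b" using True by (simp add: x3_def)
      then show ?thesis using R True l y origin(4) by (simp add: y3_def 4(2))
    qed
  next
    case (5 x y l)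
    then have "Q = Affine 0 0" by simp
    moreover have "point_add T (Affine 0 b) (Affine b (b * c)) = Affine 0 0"
      unfolding T_def
      by (rule tate_form_add[where l = "c - 1"])
        (use b in \<open>simp_all add: algebra_simps power2_eq_square\<close>)
    ultimately show ?thesis by (simp only: origin(2))
  qed simp
qed

text \<open>
  The multiples \<open>2P\<close> and \<open>3P\<close> are computed upwards. From \<open>8P = P\<close> the multiples \<open>7P\<close>, \<open>6P\<close>, \<open>5P\<close>, \<open>4P\<close> are
  computed downwards by cancellation. The two resulting values of \<open>4P\<close> agree exactly when
  \<open>c = w\<^sup>2 - w\<close> for \<open>w = b/c\<close>.
\<close>

lemma tate_form_order_7:
  fixes b c :: "'s::field"
  assumes b: "b \<noteq> 0" and 8: "point_mult (tate_form b c) 8 (Affine 0 0) = Affine 0 0"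
  obtains w where "w \<noteq> 0" "w \<noteq> 1" "tate_form b c = trivial_family w"
proof -
  define T where "T = tate_form b c"
  define p where "p n = point_mult T n (Affine 0 0)" for n
  note origin = tate_form_origin[OF b, of c, folded T_def]
  have neg: "point_neg T (Affine 0 b) = Affine 0 0"
    using origin(1) point_neg_neg by metis
  have add_neg: "point_add T (Affine 0 0) (Affine 0 b) = Infinity"
      "point_add T (Affine 0 b) (Affine 0 0) = Infinity"
    using origin(1) neg point_add_neg by metis+
  have Suc: "p (Suc n) = point_add T (Affine 0 0) (p n)" for n
    by (simp add: p_def point_mult_Suc)
  have shift: "p n = point_add T (Affine 0 b) (p (Suc n))" for n
    unfolding Suc T_def
    by (rule tate_form_cancel[OF b, symmetric])
      (simp add: p_def T_def, intro point_mult_in_curve_points,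
       simp add: tate_form_def weierstrass_poly_def)
  have p1: "p 1 = Affine 0 0" by (simp add: p_def)
  have p2: "p 2 = Affine b (b * c)" using Suc[of 1] p1 origin(2) by (simp add: numeral_2_eq_2)
  have p3: "p 3 = Affine c (b - c)" using Suc[of 2] p2 origin(3) by simp
  have p8: "p 8 = Affine 0 0" using 8 by (simp add: p_def T_def)
  have p7: "p 7 = Infinity" using shift[of 7] p8 add_neg by simp
  have p6: "p 6 = Affine 0 b" using shift[of 6] p7 by simp
  have p5: "p 5 = Affine b 0" using shift[of 5] p6 origin(4) by simp
  have p4: "p 4 = Affine c (c^2)" using shift[of 4] p5 origin(5) by simp
  \<comment> \<open>for \<open>c = 0\<close> already \<open>3P = -P\<close>\<close>
  have c: "c \<noteq> 0"
  proof
    assume c: "c = 0"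
    have "p 4 = Infinity"
      using Suc[of 3] p3 add_neg c by simp
    then show False using p4 by simp
  qed
  define w where "w = b / c"
  have w: "b = w * c" using c by (simp add: w_def)
  have "p 4 = Affine (w^2 - w) ((w - 1) * (- (w^2 - w)) - (1 - c) * (w^2 - w) + b)"
  proof -
    have "point_add T (Affine 0 0) (Affine c (b - c)) =
        Affine (w^2 - w) ((w - 1) * (- (w^2 - w)) - (1 - c) * (w^2 - w) + b)"
      unfolding T_def
      by (rule tate_form_add[where l = "w - 1"]) (use c w in \<open>simp_all add: algebra_simps power2_eq_square\<close>)
    then show ?thesis using Suc[of 3] p3 by simp
  qed
  then have cw: "c = w^2 - w" using p4 by simp
  have bw: "b = w^3 - w^2" using w cw by algebra
  have "w \<noteq> 0" "w \<noteq> 1" using c cw by auto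
  moreover have "tate_form b c = trivial_family w"
    by (simp add: tate_form_def trivial_family_def bw cw)
  ultimately show thesis by (rule that)
qed

lemma mult_8_isomorphism:
  assumes "is_isomorphism \<phi> W' W" "P \<in> curve_points W'"
    and "point_mult W 8 (cc_apply \<phi> P) = cc_apply \<phi> P"
  shows "point_mult W' 8 P = P"
  using assms isomorphism_mult[OF assms(1,2), of 8] cc_apply_eq_iff[OF isomorphism_u[OF assms(1)]]
  by metis

text \<open>
  The hypothesis \<open>8P = P\<close> is the relation that an action by a character modulo seven provides for the
  identity automorphism, as \<open>8\<close> represents the residue class of \<open>1\<close>. Tate's normalisation moves \<open>P\<close> to
  the origin, makes its tangent horizontal and scales to \<open>a2 = a3\<close>; the coefficients by which it divides
  are not zero because \<open>2P\<close> and \<open>3P\<close> are not zero.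
\<close>

lemma marking_exists:
  fixes W :: "'s::field weierstrass"
  assumes P: "P \<in> curve_points W" "P \<noteq> Infinity" and 8: "point_mult W 8 P = P"
  shows "\<exists>w \<phi>. tate_marking W P w \<phi>"
proof -
  obtain r t where rt: "P = Affine r t" using P(2) by (cases P) auto
  have on: "a6 W + r * a4 W + r^2 * a2 W + r^3 - t * a3 W - t^2 - r * t * a1 W = 0"
    using P(1) unfolding rt Affine_in_curve_points weierstrass_poly_def by algebra
  define origin :: "'s point" where "origin = Affine 0 0"
  define \<phi>0 where "\<phi>0 = CC 1 r 0 t"
  define W0 where "W0 = Weierstrass (a1 W) (a2 W + 3 * r) (a3 W + r * a1 W + 2 * t)
     (a4 W + 2 * r * a2 W - t * a1 W + 3 * r^2) 0"
  have iso0: "is_isomorphism \<phi>0 W0 W"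
    using on by (simp add: is_isomorphism_def \<phi>0_def W0_def)
  have O0: "origin \<in> curve_points W0" by (simp add: origin_def W0_def weierstrass_poly_def)
  have P0: "cc_apply \<phi>0 origin = P" by (simp add: \<phi>0_def origin_def rt)
  have 80: "point_mult W0 8 origin = origin" using mult_8_isomorphism[OF iso0 O0] 8 P0 by simp
  \<comment> \<open>with \<open>2P = 0\<close> or \<open>3P = 0\<close> the eightfold sum collapses to \<open>0\<close> or to \<open>-P\<close>\<close>
  have n8: "point_mult V 8 Q = point_add V Q (point_add V Q (point_add V Q (point_add V Q
      (point_add V Q (point_add V Q (point_add V Q Q))))))" for V :: "'s weierstrass" and Q
    by (simp add: numeral_nat(2-) point_mult_Suc)
  have a3: "a3 W0 \<noteq> 0"
  proof
    assume "a3 W0 = 0"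
    then have "point_add W0 origin origin = Infinity" by (simp add: origin_def)
    then have "point_mult W0 8 origin = Infinity" by (simp add: n8)
    then show False using 80 by (simp add: origin_def)
  qed
  define s where "s = a4 W0 / a3 W0"
  have s: "a4 W0 = s * a3 W0" using a3 by (simp add: s_def)
  define \<phi>1 where "\<phi>1 = CC 1 0 s 0"
  define W1 where "W1 = Weierstrass (a1 W0 + 2 * s) (a2 W0 - s * a1 W0 - s^2) (a3 W0) 0 0"
  have iso1: "is_isomorphism \<phi>1 W1 W0"
    using s by (simp add: is_isomorphism_def \<phi>1_def W1_def W0_def)
  have O1: "origin \<in> curve_points W1" by (simp add: origin_def W1_def weierstrass_poly_def)
  have P1: "cc_apply \<phi>1 origin = origin" by (simp add: \<phi>1_def origin_def)
  have 81: "point_mult W1 8 origin = origin" using mult_8_isomorphism[OF iso1 O1] 80 P1 by simp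
  have a2: "a2 W1 \<noteq> 0"
  proof
    assume a2: "a2 W1 = 0"
    have a3': "a3 W1 \<noteq> 0" using a3 by (simp add: W1_def)
    have n: "point_neg W1 origin = Affine 0 (- a3 W1)" by (simp add: origin_def)
    have "point_add W1 origin origin = chord_point W1 0 0 0 0"
      unfolding origin_def by (rule point_add_tangent) (use a3' in \<open>simp_all add: W1_def\<close>)
    also have "\<dots> = point_neg W1 origin" using a2 by (simp add: chord_point_def origin_def)
    finally have 2: "point_add W1 origin origin = point_neg W1 origin" .
    have "point_mult W1 8 origin = point_neg W1 origin" by (simp add: n8 2)
    then show False using 81 n a3' by (simp add: origin_def)
  qed
  define u where "u = a3 W1 / a2 W1"
  have u: "u \<noteq> 0" using a3 a2 by (simp add: u_def W1_def)
  have ua: "a3 W1 = u * a2 W1" using a2 by (simp add: u_def)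
  define \<phi>2 where "\<phi>2 = CC u 0 0 0"
  define b where "b = - (a2 W1 / u^2)"
  define c where "c = 1 - a1 W1 / u"
  have iso2: "is_isomorphism \<phi>2 (tate_form b c) W1"
    using u ua by (simp add: is_isomorphism_def \<phi>2_def tate_form_def b_def c_def)
      (simp add: W1_def power2_eq_square power3_eq_cube)
  have O2: "origin \<in> curve_points (tate_form b c)"
    by (simp add: origin_def tate_form_def weierstrass_poly_def)
  have P2: "cc_apply \<phi>2 origin = origin" by (simp add: \<phi>2_def origin_def)
  have 82: "point_mult (tate_form b c) 8 origin = origin"
    using mult_8_isomorphism[OF iso2 O2] 81 P2 by simp
  have "b \<noteq> 0" using a2 u by (simp add: b_def)
  then obtain w where w: "w \<noteq> 0" "w \<noteq> 1" "tate_form b c = trivial_family w"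
    using 82 tate_form_order_7 unfolding origin_def by metis
  have "is_isomorphism (cc_comp \<phi>0 (cc_comp \<phi>1 \<phi>2)) (trivial_family w) W"
    using iso0 iso1 iso2 w(3) by (auto intro: cc_comp_isomorphism)
  moreover have "cc_apply (cc_comp \<phi>0 (cc_comp \<phi>1 \<phi>2)) origin = P"
    by (simp add: cc_apply_comp P0 P1 P2)
  ultimately show ?thesis using w by (auto simp: tate_marking_def origin_def)
qed

section \<open>The twisted family over a root of its cubic\<close>

text \<open>
  For \<open>t (g (g - 1)) = g\<^sup>3 - 3 g\<^sup>2 + 1\<close>, that is, for a root \<open>g\<close> of the simplest cubic,
  \<open>level_point t g v\<close> is the point of order seven on \<open>cubic_family t v\<close> that is defined with the help of
  \<open>g\<close>; \<open>level_x\<close> and \<open>level_y\<close> are the polynomials in \<open>g\<close> and \<open>v\<close> that occur in its coordinates.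
\<close>

definition level_x :: "'s::field \<Rightarrow> 's \<Rightarrow> 's" where
  "level_x g v = g * (g + v * (g^2 - 3*g + 1))"

definition level_y :: "'s::field \<Rightarrow> 's \<Rightarrow> 's" where
  "level_y g v =
     (- 2*g^8 + 8*g^7 - 5*g^6 - 13*g^5 + 13*g^4 + 5*g^3 - 8*g^2 + 2*g) * v^3
     + (g^9 - 6*g^8 + 15*g^7 - 24*g^6 + 24*g^5 - 15*g^4 + 3*g^3 + 3*g^2 - 3*g + 1) * v^2
     + (13*g^6 - 39*g^5 + 39*g^4 - 13*g^3) * v
     + (- 2*g^7 + 6*g^6 - 2*g^5 - 8*g^4 + 8*g^3 - 2*g^2)"

definition level_point :: "'s::field \<Rightarrow> 's \<Rightarrow> 's \<Rightarrow> 's point" where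
  "level_point t g v =
     (let c = t^2 + 3*t + 9; f = v^3 - (t + 3) * v^2 + t * v + 1; D = g * (g - 1)
      in Affine (- (c * f * level_x g v) / D) (- (c * f * level_y g v) / D^3))"

text \<open>
  Polynomial identities in \<open>g\<close> and \<open>v\<close> alone. Clearing denominators in \<open>w = X/Z\<close> and scaling by \<open>q\<close> turns
  \<open>trivial_family w\<close> into the curve \<open>model\<close> below. The change of coordinates with
  entries \<open>(- q F B, S, - F \<tau>)\<close> then leads from it to the coefficients of the family, written with \<open>n\<close> and
  \<open>D\<close> in place of the parameter \<open>n/D\<close> of the cubic. Dividing by the powers of \<open>F\<close> that occur leaves
  identities of small degree.
\<close>

locale twisted_tate =
  fixes g v n D q X Y Z F S B N \<tau> :: "'s::field"
  assumes n: "n = g^3 - 3*g^2 + 1" and D: "D = g * (g - 1)" and q: "q = g^2 - g + 1"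
    and X: "X = g - v" and Z: "Z = (g - 1) * v + 1" and Y: "Y = Z - X" and F: "F = X * Y * Z"
    and S: "S = q * (g * v^2 - (g^2 + g - 1) * v + g^2 - g)"
    and B: "B = level_x g v" and N: "N = level_y g v" and \<tau>: "\<tau> = N + q * S * B"
begin

text \<open>
  Up to sign, the cofactors of the powers of \<open>c\<close> and \<open>f(v)\<close> in the coefficients \<open>a3\<close>, \<open>a4\<close> and \<open>a6\<close> of the
  family, made homogeneous in \<open>n\<close> and \<open>D\<close> by the substitution of \<open>n/D\<close> for the parameter of the cubic.
\<close>

definition numer3 :: 's where
  "numer3 = (n^3 - D^3) * v^3 + (n^3 - D^3) * v + n^2*D - n*D^2 + D^3"

definition numer4 :: 's where
  "numer4 = (-3*n^2*D - 5*n*D^2 - 2*D^3) * v^5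
      + (2*n^3 + 8*n^2*D + 8*n*D^2 - 7*D^3) * v^4
      - (3*n^3 + 6*n^2*D + 5*n*D^2 - 20*D^3) * v^3 + (2*n^3 - n*D^2 - 23*D^3) * v^2
      + 2 * (n^2*D + 2*n*D^2 + 7*D^3) * v - n*D^2 - D^3"

definition numer6 :: 's where
  "numer6 = (2*n^5*D + 9*n^4*D^2 + 23*n^3*D^3 + 35*n^2*D^4 + 24*n*D^5 + 11*D^6) * v^6
      + (- (n^6) - 6*n^5*D - 23*n^4*D^2 - 38*n^3*D^3 - 33*n^2*D^4 + 36*n*D^5) * v^5
      + (n^6 + 6*n^5*D + 18*n^4*D^2 - 6*n^3*D^3 - 60*n^2*D^4 - 180*n*D^5 + 13*D^6) * v^4
      + (- (n^6) - 2*n^5*D + 46*n^3*D^3 + 84*n^2*D^4 + 142*n*D^5 - 139*D^6) * v^3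
      + (- (n^5*D) - 5*n^4*D^2 - 27*n^3*D^3 - 15*n^2*D^4 + 9*n*D^5 + 182*D^6) * v^2
      + (2*n^4*D^2 + 3*n^3*D^3 - 10*n^2*D^4 - 32*n*D^5 - 67*D^6) * v
      + 2*n^3*D^3 + 5*n^2*D^4 + 11*n*D^5 + 11*D^6"

lemma model_a1: "q^2 * (v^2 - v + 1) = q * (Z^2 + X * Z - X^2) + 2 * S"
  unfolding S q Z X by algebra

lemma model_a2: "- (q * F * n * (2*v - 1))
    = q^2 * X * F - S * (q * (Z^2 + X * Z - X^2)) + 3 * (- (q * F * B)) - S^2"
  unfolding S F n B level_x_def q Y Z X by algebra

lemma model_a3: "- (F * numer3)
    = q^3 * X * Z^2 * F + (- (q * F * B)) * (q * (Z^2 + X * Z - X^2)) + 2 * (- (F * \<tau>))"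
proof -
  have "numer3
    = - (q^3 * X * Z^2) + q^2 * B * (Z^2 + X * Z - X^2) + 2 * \<tau>"
    unfolding numer3_def unfolding \<tau> N level_y_def S n D B level_x_def q Z X by algebra
  then show ?thesis by algebra
qed

lemma model_a4: "q^2 * F * numer4
    = - (S * (q^3 * X * Z^2 * F)) + 2 * (- (q * F * B)) * (q^2 * X * F)
      - (- (F * \<tau>) + (- (q * F * B)) * S) * (q * (Z^2 + X * Z - X^2))
      + 3 * (- (q * F * B))^2 - 2 * S * (- (F * \<tau>))"
proof -
  have "q^2 * numer4
    = - (S * (q^3 * X * Z^2)) - 2 * q^3 * B * X * F
      + (\<tau> + q * B * S) * (q * (Z^2 + X * Z - X^2)) + 3 * q^2 * F * B^2 + 2 * S * \<tau>"
    unfolding numer4_def unfolding F \<tau> N level_y_def S n D B level_x_def q Y Z X by algebra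
  then show ?thesis by algebra
qed

lemma model_a6: "F^2 * numer6
    = (- (q * F * B))^2 * (q^2 * X * F) + (- (q * F * B))^3 - (- (F * \<tau>)) * (q^3 * X * Z^2 * F)
      - (- (F * \<tau>))^2 - (- (q * F * B)) * (- (F * \<tau>)) * (q * (Z^2 + X * Z - X^2))"
proof -
  have "numer6
    = q^4 * B^2 * X * F - q^3 * B^3 * F + q^3 * X * Z^2 * \<tau> - \<tau>^2
      - q^2 * B * \<tau> * (Z^2 + X * Z - X^2)"
    unfolding numer6_def unfolding F \<tau> N level_y_def S n D B level_x_def q Y Z X by algebra
  then show ?thesis by algebra
qed

definition model :: "'s weierstrass" where
  "model = Weierstrass (q * (Z^2 + X * Z - X^2)) (q^2 * X * F) (q^3 * X * Z^2 * F) 0 0"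

text \<open>
  With \<open>X = w Z\<close> the coefficient of weight \<open>i\<close> of \<open>trivial_family w\<close> is multiplied by the \<open>i\<close>-th power of
  \<open>q Z\<^sup>2\<close>.
\<close>

lemma model_scaling:
  assumes "q \<noteq> 0" "Z \<noteq> 0" and w: "w = X / Z"
  shows "is_isomorphism (CC (q * Z^2) 0 0 0) (trivial_family w) model"
proof -
  have X': "X = w * Z" using assms by simp
  show ?thesis
    unfolding is_isomorphism_def model_def trivial_family_def coord_change.case weierstrass.sel
  proof (intro conjI)
    show "q * Z^2 \<noteq> 0" using assms by simp
    show "q * Z^2 * (- (w^2) + w + 1) = q * (Z^2 + X * Z - X^2) + 2 * 0"
      unfolding X' by algebra
    show "(q * Z^2)^2 * (- (w^3) + w^2) = q^2 * X * F - 0 * (q * (Z^2 + X * Z - X^2)) + 3 * 0 - 0^2"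
    proof -
      have "(q * Z^2)^2 * (- (w^3) + w^2) = q^2 * X * F" unfolding F Y X' by algebra
      then show ?thesis by simp
    qed
    show "(q * Z^2)^3 * (- (w^3) + w^2) = q^3 * X * Z^2 * F + 0 * (q * (Z^2 + X * Z - X^2)) + 2 * 0"
    proof -
      have "(q * Z^2)^3 * (- (w^3) + w^2) = q^3 * X * Z^2 * F" unfolding F Y X' by algebra
      then show ?thesis by simp
    qed
  qed simp_all
qed

end

text \<open>
  The equation \<open>root\<close> says that \<open>g\<close> is a root of the simplest cubic with parameter \<open>t\<close>. It implies
  \<open>c D\<^sup>2 = q\<^sup>3\<close> and \<open>f(v) D = - F\<close>, so the factors \<open>c\<close> and \<open>f(v)\<close> of the coefficients turn into \<open>q\<close> and \<open>F\<close> after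
  scaling by \<open>lam\<close>.
\<close>

locale cubic_level = twisted_tate g v n D q X Y Z F S B N \<tau>
  for g v n D q X Y Z F S B N \<tau> :: "'s::field" +
  fixes t c f lam :: 's
  assumes root: "t * D = n" and D0: "D \<noteq> 0" and q0: "q \<noteq> 0"
    and c: "c = t^2 + 3*t + 9" and f: "f = v^3 - (t + 3) * v^2 + t * v + 1"
    and lam: "lam = D^2 / q"
begin

lemma lam_q: "lam * q = D^2"
  using q0 by (simp add: lam)

lemma c_D: "c * D^2 = q^3"
proof -
  have "c * D^2 = n^2 + 3*n*D + 9*D^2" unfolding c root[symmetric] by algebra
  also have "\<dots> = q^3" unfolding n D q by algebra
  finally show ?thesis .
qed

lemma lam_c: "lam * c = q^2"
proof -
  have "q * (lam * c) = q * q^2" using lam_q c_D by algebra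
  then show ?thesis using q0 by simp
qed

lemma f_D: "f * D = - F"
proof -
  have "f * D = v^3 * D - (n + 3*D) * v^2 + n * v + D" unfolding f root[symmetric] by algebra
  also have "\<dots> = - F" unfolding F Y n D X Z by algebra
  finally show ?thesis .
qed

abbreviation family :: "'s weierstrass" where "family \<equiv> cubic_family t v"

lemma lam_a1: "lam * a1 family = q^2 * (v^2 - v + 1)"
  using lam_c by (simp add: cubic_family_def Let_def flip: c)

lemma lam_a2: "lam^2 * a2 family = - (q * F * n * (2*v - 1))"
proof -
  have "a2 family = c * f * t * (2*v - 1)"
    by (simp add: cubic_family_def Let_def flip: c f)
  then have "lam^2 * a2 family = (lam * c) * lam * f * t * (2*v - 1)" by algebra
  also have "\<dots> = q * (lam * q) * f * t * (2*v - 1)" unfolding lam_c by algebra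
  also have "\<dots> = q * (f * D) * (t * D) * (2*v - 1)" unfolding lam_q by algebra
  also have "\<dots> = - (q * F * n * (2*v - 1))" unfolding f_D root by algebra
  finally show ?thesis .
qed

lemma lam_a3: "lam^3 * a3 family
  = - (F * numer3)"
proof -
  have "a3 family = c * f * ((t^3 - 1) * v^3 + (t^3 - 1) * v + t^2 - t + 1)"
    by (simp add: cubic_family_def Let_def flip: c f)
  then have "lam^3 * a3 family
      = (lam * c) * lam^2 * f * ((t^3 - 1) * v^3 + (t^3 - 1) * v + t^2 - t + 1)" by algebra
  also have "\<dots> = (lam * q)^2 * f * ((t^3 - 1) * v^3 + (t^3 - 1) * v + t^2 - t + 1)"
    unfolding lam_c by algebra
  also have "\<dots> = (f * D) * (((t*D)^3 - D^3) * v^3 + ((t*D)^3 - D^3) * v + (t*D)^2*D - (t*D)*D^2 + D^3)"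
    unfolding lam_q by algebra
  finally show ?thesis unfolding numer3_def f_D root by algebra
qed

lemma lam_a4: "lam^4 * a4 family = q^2 * F * numer4"
proof -
  define p where "p = (-3*t^2 - 5*t - 2) * v^5 + (2*t^3 + 8*t^2 + 8*t - 7) * v^4
           - (3*t^3 + 6*t^2 + 5*t - 20) * v^3 + (2*t^3 - t - 23) * v^2
           + 2 * (t^2 + 2*t + 7) * v - t - 1"
  have "a4 family = - (c^2 * f * p)"
    unfolding cubic_family_def Let_def weierstrass.sel c f p_def by (rule refl)
  then have "lam^4 * a4 family = - ((lam * c)^2 * lam^2 * f * p)" by algebra
  also have "\<dots> = - (q^2 * (lam * q)^2 * f * p)" unfolding lam_c by algebra
  also have "\<dots> = - (q^2 * (f * D) * (D^3 * p))" unfolding lam_q by algebra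
  also have "D^3 * p = numer4"
    unfolding numer4_def unfolding root[symmetric] p_def by algebra
  finally show ?thesis unfolding f_D by algebra
qed

lemma lam_a6: "lam^6 * a6 family
   = F^2 * numer6"
proof -
  define p where "p = (2*t^5 + 9*t^4 + 23*t^3 + 35*t^2 + 24*t + 11) * v^6
           + (- (t^6) - 6*t^5 - 23*t^4 - 38*t^3 - 33*t^2 + 36*t) * v^5
           + (t^6 + 6*t^5 + 18*t^4 - 6*t^3 - 60*t^2 - 180*t + 13) * v^4
           + (- (t^6) - 2*t^5 + 46*t^3 + 84*t^2 + 142*t - 139) * v^3
           + (- (t^5) - 5*t^4 - 27*t^3 - 15*t^2 + 9*t + 182) * v^2
           + (2*t^4 + 3*t^3 - 10*t^2 - 32*t - 67) * v + 2*t^3 + 5*t^2 + 11*t + 11"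
  have "a6 family = c^2 * f^2 * p"
    by (simp add: cubic_family_def Let_def flip: c f p_def)
  then have "lam^6 * a6 family = (lam * c)^2 * lam^4 * f^2 * p" by algebra
  also have "\<dots> = (lam * q)^4 * f^2 * p" unfolding lam_c by algebra
  also have "\<dots> = (f * D)^2 * (D^6 * p)" unfolding lam_q by algebra
  also have "D^6 * p = numer6"
    unfolding numer6_def unfolding root[symmetric] p_def by algebra
  finally show ?thesis unfolding f_D by algebra
qed

definition \<kappa> :: "'s coord_change" where
  "\<kappa> = CC lam (- (q * F * B)) S (- (F * \<tau>))"

lemma lam0: "lam \<noteq> 0"
  using q0 D0 by (simp add: lam)

lemma family_model: "is_isomorphism \<kappa> family model"
  unfolding is_isomorphism_def \<kappa>_def model_def coord_change.case weierstrass.sel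
    lam_a1 lam_a2 lam_a3 lam_a4 lam_a6 model_a1 model_a2 model_a3 model_a4 model_a6
  using lam0 by simp

lemma level_point_origin: "cc_apply \<kappa> (level_point t g v) = Affine 0 0"
proof -
  have e: "level_point t g v = Affine (- (c * f * B) / D) (- (c * f * N) / D^3)"
    by (simp add: level_point_def Let_def B N flip: c f D)
  have "lam^2 * (- (c * f * B) / D) = q * F * B"
  proof -
    have "D * (lam^2 * (- (c * f * B) / D)) = - ((lam * c) * lam * f * B)"
      using D0 by (simp add: power2_eq_square)
    also have "\<dots> = - (q * (lam * q) * f * B)" unfolding lam_c by algebra
    also have "\<dots> = D * (- (q * (f * D) * B))" unfolding lam_q by algebra
    finally have "lam^2 * (- (c * f * B) / D) = - (q * (f * D) * B)"
      unfolding mult_left_cancel[OF D0] .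
    then show ?thesis unfolding f_D by simp
  qed
  moreover have "lam^3 * (- (c * f * N) / D^3) = F * N"
  proof -
    have "D^3 * (lam^3 * (- (c * f * N) / D^3)) = - ((lam * c) * lam^2 * f * N)"
      using D0 by (simp add: power2_eq_square power3_eq_cube)
    also have "\<dots> = - ((lam * q)^2 * f * N)" unfolding lam_c by algebra
    also have "\<dots> = D^3 * (- (f * D) * N)" unfolding lam_q by algebra
    finally have "lam^3 * (- (c * f * N) / D^3) = - (f * D) * N"
      unfolding mult_left_cancel[OF power_not_zero[OF D0]] .
    then show ?thesis unfolding f_D by simp
  qed
  moreover have "cc_apply \<kappa> (level_point t g v)
      = Affine (lam^2 * (- (c * f * B) / D) - q * F * B)
         (lam^3 * (- (c * f * N) / D^3) + S * (lam^2 * (- (c * f * B) / D)) - F * \<tau>)"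
    by (simp add: e \<kappa>_def)
  ultimately have "cc_apply \<kappa> (level_point t g v)
      = Affine (q * F * B - q * F * B) (F * N + S * (q * F * B) - F * \<tau>)" by (simp only:)
  also have "F * N + S * (q * F * B) - F * \<tau> = 0" unfolding \<tau> by algebra
  finally show ?thesis by simp
qed

text \<open>
  The right-hand side is the fourth multiple of the marked point, scaled to \<open>model\<close>. With \<open>h = 1 - g\<close> the
  conjugate root is \<open>g' = 1/h\<close>, and since \<open>level_y\<close> has degree nine in its first argument,
  \<open>h\<^sup>9\<close> times its value at \<open>g'\<close> is again a polynomial in \<open>g\<close> and \<open>v\<close>.
\<close>

lemma level_point_conjugate:
  "cc_apply \<kappa> (level_point t (1 / (1 - g)) v)
    = Affine (- (q^2 * Z * F)) (q^3 * F^2)"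
proof -
  define h where "h = 1 - g"
  define g' where "g' = 1 / h"
  have gh: "g = 1 - h" by (simp add: h_def)
  have h0: "h \<noteq> 0" and g0: "g \<noteq> 0" using D0 by (auto simp: D h_def)
  have g': "h * g' = 1" using h0 by (simp add: g'_def)
  define D' where "D' = g' * (g' - 1)"
  have D': "h^2 * D' = g" using g' unfolding D'_def gh by algebra
  have D'0: "D' \<noteq> 0" using D' g0 by auto
  have Dg: "D = - (g * h)" unfolding D h_def by algebra
  define B' where "B' = level_x g' v"
  define N' where "N' = level_y g' v"
  have B': "h^3 * B' = h + v * (g^2 + g - 1)"
    using g' unfolding B'_def level_x_def gh by algebra
  have BZ: "h + v * (g^2 + g - 1) = q * Z - B"
    unfolding h_def q Z B level_x_def by algebra
  have pw: "h^9 * g' = h^8" "h^9 * g'^2 = h^7" "h^9 * g'^3 = h^6" "h^9 * g'^4 = h^5"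
    "h^9 * g'^5 = h^4" "h^9 * g'^6 = h^3" "h^9 * g'^7 = h^2" "h^9 * g'^8 = h" "h^9 * g'^9 = 1"
    using g' by algebra+
  have "h^9 * N' =
     (- 2*(h^9*g'^8) + 8*(h^9*g'^7) - 5*(h^9*g'^6) - 13*(h^9*g'^5) + 13*(h^9*g'^4) + 5*(h^9*g'^3)
       - 8*(h^9*g'^2) + 2*(h^9*g')) * v^3
     + ((h^9*g'^9) - 6*(h^9*g'^8) + 15*(h^9*g'^7) - 24*(h^9*g'^6) + 24*(h^9*g'^5) - 15*(h^9*g'^4)
       + 3*(h^9*g'^3) + 3*(h^9*g'^2) - 3*(h^9*g') + h^9) * v^2
     + (13*(h^9*g'^6) - 39*(h^9*g'^5) + 39*(h^9*g'^4) - 13*(h^9*g'^3)) * v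
     + (- 2*(h^9*g'^7) + 6*(h^9*g'^6) - 2*(h^9*g'^5) - 8*(h^9*g'^4) + 8*(h^9*g'^3) - 2*(h^9*g'^2))"
    unfolding N'_def level_y_def by algebra
  also have "\<dots> = - (q^3 * F + q * (q * Z - B) * S + \<tau>)"
    unfolding pw unfolding \<tau> N level_y_def S F Y B level_x_def q X Z h_def by algebra
  finally have N'h: "h^9 * N' = - (q^3 * F + q * (q * Z - B) * S + \<tau>)" .
  have e: "level_point t (1 / (1 - g)) v = Affine (- (c * f * B') / D') (- (c * f * N') / D'^3)"
    by (simp add: level_point_def Let_def B'_def N'_def g'_def h_def D'_def flip: c f)
  have x: "lam^2 * (- (c * f * B') / D') = - (q * F * (q * Z - B))"
  proof -
    have "(h^3 * D') * (lam^2 * (- (c * f * B') / D')) = - ((lam * c) * lam * f * (h^3 * B'))"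
      using D'0 by (simp add: power2_eq_square)
    also have "\<dots> = - (q * (lam * q) * f * (q * Z - B))" unfolding lam_c B' BZ by algebra
    also have "\<dots> = (h * g) * (q * (f * D) * (q * Z - B))" unfolding lam_q Dg by algebra
    also have "h * g = h^3 * D'" unfolding D'[symmetric] by algebra
    finally have "lam^2 * (- (c * f * B') / D') = q * (f * D) * (q * Z - B)"
      using D'0 h0 by (subst (asm) mult_left_cancel) auto
    then show ?thesis unfolding f_D by simp
  qed
  have y: "lam^3 * (- (c * f * N') / D'^3) = F * (q^3 * F + q * (q * Z - B) * S + \<tau>)"
  proof -
    have "(h^9 * D'^3) * (lam^3 * (- (c * f * N') / D'^3)) = - ((lam * c) * lam^2 * f * (h^9 * N'))"
      using D'0 by (simp add: power2_eq_square power3_eq_cube)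
    also have "\<dots> = (lam * q)^2 * f * (q^3 * F + q * (q * Z - B) * S + \<tau>)"
      unfolding lam_c N'h by algebra
    also have "\<dots> = (h^3 * g^3) * (- (f * D) * (q^3 * F + q * (q * Z - B) * S + \<tau>))"
      unfolding lam_q Dg by algebra
    also have "h^3 * g^3 = h^9 * D'^3" unfolding D'[symmetric] by algebra
    finally have "lam^3 * (- (c * f * N') / D'^3) = - (f * D) * (q^3 * F + q * (q * Z - B) * S + \<tau>)"
      using D'0 h0 by (subst (asm) mult_left_cancel) auto
    then show ?thesis unfolding f_D by simp
  qed
  have "cc_apply \<kappa> (level_point t (1 / (1 - g)) v)
      = Affine (lam^2 * (- (c * f * B') / D') - q * F * B)
         (lam^3 * (- (c * f * N') / D'^3) + S * (lam^2 * (- (c * f * B') / D')) - F * \<tau>)"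
    by (simp add: e \<kappa>_def)
  also have "\<dots> = Affine (- (q^2 * Z * F)) (q^3 * F^2)"
    unfolding x y point.inject by (intro conjI; algebra)
  finally show ?thesis .
qed

text \<open>
  The condition on \<open>X\<close>, \<open>Y\<close>, \<open>Z\<close> says that \<open>v\<close> is not a root of the simplest cubic; the parameter \<open>X/Z\<close>
  then avoids \<open>0\<close>, \<open>1\<close> and infinity.
\<close>

lemma marking:
  assumes "X \<noteq> 0" "Y \<noteq> 0" "Z \<noteq> 0"
  shows "\<exists>\<phi>. tate_marking family (level_point t g v) (X / Z) \<phi>"
    and "point_mult family 4 (level_point t g v) = level_point t (1 / (1 - g)) v"
proof -
  let ?s = "CC (q * Z^2) 0 0 0" and ?w = "X / Z"
  define P where "P = level_point t g v"
  note iso = model_scaling[OF q0 assms(3) refl]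
  have w: "?w \<noteq> 0" "?w \<noteq> 1" using assms by (auto simp: Y)
  have m: "tate_marking model (Affine 0 0) ?w ?s"
    using w iso by (simp add: tate_marking_def)
  have u: "cc_u \<kappa> \<noteq> 0" by (simp add: \<kappa>_def lam0)
  have inv: "cc_apply (cc_inv \<kappa>) (Affine 0 0) = P"
    unfolding level_point_origin[symmetric] P_def using cc_comp_inv[OF u]
    by (metis cc_apply_comp cc_apply_id)
  from marking_transport[OF m cc_inv_isomorphism[OF family_model]]
  have mP: "tate_marking family P ?w (cc_comp (cc_inv \<kappa>) ?s)"
    unfolding inv .
  then show "\<exists>\<phi>. tate_marking family (level_point t g v) ?w \<phi>" unfolding P_def by blast
  have "cc_apply \<kappa> (point_mult family 4 P) = cc_apply ?s (tate_point ?w 4)"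
    unfolding marking_mult[OF mP] using cc_comp_inv[OF u]
    by (metis cc_apply_comp cc_apply_id)
  also have "\<dots> = Affine (- (q^2 * Z * F)) (q^3 * F^2)"
  proof -
    have X': "X = ?w * Z" using assms by simp
    have "(q * Z^2)^2 * (?w^2 - ?w) = - (q^2 * Z * F)"
      unfolding F Y using X' by algebra
    moreover have "(q * Z^2)^3 * (?w^2 - ?w)^2 = q^3 * F^2"
      unfolding F Y using X' by algebra
    ultimately show ?thesis by (simp add: tate_point_values)
  qed
  also have "\<dots> = cc_apply \<kappa> (level_point t (1 / (1 - g)) v)"
    by (rule level_point_conjugate[symmetric])
  finally show "point_mult family 4 (level_point t g v) = level_point t (1 / (1 - g)) v"
    unfolding cc_apply_eq_iff[OF u] P_def .
qed

end

section \<open>The Galois action on points and isomorphisms\<close>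

lemma set_weierstrass_subset:
  "set_weierstrass W \<subseteq> K \<longleftrightarrow> a1 W \<in> K \<and> a2 W \<in> K \<and> a3 W \<in> K \<and> a4 W \<in> K \<and> a6 W \<in> K"
  by (cases W) auto

lemma galois_curve:
  assumes "\<sigma> \<in> galois_group K" "set_weierstrass W \<subseteq> K"
  shows "\<sigma> (a1 W) = a1 W" "\<sigma> (a2 W) = a2 W" "\<sigma> (a3 W) = a3 W" "\<sigma> (a4 W) = a4 W" "\<sigma> (a6 W) = a6 W"
  using assms galois_fixes[OF assms(1)] by (simp_all add: set_weierstrass_subset)

lemma galois_point_neg:
  assumes "\<sigma> \<in> galois_group K" "set_weierstrass W \<subseteq> K"
  shows "map_point \<sigma> (point_neg W P) = point_neg W (map_point \<sigma> P)"
  by (cases P) (simp_all add: galois_curve[OF assms] galois_simps[OF assms(1)])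

lemma galois_map_point_eq_iff:
  assumes "\<sigma> \<in> galois_group K"
  shows "map_point \<sigma> P = map_point \<sigma> Q \<longleftrightarrow> P = Q"
  by (cases P; cases Q) (simp_all add: galois_eq_iff[OF assms])

lemma galois_point_add:
  assumes "\<sigma> \<in> galois_group K" "set_weierstrass W \<subseteq> K"
  shows "map_point \<sigma> (point_add W P Q) = point_add W (map_point \<sigma> P) (map_point \<sigma> Q)"
proof (cases P)
  case P: (Affine x1 y1)
  show ?thesis
  proof (cases Q)
    case Q: (Affine x2 y2)
    show ?thesis
    proof (cases "Q = point_neg W P")
      case True
      then have "map_point \<sigma> Q = point_neg W (map_point \<sigma> P)"
        by (simp only: galois_point_neg[OF assms])
      then show ?thesis using True by simp
    next
      case False
      define l where "l = (if x1 = x2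
                 then (3 * x1 ^ 2 + 2 * a2 W * x1 + a4 W - a1 W * y1) / (2 * y1 + a1 W * x1 + a3 W)
                 else (y2 - y1) / (x2 - x1))"
      have add: "point_add W (Affine x1 y1) (Affine x2 y2) = chord_point W l x1 y1 x2"
        using False by (simp add: P Q l_def chord_point_def Let_def)
      have "point_neg W (map_point \<sigma> P) \<noteq> map_point \<sigma> Q"
        using False galois_map_point_eq_iff[OF assms(1)] galois_point_neg[OF assms] by metis
      moreover have "\<sigma> l = (if \<sigma> x1 = \<sigma> x2
                 then (3 * \<sigma> x1 ^ 2 + 2 * a2 W * \<sigma> x1 + a4 W - a1 W * \<sigma> y1)
                    / (2 * \<sigma> y1 + a1 W * \<sigma> x1 + a3 W)
                 else (\<sigma> y2 - \<sigma> y1) / (\<sigma> x2 - \<sigma> x1))"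
        by (simp add: l_def galois_eq_iff[OF assms(1)] galois_curve[OF assms]
            galois_simps[OF assms(1)] galois_divide[OF assms(1)])
      ultimately have "point_add W (Affine (\<sigma> x1) (\<sigma> y1)) (Affine (\<sigma> x2) (\<sigma> y2))
          = chord_point W (\<sigma> l) (\<sigma> x1) (\<sigma> y1) (\<sigma> x2)"
        by (auto simp: P Q chord_point_def Let_def)
      also have "\<dots> = map_point \<sigma> (chord_point W l x1 y1 x2)"
        by (simp add: chord_point_def Let_def galois_curve[OF assms] galois_simps[OF assms(1)])
      finally show ?thesis by (simp only: P Q add point.map)
    qed
  qed simp
qed simp

lemma galois_point_mult:
  assumes "\<sigma> \<in> galois_group K" "set_weierstrass W \<subseteq> K"
  shows "map_point \<sigma> (point_mult W n P) = point_mult W n (map_point \<sigma> P)"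
  by (induction n) (simp_all add: point_mult_Suc galois_point_add[OF assms])

lemma galois_cc_apply:
  assumes "\<sigma> \<in> galois_group K"
  shows "map_point \<sigma> (cc_apply \<phi> P) = cc_apply (map_coord_change \<sigma> \<phi>) (map_point \<sigma> P)"
  by (cases \<phi>; cases P) (simp_all add: galois_simps[OF assms])

lemma galois_isomorphism:
  assumes \<sigma>: "\<sigma> \<in> galois_group K" and "is_isomorphism \<phi> W' W"
  shows "is_isomorphism (map_coord_change \<sigma> \<phi>) (map_weierstrass \<sigma> W') (map_weierstrass \<sigma> W)"
proof -
  obtain u r s t where e: "\<phi> = CC u r s t" by (cases \<phi>)
  have sel: "a1 (map_weierstrass \<sigma> V) = \<sigma> (a1 V)" "a2 (map_weierstrass \<sigma> V) = \<sigma> (a2 V)"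
    "a3 (map_weierstrass \<sigma> V) = \<sigma> (a3 V)" "a4 (map_weierstrass \<sigma> V) = \<sigma> (a4 V)"
    "a6 (map_weierstrass \<sigma> V) = \<sigma> (a6 V)" for V by (cases V; simp)+
  note hom = galois_simps[OF \<sigma>]
  note nz = isomorphism_equations(1)[OF assms(2)[unfolded e]]
    and A = isomorphism_equations(2-)[OF assms(2)[unfolded e]]
  have "\<sigma> u \<noteq> 0" using nz galois_eq_iff[OF \<sigma>, of u 0] hom(1) by simp
  then show ?thesis
    using A[THEN arg_cong[where f = \<sigma>]] by (simp add: e is_isomorphism_def sel hom)
qed

lemma galois_curve_map:
  assumes "\<sigma> \<in> galois_group K" "set_weierstrass W \<subseteq> K"
  shows "map_weierstrass \<sigma> W = W"
  using galois_curve[OF assms] by (cases W) simp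

text \<open>
  Rationality of coefficients given by long polynomials follows from their invariance.
\<close>

lemma galois_invariant_curve:
  assumes "separable_closure_of K" "\<And>\<sigma>. \<sigma> \<in> galois_group K \<Longrightarrow> map_weierstrass \<sigma> W = W"
  shows "set_weierstrass W \<subseteq> K"
proof
  fix x assume x: "x \<in> set_weierstrass W"
  have "\<sigma> x = x" if "\<sigma> \<in> galois_group K" for \<sigma>
    using assms(2)[OF that] x by (cases W) auto
  then show "x \<in> K" by (rule galois_fixed_field[OF assms(1)])
qed

section \<open>Level structures and quadratic twists\<close>

text \<open>
  \<open>P\<close> has order seven and the Galois group acts on its multiples through \<open>\<chi>\<close>. As in the definition of
  \<open>acts_via\<close>, \<open>n\<close> ranges over all natural numbers that represent \<open>\<chi> \<sigma>\<close>.
\<close>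

definition level_structure ::
  "'s::field set \<Rightarrow> 's weierstrass \<Rightarrow> 's point \<Rightarrow> (('s \<Rightarrow> 's) \<Rightarrow> 7) \<Rightarrow> bool" where
  "level_structure K W P \<chi> \<longleftrightarrow> (\<exists>w \<phi>. tate_marking W P w \<phi>) \<and>
     (\<forall>\<sigma>\<in>galois_group K. \<forall>n. of_nat n = \<chi> \<sigma> \<longrightarrow> map_point \<sigma> P = point_mult W n P)"

lemma marking_mult_cong:
  assumes "tate_marking W P w \<phi>" "(of_nat n :: 7) = of_nat m"
  shows "point_mult W n P = point_mult W m P"
  using assms by (simp add: marking_mult_eq_iff F7_of_nat_eq_iff)

text \<open>
  A generator of the subgroup is a level structure, and its multiples recover the subgroup.
\<close>

lemma rational_subgroup_iff_level_structure:
  assumes E: "set_weierstrass E \<subseteq> K" and \<psi>: "continuous_character K \<psi>"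
  shows "(\<exists>C. rational_subgroup K E C \<and> card C = 7 \<and> acts_via K E C \<psi>)
    \<longleftrightarrow> (\<exists>P. level_structure K E P \<psi>)"
proof
  assume "\<exists>C. rational_subgroup K E C \<and> card C = 7 \<and> acts_via K E C \<psi>"
  then obtain C where C: "C \<subseteq> curve_points E" "card C = 7" and act: "acts_via K E C \<psi>"
    by (auto simp: rational_subgroup_def point_subgroup_def)
  have "\<not> C \<subseteq> {Infinity}" using C(2) card_mono[of "{Infinity}" C] by auto
  then obtain P where P: "P \<in> C" "P \<noteq> Infinity" by blast
  have "map_point id P = point_mult E 8 P"
  proof -
    have "(of_nat 8 :: 7) = \<psi> id" by (simp add: character_id[OF \<psi>])
    then show ?thesis using act P(1) galois_id unfolding acts_via_def by blast
  qed
  then have "point_mult E 8 P = P" by (simp add: point.map_id)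
  then have "\<exists>w \<phi>. tate_marking E P w \<phi>" using marking_exists P C(1) by blast
  then have "level_structure K E P \<psi>"
    using act P(1) by (simp add: level_structure_def acts_via_def)
  then show "\<exists>P. level_structure K E P \<psi>" ..
next
  assume "\<exists>P. level_structure K E P \<psi>"
  then obtain P w \<phi> where m: "tate_marking E P w \<phi>"
    and act: "\<And>\<sigma> n. \<sigma> \<in> galois_group K \<Longrightarrow> of_nat n = \<psi> \<sigma> \<Longrightarrow> map_point \<sigma> P = point_mult E n P"
    by (auto simp: level_structure_def)
  define C where "C = range (\<lambda>n. point_mult E n P)"
  have C7: "C = (\<lambda>n. point_mult E n P) ` {..<7}"
  proof -
    have "point_mult E n P \<in> (\<lambda>n. point_mult E n P) ` {..<7}" for n
      using marking_mult_eq_iff[OF m, of n "n mod 7"] by (intro image_eqI[of _ _ "n mod 7"]) auto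
    then show ?thesis by (auto simp: C_def)
  qed
  have "inj_on (\<lambda>n. point_mult E n P) {..<7}"
    by (auto simp: inj_on_def marking_mult_eq_iff[OF m])
  then have card: "card C = 7" by (simp add: C7 card_image)
  have fin: "finite C" by (simp add: C7)
  have mult: "map_point \<sigma> (point_mult E m P) = point_mult E (m * n) P"
    if "\<sigma> \<in> galois_group K" "of_nat n = \<psi> \<sigma>" for \<sigma> m n
    using galois_point_mult[OF that(1) E, of m P] act[OF that] marking_mult_mult[OF m] by simp
  have "rational_subgroup K E C"
    unfolding rational_subgroup_def point_subgroup_def
  proof (intro conjI ballI)
    show "C \<subseteq> curve_points E" using marking_on_curve[OF m] by (auto simp: C_def)
    show "Infinity \<in> C" unfolding C_def by (rule range_eqI[of _ _ 0]) simp
    show "point_neg E Q \<in> C" if "Q \<in> C" for Q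
      using that marking_point_neg[OF m] by (auto simp: C_def)
    show "point_add E Q R \<in> C" if "Q \<in> C" "R \<in> C" for Q R
      using that marking_add[OF m] by (auto simp: C_def)
    fix \<sigma> assume \<sigma>: "\<sigma> \<in> galois_group K"
    obtain n where "of_nat n = \<psi> \<sigma>" using F7_of_nat_surj by blast
    then have "map_point \<sigma> ` C \<subseteq> C" using mult[OF \<sigma>] by (auto simp: C_def)
    moreover have "inj_on (map_point \<sigma>) C"
      by (auto simp: inj_on_def galois_map_point_eq_iff[OF \<sigma>])
    ultimately show "map_point \<sigma> ` C = C" using endo_inj_surj[OF fin] by blast
  qed
  moreover have "acts_via K E C \<psi>"
    unfolding acts_via_def
  proof (intro ballI allI impI)
    fix \<sigma> Q n assume \<sigma>: "\<sigma> \<in> galois_group K" and Q: "Q \<in> C" and n: "of_nat n = \<psi> \<sigma>"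
    obtain m' where "Q = point_mult E m' P" using Q by (auto simp: C_def)
    then show "map_point \<sigma> Q = point_mult E n Q"
      using mult[OF \<sigma> n, of m'] marking_mult_mult[OF m, of n m'] by (simp add: mult.commute)
  qed
  ultimately show "\<exists>C. rational_subgroup K E C \<and> card C = 7 \<and> acts_via K E C \<psi>"
    using card by blast
qed

text \<open>
  With \<open>\<epsilon> = \<psi>\<^sup>3\<close> and \<open>lam P = Q\<close>, conjugation gives \<open>\<epsilon>(\<sigma>) lam (\<sigma> P) = \<sigma> Q = \<chi>(\<sigma>) Q\<close>. Hence
  \<open>\<sigma> P = \<epsilon>(\<sigma>) \<chi>(\<sigma>) P = \<psi>(\<sigma>) P\<close>.
\<close>

lemma twist_level_structure:
  assumes A: "set_weierstrass A \<subseteq> K" and E: "set_weierstrass E \<subseteq> K"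
    and \<psi>: "continuous_character K \<psi>"
    and level: "level_structure K A Q (\<lambda>\<sigma>. \<psi> \<sigma> ^ 4)"
    and iso: "is_isomorphism lam E A"
    and twist: "\<And>\<sigma>. \<sigma> \<in> galois_group K \<Longrightarrow>
      map_coord_change \<sigma> lam = cc_comp (sign_automorphism A (\<psi> \<sigma> ^ 3)) lam"
  shows "level_structure K E (cc_apply (cc_inv lam) Q) \<psi>"
proof -
  define P where "P = cc_apply (cc_inv lam) Q"
  obtain w \<phi> where mQ: "tate_marking A Q w \<phi>"
    and act: "\<And>\<sigma> n. \<sigma> \<in> galois_group K \<Longrightarrow> of_nat n = \<psi> \<sigma> ^ 4 \<Longrightarrow> map_point \<sigma> Q = point_mult A n Q"
    using level by (auto simp: level_structure_def)
  have mP: "tate_marking E P w (cc_comp (cc_inv lam) \<phi>)"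
    unfolding P_def by (rule marking_transport[OF mQ cc_inv_isomorphism[OF iso]])
  have lamP: "cc_apply lam P = Q" unfolding P_def by (rule cc_inv_inv[OF iso])
  have Pc: "P \<in> curve_points E" using marking_on_curve[OF mP, of "Suc 0"] by simp
  have lam_mult: "cc_apply lam (point_mult E n P) = point_mult A n Q" for n
    using isomorphism_mult[OF iso Pc, of n] lamP by simp
  note lam_eq = cc_apply_eq_iff[OF isomorphism_u[OF iso]]
  have "map_point \<sigma> P = point_mult E n P" if \<sigma>: "\<sigma> \<in> galois_group K" and n: "of_nat n = \<psi> \<sigma>" for \<sigma> n
  proof -
    obtain m where m: "of_nat m = \<psi> \<sigma> ^ 4" using F7_of_nat_surj by blast
    have eq: "cc_apply (sign_automorphism A (\<psi> \<sigma> ^ 3)) (cc_apply lam (map_point \<sigma> P)) = point_mult A m Q"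
      using galois_cc_apply[OF \<sigma>, of lam P] act[OF \<sigma> m]
      by (simp add: lamP twist[OF \<sigma>] cc_apply_comp)
    from F7_sign(1)[OF character_nonzero[OF \<psi> \<sigma>] n m] show ?thesis
    proof (elim disjE conjE)
      assume s: "\<psi> \<sigma> ^ 3 = 1" and nm: "(of_nat n :: 7) = of_nat m"
      have "cc_apply lam (map_point \<sigma> P) = cc_apply lam (point_mult E m P)"
        using eq by (simp add: sign_automorphism_def s lam_mult)
      then show ?thesis using marking_mult_cong[OF mP nm] by (simp add: lam_eq)
    next
      assume s: "\<psi> \<sigma> ^ 3 = - 1" and nm: "(of_nat n :: 7) = of_nat (6 * m)"
      have "point_neg A (cc_apply lam (map_point \<sigma> P)) = point_mult A m Q"
        using eq by (simp add: sign_automorphism_def s cc_apply_neg)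
      then have "cc_apply lam (map_point \<sigma> P) = point_neg A (point_mult A m Q)"
        by (metis point_neg_neg)
      also have "\<dots> = cc_apply lam (point_mult E (6 * m) P)"
        by (simp add: marking_point_neg[OF mQ] lam_mult)
      finally show ?thesis using marking_mult_cong[OF mP nm] by (simp add: lam_eq)
    qed
  qed
  then show ?thesis using mP unfolding level_structure_def P_def[symmetric] by blast
qed

text \<open>
  Let \<open>lam\<close> carry \<open>P\<close> to \<open>Q\<close>. Its conjugate \<open>\<theta>\<close> carries \<open>\<psi>(\<sigma>) P\<close> to \<open>\<chi>(\<sigma>) Q\<close>, and multiplying by the inverse
  of \<open>\<chi>(\<sigma>)\<close> shows that it carries \<open>P\<close> to \<open>Q\<close> or to \<open>-Q\<close>, according to the sign \<open>\<psi>(\<sigma>)\<^sup>3\<close>. By uniqueness of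
  markings it is \<open>lam\<close> or its negative.
\<close>

lemma level_structure_twist:
  assumes A: "set_weierstrass A \<subseteq> K" and E: "elliptic_curve K E"
    and \<psi>: "continuous_character K \<psi>"
    and levelA: "level_structure K A Q (\<lambda>\<sigma>. \<psi> \<sigma> ^ 4)" and mA: "tate_marking A Q w \<phi>A"
    and levelE: "level_structure K E P \<psi>" and mE: "tate_marking E P w \<phi>E"
  shows "is_twist K A (\<lambda>\<sigma>. \<psi> \<sigma> ^ 3) E"
proof -
  define lam where "lam = cc_comp \<phi>A (cc_inv \<phi>E)"
  have EK: "set_weierstrass E \<subseteq> K" using E by (simp add: elliptic_curve_def)
  have isoA: "is_isomorphism \<phi>A (trivial_family w) A" and isoE: "is_isomorphism \<phi>E (trivial_family w) E"
    using mA mE by (simp_all add: tate_marking_def)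
  have iso: "is_isomorphism lam E A"
    unfolding lam_def by (rule cc_comp_isomorphism[OF isoA cc_inv_isomorphism[OF isoE]])
  have invE: "cc_comp \<phi>E (cc_inv \<phi>E) = cc_id" "cc_comp (cc_inv \<phi>E) \<phi>E = cc_id"
    using cc_comp_inv[OF isomorphism_u[OF isoE]] by simp_all
  have inv: "cc_comp lam (cc_inv lam) = cc_id"
    using cc_comp_inv[OF isomorphism_u[OF iso]] by simp
  have lam_E: "cc_comp lam \<phi>E = \<phi>A"
    unfolding lam_def by (simp add: cc_comp_assoc[symmetric] invE)
  have cancel: "\<theta> = cc_comp \<eta> lam" if "cc_comp \<theta> \<phi>E = cc_comp \<eta> \<phi>A" for \<theta> \<eta>
  proof -
    have "\<theta> = cc_comp (cc_comp \<theta> \<phi>E) (cc_inv \<phi>E)" by (simp add: cc_comp_assoc[symmetric] invE)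
    also have "\<dots> = cc_comp \<eta> lam" unfolding that lam_def by (simp add: cc_comp_assoc)
    finally show ?thesis .
  qed
  have Pc: "P \<in> curve_points E" using marking_on_curve[OF mE, of "Suc 0"] by simp
  have "cc_comp (map_coord_change \<sigma> lam) (cc_inv lam) = sign_automorphism A (\<psi> \<sigma> ^ 3)"
    if \<sigma>: "\<sigma> \<in> galois_group K" for \<sigma>
  proof -
    define \<theta> where "\<theta> = map_coord_change \<sigma> lam"
    have iso\<theta>: "is_isomorphism \<theta> E A"
      using galois_isomorphism[OF \<sigma> iso]
      by (simp add: \<theta>_def galois_curve_map[OF \<sigma> EK] galois_curve_map[OF \<sigma> A])
    obtain n m where n: "of_nat n = \<psi> \<sigma>" and m: "of_nat m = \<psi> \<sigma> ^ 4"
      using F7_of_nat_surj by metis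
    have \<sigma>P: "map_point \<sigma> P = point_mult E n P"
      using levelE \<sigma> n by (simp add: level_structure_def)
    have \<sigma>Q: "map_point \<sigma> Q = point_mult A m Q"
      using levelA \<sigma> m by (simp add: level_structure_def)
    have lamP: "cc_apply lam P = Q"
      using lam_E mA mE by (metis cc_apply_comp tate_marking_def)
    have eq: "cc_apply \<theta> (point_mult E n P) = point_mult A m Q"
      using galois_cc_apply[OF \<sigma>, of lam P] by (simp add: \<sigma>P \<sigma>Q lamP \<theta>_def)
    \<comment> \<open>\<open>m\<^sup>2\<close> represents the inverse of \<open>\<chi>(\<sigma>)\<close>, which has order dividing three\<close>
    have cube: "point_mult A (m * m) (point_mult A m Q) = Q"
    proof -
      have "(of_nat (m * m * m) :: 7) = of_nat (Suc 0)"
        using F7_sign(2)[OF character_nonzero[OF \<psi> \<sigma>] n m] by simp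
      from marking_mult_cong[OF mA this] show ?thesis by (simp add: marking_mult_mult[OF mA])
    qed
    have \<theta>_mult: "cc_apply \<theta> (point_mult E (m * m * n) P) = Q"
    proof -
      have "cc_apply \<theta> (point_mult E (m * m) (point_mult E n P)) = point_mult A (m * m) (point_mult A m Q)"
        using isomorphism_mult[OF iso\<theta> marking_on_curve[OF mE, of n], of "m * m"] eq by simp
      then show ?thesis using cube by (simp add: marking_mult_mult[OF mE])
    qed
    have m\<theta>: "tate_marking A (cc_apply \<theta> P) w (cc_comp \<theta> \<phi>E)"
      by (rule marking_transport[OF mE iso\<theta>])
    from F7_sign[OF character_nonzero[OF \<psi> \<sigma>] n m] have "\<theta> = cc_comp (sign_automorphism A (\<psi> \<sigma> ^ 3)) lam"
    proof (elim disjE conjE)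
      assume s: "\<psi> \<sigma> ^ 3 = 1" and nm: "(of_nat n :: 7) = of_nat m"
        and m3: "(of_nat (m * m * m) :: 7) = 1"
      have "(of_nat (m * m * n) :: 7) = of_nat (Suc 0)" using nm m3 by simp
      then have "point_mult E (m * m * n) P = P" using marking_mult_cong[OF mE] by fastforce
      then have "cc_apply \<theta> P = Q" using \<theta>_mult by simp
      then have "cc_comp \<theta> \<phi>E = \<phi>A" using marking_unique[OF mA] m\<theta> by blast
      then show ?thesis using cancel[of \<theta> cc_id] by (simp add: sign_automorphism_def s)
    next
      assume s: "\<psi> \<sigma> ^ 3 = - 1" and nm: "(of_nat n :: 7) = of_nat (6 * m)"
        and m3: "(of_nat (m * m * m) :: 7) = 1"
      have "(of_nat (m * m * n) :: 7) = of_nat (6 * (m * m * m))"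
        using nm by (simp add: mult.commute mult.left_commute)
      also have "\<dots> = of_nat (6 * Suc 0)" unfolding of_nat_mult[of 6] m3 by simp
      finally have "point_mult E (m * m * n) P = point_mult E (6 * Suc 0) P"
        using marking_mult_cong[OF mE] by blast
      also have "\<dots> = point_neg E P" using marking_point_neg[OF mE, of "Suc 0"] by simp
      finally have "point_neg A (cc_apply \<theta> P) = Q"
        using \<theta>_mult isomorphism_neg[OF iso\<theta>, of P] by simp
      then have "cc_apply \<theta> P = point_neg A Q" by (metis point_neg_neg)
      then have "cc_comp \<theta> \<phi>E = cc_comp (cc_neg A) \<phi>A"
        using marking_unique[OF marking_neg[OF mA]] m\<theta> by metis
      then show ?thesis using cancel[of \<theta> "cc_neg A"] by (simp add: sign_automorphism_def s)
    qed
    then show ?thesis unfolding \<theta>_def[symmetric]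
      by (simp add: cc_comp_assoc[symmetric] inv)
  qed
  moreover have "\<psi> \<sigma> ^ 3 \<in> {1, - 1}" if "\<sigma> \<in> galois_group K" for \<sigma>
    using F7_power_3[OF character_nonzero[OF \<psi> that]] by simp
  ultimately show ?thesis using E iso unfolding is_twist_def by blast
qed

text \<open>
  The conjugate of the marking of \<open>P\<close> is a marking of \<open>\<sigma> P = \<psi>(\<sigma>) P\<close> with parameter \<open>\<sigma> w\<close>. Up to sign this
  point is \<open>\<chi>(\<sigma>) P\<close>, and the sign does not affect the parameter.
\<close>

lemma galois_marking:
  assumes \<sigma>: "\<sigma> \<in> galois_group K" and E: "set_weierstrass E \<subseteq> K"
    and \<psi>: "continuous_character K \<psi>"
    and level: "level_structure K E P \<psi>" and mE: "tate_marking E P w \<phi>"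
    and m: "of_nat m = \<psi> \<sigma> ^ 4"
  shows "\<exists>\<phi>'. tate_marking E (point_mult E m P) (\<sigma> w) \<phi>'"
proof -
  obtain n where n: "of_nat n = \<psi> \<sigma>" using F7_of_nat_surj by blast
  note hom = galois_simps[OF \<sigma>]
  have "tate_marking E (map_point \<sigma> P) (\<sigma> w) (map_coord_change \<sigma> \<phi>)"
    unfolding tate_marking_def
  proof (intro conjI)
    have w: "w \<noteq> 0" "w \<noteq> 1" and iso: "is_isomorphism \<phi> (trivial_family w) E"
      and P: "cc_apply \<phi> (Affine 0 0) = P" using mE by (simp_all add: tate_marking_def)
    show "\<sigma> w \<noteq> 0" using w(1) galois_eq_iff[OF \<sigma>, of w 0] hom(1) by simp
    show "\<sigma> w \<noteq> 1" using w(2) galois_eq_iff[OF \<sigma>, of w 1] hom(2) by simp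
    have "map_weierstrass \<sigma> (trivial_family w) = trivial_family (\<sigma> w)"
      by (simp add: trivial_family_def hom)
    then show "is_isomorphism (map_coord_change \<sigma> \<phi>) (trivial_family (\<sigma> w)) E"
      using galois_isomorphism[OF \<sigma> iso] by (simp add: galois_curve_map[OF \<sigma> E])
    show "cc_apply (map_coord_change \<sigma> \<phi>) (Affine 0 0) = map_point \<sigma> P"
      using galois_cc_apply[OF \<sigma>, of \<phi> "Affine 0 0"] P by (simp add: hom)
  qed
  moreover have "map_point \<sigma> P = point_mult E n P" using level \<sigma> n by (simp add: level_structure_def)
  ultimately have mn: "tate_marking E (point_mult E n P) (\<sigma> w) (map_coord_change \<sigma> \<phi>)" by simp
  from F7_sign(1)[OF character_nonzero[OF \<psi> \<sigma>] n m] show ?thesis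
  proof (elim disjE conjE)
    assume "(of_nat n :: 7) = of_nat m"
    then show ?thesis using mn marking_mult_cong[OF mE] by metis
  next
    assume nm: "(of_nat n :: 7) = of_nat (6 * m)"
    have "(of_nat (6 * n) :: 7) = of_nat (m + 7 * (5 * m))"
      unfolding of_nat_mult[of 6] nm by simp
    also have "\<dots> = of_nat m" unfolding F7_of_nat_eq_iff by (rule mod_mult_self2)
    finally have "point_neg E (point_mult E n P) = point_mult E m P"
      using marking_mult_cong[OF mE] marking_point_neg[OF mE] by metis
    then show ?thesis using marking_neg[OF mn] by auto
  qed
qed

text \<open>
  Any other generator of the subgroup is a level structure as well.
\<close>

lemma level_structure_quadruple:
  assumes E: "set_weierstrass E \<subseteq> K" and level: "level_structure K E P \<psi>"
  shows "level_structure K E (point_mult E 4 P) \<psi>"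
proof -
  obtain w \<phi> where m: "tate_marking E P w \<phi>"
    and act: "\<And>\<sigma> n. \<sigma> \<in> galois_group K \<Longrightarrow> of_nat n = \<psi> \<sigma> \<Longrightarrow> map_point \<sigma> P = point_mult E n P"
    using level by (auto simp: level_structure_def)
  have "map_point \<sigma> (point_mult E 4 P) = point_mult E n (point_mult E 4 P)"
    if "\<sigma> \<in> galois_group K" "of_nat n = \<psi> \<sigma>" for \<sigma> n
    using galois_point_mult[OF that(1) E, of 4 P] act[OF that]
    by (simp add: marking_mult_mult[OF m] mult.commute)
  then show ?thesis using marking_quadruple[OF m] unfolding level_structure_def by blast
qed

section \<open>The parameter when the cubic character is trivial\<close>

lemma galois_trivial_family:
  assumes "\<sigma> \<in> galois_group K"
  shows "map_weierstrass \<sigma> (trivial_family v) = trivial_family (\<sigma> v)"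
  by (simp add: trivial_family_def galois_simps[OF assms])

lemma trivial_family_level_structure:
  assumes disc: "discriminant (trivial_family v) \<noteq> 0"
    and chi: "continuous_character K \<chi>" "trivial_character K \<chi>"
  shows "level_structure K (trivial_family v) (Affine 0 0) \<chi>"
    and "tate_marking (trivial_family v) (Affine 0 0) v cc_id"
proof -
  have "v \<noteq> 0" "v \<noteq> 1"
    using disc by (auto simp: discriminant_def b2_def b4_def b6_def b8_def trivial_family_def)
  then show m: "tate_marking (trivial_family v) (Affine 0 0) v cc_id"
    by (simp add: tate_marking_def cc_id_isomorphism)
  have "map_point \<sigma> (Affine 0 0) = point_mult (trivial_family v) n (Affine 0 0)"
    if "\<sigma> \<in> galois_group K" "of_nat n = \<chi> \<sigma>" for \<sigma> n
  proof -
    have "(of_nat n :: 7) = of_nat (Suc 0)" using that chi(2) by (simp add: trivial_character_def)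
    from marking_mult_cong[OF m this] show ?thesis using galois_simps(1)[OF that(1)] by simp
  qed
  then show "level_structure K (trivial_family v) (Affine 0 0) \<chi>"
    using m by (auto simp: level_structure_def)
qed

section \<open>The parameter when the cubic character is nontrivial\<close>

lemma poly_simplest_cubic:
  "poly (simplest_cubic t) g = 0 \<longleftrightarrow> t * (g * (g - 1)) = g^3 - 3*g^2 + 1"
proof -
  have "poly (simplest_cubic t) g = g^3 - 3*g^2 + 1 - t * (g * (g - 1))"
    unfolding simplest_cubic_def poly_pCons poly_0 by algebra
  then show ?thesis by auto
qed

lemma simplest_cubic_root_nonzero:
  assumes "poly (simplest_cubic t) g = 0"
  shows "g \<noteq> 0" "g \<noteq> 1"
  using assms unfolding poly_simplest_cubic by auto

locale cubic_character =
  fixes K :: "'s::field set" and \<chi> :: "('s \<Rightarrow> 's) \<Rightarrow> 7" and t :: 's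
  assumes S: "separable_closure_of K" and chi: "continuous_character K \<chi>"
    and chi_values: "\<And>\<sigma>. \<sigma> \<in> galois_group K \<Longrightarrow> \<chi> \<sigma> = 1 \<or> \<chi> \<sigma> = 2 \<or> \<chi> \<sigma> = 4"
    and nontrivial: "\<not> trivial_character K \<chi>" and adm: "admissible_parameter K \<chi> t"
begin

lemma tK: "t \<in> K"
  using adm by (simp add: admissible_parameter_def)

lemma cut_out: "cut_out_field K \<chi> = adjoin K {x. poly (simplest_cubic t) x = 0}"
  using adm by (auto simp: admissible_parameter_def splitting_field_of_def)

lemma root_1:
  assumes "\<sigma> \<in> galois_group K" "\<chi> \<sigma> = 1" "poly (simplest_cubic t) g = 0"
  shows "\<sigma> g = g"
proof -
  have "g \<in> adjoin K {x. poly (simplest_cubic t) x = 0}"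
    using assms(3) by (auto simp: adjoin_def)
  then show ?thesis using assms(1,2) unfolding cut_out[symmetric] cut_out_field_def by blast
qed

lemma root_4:
  assumes "\<sigma> \<in> galois_group K" "\<chi> \<sigma> = 4" "poly (simplest_cubic t) g = 0"
  shows "\<sigma> g = 1 / (1 - g)"
  using adm assms by (auto simp: admissible_parameter_def)

text \<open>
  The rule that defines an admissible parameter covers \<open>\<chi> \<sigma> = 4\<close>. The case \<open>\<chi> \<sigma> = 2\<close> is reduced to it by
  passing to \<open>\<sigma>\<^sup>2\<close>, together with \<open>\<sigma>\<^sup>3\<close> in the kernel.
\<close>

lemma power_2_values:
  assumes "\<sigma> \<in> galois_group K" "\<chi> \<sigma> = 2"
  shows "\<sigma> \<circ> \<sigma> \<in> galois_group K" "\<chi> (\<sigma> \<circ> \<sigma>) = 4"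
    "\<sigma> \<circ> (\<sigma> \<circ> \<sigma>) \<in> galois_group K" "\<chi> (\<sigma> \<circ> (\<sigma> \<circ> \<sigma>)) = 1"
proof -
  show G: "\<sigma> \<circ> \<sigma> \<in> galois_group K" by (rule galois_comp[OF assms(1,1)])
  show "\<sigma> \<circ> (\<sigma> \<circ> \<sigma>) \<in> galois_group K" by (rule galois_comp[OF assms(1) G])
  show 4: "\<chi> (\<sigma> \<circ> \<sigma>) = 4" using character_comp[OF chi assms(1,1)] assms(2) by simp
  show "\<chi> (\<sigma> \<circ> (\<sigma> \<circ> \<sigma>)) = 1"
    using character_comp[OF chi assms(1) G] assms(2) 4 by simp
qed

text \<open>
  Since \<open>\<chi>\<close> is nontrivial, some automorphism moves a root \<open>g\<close> of the cubic, for otherwise it would fix the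
  whole field cut out by \<open>\<chi>\<close>. The inequality says \<open>g \<noteq> 1/(1 - g)\<close>, i.e. that the cubic is separable.
\<close>

lemma exists_root: "\<exists>g. poly (simplest_cubic t) g = 0 \<and> g^2 - g + 1 \<noteq> 0"
proof -
  obtain \<rho> where \<rho>: "\<rho> \<in> galois_group K" "\<chi> \<rho> \<noteq> 1"
    using nontrivial by (auto simp: trivial_character_def)
  have sep: "\<forall>x. separable_element K x" using S by (simp add: separable_closure_of_def)
  obtain x where x: "x \<in> cut_out_field K \<chi>" "\<rho> x \<noteq> x"
    using fixes_cut_out_field[OF sep chi \<rho>(1)] \<rho>(2) by blast
  have "\<exists>g. poly (simplest_cubic t) g = 0 \<and> \<rho> g \<noteq> g"
  proof (rule ccontr)
    assume "\<not> ?thesis"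
    then have "adjoin K {x. poly (simplest_cubic t) x = 0} \<subseteq> {x. \<rho> x = x}"
      unfolding adjoin_def using galois_fixed_points_subfield[OF \<rho>(1)] galois_fixes[OF \<rho>(1)]
      by (intro Inter_lower) auto
    then show False using x unfolding cut_out by blast
  qed
  then obtain g where g: "poly (simplest_cubic t) g = 0" "\<rho> g \<noteq> g" by blast
  have "g^2 - g + 1 \<noteq> 0"
  proof
    assume "g^2 - g + 1 = 0"
    then have "g * (1 - g) = 1" by algebra
    then have eq: "1 / (1 - g) = g"
      by (metis divide_self_if mult_not_zero nonzero_mult_div_cancel_right one_neq_zero)
    from chi_values[OF \<rho>(1)] \<rho>(2) show False
    proof (elim disjE)
      assume "\<chi> \<rho> = 4"
      then show False using root_4[OF \<rho>(1) _ g(1)] eq g(2) by simp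
    next
      assume 2: "\<chi> \<rho> = 2"
      note p = power_2_values[OF \<rho>(1) 2]
      have "(\<rho> \<circ> \<rho>) g = g" using root_4[OF p(1,2) g(1)] eq by simp
      moreover have "(\<rho> \<circ> (\<rho> \<circ> \<rho>)) g = g" using root_1[OF p(3,4) g(1)] .
      ultimately show False using g(2) by simp
    qed simp
  qed
  then show ?thesis using g(1) by blast
qed

lemma galois_cubic_family:
  assumes "\<sigma> \<in> galois_group K"
  shows "map_weierstrass \<sigma> (cubic_family t v) = cubic_family t (\<sigma> v)"
proof -
  note hom = galois_simps[OF assms] galois_fixes[OF assms tK]
  show ?thesis unfolding cubic_family_def Let_def weierstrass.map by (simp only: hom)
qed

lemma galois_level_point:
  assumes "\<sigma> \<in> galois_group K"
  shows "map_point \<sigma> (level_point t g v) = level_point t (\<sigma> g) (\<sigma> v)"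
proof -
  note hom = galois_simps[OF assms] galois_fixes[OF assms tK] galois_divide[OF assms]
  show ?thesis
    unfolding level_point_def level_x_def level_y_def Let_def point.map by (simp only: hom)
qed

lemma cubic_family_marking:
  assumes g: "poly (simplest_cubic t) g = 0" "g^2 - g + 1 \<noteq> 0"
    and nz: "g - v \<noteq> 0" "(g - 1) * v + 1 - (g - v) \<noteq> 0" "(g - 1) * v + 1 \<noteq> 0"
  shows "\<exists>\<phi>. tate_marking (cubic_family t v) (level_point t g v) ((g - v) / ((g - 1) * v + 1)) \<phi>"
    and "point_mult (cubic_family t v) 4 (level_point t g v) = level_point t (1 / (1 - g)) v"
proof -
  have D: "g * (g - 1) \<noteq> 0" using simplest_cubic_root_nonzero[OF g(1)] by simp
  interpret cubic_level g v "g^3 - 3*g^2 + 1" "g * (g - 1)" "g^2 - g + 1" "g - v"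
    "(g - 1) * v + 1 - (g - v)" "(g - 1) * v + 1"
    "(g - v) * ((g - 1) * v + 1 - (g - v)) * ((g - 1) * v + 1)"
    "(g^2 - g + 1) * (g * v^2 - (g^2 + g - 1) * v + g^2 - g)"
    "level_x g v" "level_y g v"
    "level_y g v + (g^2 - g + 1) * ((g^2 - g + 1) * (g * v^2 - (g^2 + g - 1) * v + g^2 - g)) * level_x g v"
    t "t^2 + 3*t + 9" "v^3 - (t + 3) * v^2 + t * v + 1" "(g * (g - 1))^2 / (g^2 - g + 1)"
    using g D by unfold_locales (simp_all only: poly_simplest_cubic not_False_eq_True)
  show "\<exists>\<phi>. tate_marking (cubic_family t v) (level_point t g v) ((g - v) / ((g - 1) * v + 1)) \<phi>"
    "point_mult (cubic_family t v) 4 (level_point t g v) = level_point t (1 / (1 - g)) v"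
    using marking[OF nz] by blast+
qed

text \<open>
  If \<open>v\<close> is a root of the cubic, all coefficients but \<open>a1\<close> vanish and the curve is singular.
\<close>

lemma cubic_family_nonsingular:
  assumes g: "poly (simplest_cubic t) g = 0" and disc: "discriminant (cubic_family t v) \<noteq> 0"
  shows "g - v \<noteq> 0 \<and> (g - 1) * v + 1 - (g - v) \<noteq> 0 \<and> (g - 1) * v + 1 \<noteq> 0"
proof -
  have D: "g * (g - 1) \<noteq> 0" using simplest_cubic_root_nonzero[OF g] by simp
  have f: "v^3 - (t + 3) * v^2 + t * v + 1 \<noteq> 0"
  proof
    assume "v^3 - (t + 3) * v^2 + t * v + 1 = 0"
    then show False using disc
      by (simp add: discriminant_def b2_def b4_def b6_def b8_def cubic_family_def Let_def)
  qed
  have "(v^3 - (t + 3) * v^2 + t * v + 1) * (g * (g - 1))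
      = - ((g - v) * ((g - 1) * v + 1 - (g - v)) * ((g - 1) * v + 1))"
    using g unfolding poly_simplest_cubic by algebra
  then show ?thesis using f D by auto
qed

text \<open>
  An automorphism with \<open>\<chi> \<sigma> = 4\<close> sends \<open>g\<close> to \<open>1/(1 - g)\<close> and hence the marked point to its fourth
  multiple. If \<open>\<chi> \<sigma> = 2\<close>, then \<open>\<sigma> P = \<sigma>\<^sup>4 P = 16 P\<close>.
\<close>

lemma cubic_level_structure:
  assumes v: "v \<in> K"
    and g: "poly (simplest_cubic t) g = 0" "g^2 - g + 1 \<noteq> 0"
    and nz: "g - v \<noteq> 0" "(g - 1) * v + 1 - (g - v) \<noteq> 0" "(g - 1) * v + 1 \<noteq> 0"
  shows "level_structure K (cubic_family t v) (level_point t g v) \<chi>"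
proof -
  define A where "A = cubic_family t v"
  define P where "P = level_point t g v"
  obtain w \<phi> where m: "tate_marking A P w \<phi>"
    using cubic_family_marking(1)[OF g nz] by (auto simp: A_def P_def)
  have four: "point_mult A 4 P = level_point t (1 / (1 - g)) v"
    using cubic_family_marking(2)[OF g nz] by (simp add: A_def P_def)
  have AK: "set_weierstrass A \<subseteq> K"
    unfolding A_def using galois_invariant_curve[OF S] galois_cubic_family galois_fixes v by metis
  have gal: "map_point \<sigma> P = level_point t (\<sigma> g) v" if "\<sigma> \<in> galois_group K" for \<sigma>
    using galois_level_point[OF that, of g v] galois_fixes[OF that v] by (simp add: P_def)
  have one: "map_point \<sigma> P = P" if "\<sigma> \<in> galois_group K" "\<chi> \<sigma> = 1" for \<sigma>
    using gal[OF that(1)] root_1[OF that g(1)] by (simp add: P_def)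
  have quad: "map_point \<sigma> P = point_mult A 4 P" if "\<sigma> \<in> galois_group K" "\<chi> \<sigma> = 4" for \<sigma>
    using gal[OF that(1)] root_4[OF that g(1)] four by simp
  have "map_point \<sigma> P = point_mult A n P" if \<sigma>: "\<sigma> \<in> galois_group K" and n: "of_nat n = \<chi> \<sigma>" for \<sigma> n
    using chi_values[OF \<sigma>]
  proof (elim disjE)
    assume 1: "\<chi> \<sigma> = 1"
    have "point_mult A n P = point_mult A (Suc 0) P"
      by (rule marking_mult_cong[OF m]) (use n 1 in simp)
    then show ?thesis using one[OF \<sigma> 1] by simp
  next
    assume 4: "\<chi> \<sigma> = 4"
    have "point_mult A n P = point_mult A 4 P"
      by (rule marking_mult_cong[OF m]) (use n 4 in simp)
    then show ?thesis using quad[OF \<sigma> 4] by simp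
  next
    assume 2: "\<chi> \<sigma> = 2"
    note p = power_2_values[OF \<sigma> 2]
    have comp: "map_point (\<sigma> \<circ> \<tau>) Q = map_point \<sigma> (map_point \<tau> Q)" for \<tau> Q
      by (simp add: point.map_comp)
    have c4: "map_point (\<sigma> \<circ> \<sigma>) P = point_mult A 4 P" by (rule quad[OF p(1,2)])
    have c1: "map_point (\<sigma> \<circ> (\<sigma> \<circ> \<sigma>)) P = P" by (rule one[OF p(3,4)])
    have "map_point \<sigma> P = map_point \<sigma> (map_point (\<sigma> \<circ> (\<sigma> \<circ> \<sigma>)) P)" by (simp only: c1)
    also have "\<dots> = map_point (\<sigma> \<circ> \<sigma>) (map_point (\<sigma> \<circ> \<sigma>) P)"
      by (simp add: point.map_comp comp_assoc)
    also have "\<dots> = point_mult A 16 P"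
      by (simp add: c4 galois_point_mult[OF p(1) AK] marking_mult_mult[OF m])
    also have "\<dots> = point_mult A n P" by (rule marking_mult_cong[OF m]) (use n 2 in simp)
    finally show ?thesis .
  qed
  then show ?thesis using m by (auto simp: level_structure_def A_def P_def)
qed

text \<open>
  \<open>v\<close> is obtained by solving \<open>w = (g - v)/((g - 1) v + 1)\<close>. It is invariant because \<open>g\<close> and \<open>w\<close> are conjugated
  by the same rule \<open>z \<mapsto> 1/(1 - z)\<close>, and it is finite for \<open>w\<close> different from \<open>1/(1 - g)\<close>. In the exceptional
  case the level structure \<open>4P\<close> has parameter \<open>1/(1 - w)\<close>, which is the third root of the cubic and
  so is not exceptional.
\<close>

lemma level_structure_parameter:
  assumes E: "elliptic_curve K E" and \<psi>: "continuous_character K \<psi>" "\<And>\<sigma>. \<chi> \<sigma> = \<psi> \<sigma> ^ 4"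
    and level: "level_structure K E P \<psi>"
  shows "\<exists>v\<in>K. elliptic_curve K (cubic_family t v) \<and> is_twist K (cubic_family t v) (\<lambda>\<sigma>. \<psi> \<sigma> ^ 3) E"
proof -
  have EK: "set_weierstrass E \<subseteq> K" and disc: "discriminant E \<noteq> 0"
    using E by (simp_all add: elliptic_curve_def)
  obtain g where g: "poly (simplest_cubic t) g = 0" "g^2 - g + 1 \<noteq> 0" using exists_root by blast
  have g1: "1 - g \<noteq> 0" using simplest_cubic_root_nonzero[OF g(1)] by simp
  \<comment> \<open>choose the generator whose parameter is not the pole \<open>1/(1 - g)\<close>\<close>
  have "\<exists>Q w \<phi>. level_structure K E Q \<psi> \<and> tate_marking E Q w \<phi> \<and> w * (1 - g) \<noteq> 1"
  proof -
    obtain w \<phi> where m: "tate_marking E P w \<phi>" using level by (auto simp: level_structure_def)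
    show ?thesis
    proof (cases "w * (1 - g) = 1")
      case False
      then show ?thesis using level m by blast
    next
      case True
      obtain \<phi>' where m4: "tate_marking E (point_mult E 4 P) (1 / (1 - w)) \<phi>'"
        using marking_quadruple[OF m] by blast
      have w1: "1 - w \<noteq> 0" using m by (auto simp: tate_marking_def)
      have "1 / (1 - w) * (1 - g) \<noteq> 1"
      proof
        assume "1 / (1 - w) * (1 - g) = 1"
        then have "1 - g = 1 - w" using w1 by (simp add: field_simps)
        then have "g^2 - g + 1 = 0" using True by algebra
        then show False using g(2) by simp
      qed
      then show ?thesis using level_structure_quadruple[OF EK level] m4 by blast
    qed
  qed
  then obtain Q w \<phi> where levelQ: "level_structure K E Q \<psi>" and m: "tate_marking E Q w \<phi>"
    and wg: "w * (1 - g) \<noteq> 1" by blast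
  have w: "w \<noteq> 0" "w \<noteq> 1" using m by (simp_all add: tate_marking_def)
  define d where "d = 1 + w * (g - 1)"
  have d: "d \<noteq> 0"
  proof
    assume "d = 0"
    then have "w * (1 - g) = 1" unfolding d_def by algebra
    then show False using wg by simp
  qed
  define v where "v = (g - w) / d"
  have vd: "v * d = g - w" using d by (simp add: v_def)
  have m1: "\<sigma> w = w" if "\<sigma> \<in> galois_group K" "\<chi> \<sigma> = 1" for \<sigma>
  proof -
    have "of_nat (Suc 0) = \<psi> \<sigma> ^ 4" using that(2) \<psi>(2) by simp
    from galois_marking[OF that(1) EK \<psi>(1) levelQ m this] show ?thesis
      using marking_unique[OF m] by auto
  qed
  have m4: "\<sigma> w = 1 / (1 - w)" if "\<sigma> \<in> galois_group K" "\<chi> \<sigma> = 4" for \<sigma>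
  proof -
    have "of_nat 4 = \<psi> \<sigma> ^ 4" using that(2) \<psi>(2) by simp
    from galois_marking[OF that(1) EK \<psi>(1) levelQ m this] marking_quadruple[OF m] show ?thesis
      using marking_unique by blast
  qed
  have v1: "\<sigma> v = v" if "\<sigma> \<in> galois_group K" "\<chi> \<sigma> = 1" for \<sigma>
    using m1[OF that] root_1[OF that g(1)]
    by (simp add: v_def d_def galois_divide[OF that(1)] galois_simps[OF that(1)])
  have v4: "\<sigma> v = v" if \<sigma>: "\<sigma> \<in> galois_group K" "\<chi> \<sigma> = 4" for \<sigma>
  proof -
    have w1: "1 - w \<noteq> 0" using w by simp
    define g' where "g' = 1 / (1 - g)"
    define w' where "w' = 1 / (1 - w)"
    have g': "g' * (1 - g) = 1" and w': "w' * (1 - w) = 1"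
      using g1 w1 by (simp_all add: g'_def w'_def)
    have "(1 - g) * (1 - w) * (1 + w' * (g' - 1)) = d" "(1 - g) * (1 - w) * (g' - w') = g - w"
      unfolding d_def using g' w' by algebra+
    then have "(g' - w') / (1 + w' * (g' - 1)) = (g - w) / d"
      using g1 w1 by (metis mult_divide_mult_cancel_left no_zero_divisors)
    moreover have "\<sigma> v = (g' - w') / (1 + w' * (g' - 1))"
      using m4[OF \<sigma>] root_4[OF \<sigma> g(1)]
      by (simp add: v_def d_def g'_def w'_def galois_divide[OF \<sigma>(1)] galois_simps[OF \<sigma>(1)])
    ultimately show ?thesis by (simp add: v_def)
  qed
  have "\<sigma> v = v" if \<sigma>: "\<sigma> \<in> galois_group K" for \<sigma>
    using chi_values[OF \<sigma>]
  proof (elim disjE)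
    assume 2: "\<chi> \<sigma> = 2"
    note p = power_2_values[OF \<sigma> 2]
    have "(\<sigma> \<circ> \<sigma>) v = v" "(\<sigma> \<circ> (\<sigma> \<circ> \<sigma>)) v = v" using v4[OF p(1,2)] v1[OF p(3,4)] by blast+
    then show ?thesis by simp
  qed (use v1 v4 \<sigma> in blast)+
  then have vK: "v \<in> K" by (rule galois_fixed_field[OF S])
  have X: "(g - v) * d = w * (g^2 - g + 1)" and Z: "((g - 1) * v + 1) * d = g^2 - g + 1"
    using vd unfolding d_def by algebra+
  have Y: "((g - 1) * v + 1 - (g - v)) * d = (1 - w) * (g^2 - g + 1)" using X Z by algebra
  have nz: "g - v \<noteq> 0" "(g - 1) * v + 1 - (g - v) \<noteq> 0" "(g - 1) * v + 1 \<noteq> 0"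
    using X Y Z g(2) w d by auto
  have "(g - v) / ((g - 1) * v + 1) = w"
  proof -
    have "(g - v) * d = (w * ((g - 1) * v + 1)) * d" using X Z by algebra
    then have "g - v = w * ((g - 1) * v + 1)" using d by simp
    then show ?thesis using nz(3) by simp
  qed
  then obtain \<phi>A where mA: "tate_marking (cubic_family t v) (level_point t g v) w \<phi>A"
    using cubic_family_marking(1)[OF g nz] by auto
  have AK: "set_weierstrass (cubic_family t v) \<subseteq> K"
    using galois_invariant_curve[OF S] galois_cubic_family galois_fixes vK by metis
  have levelA: "level_structure K (cubic_family t v) (level_point t g v) (\<lambda>\<sigma>. \<psi> \<sigma> ^ 4)"
    using cubic_level_structure[OF vK g nz] \<psi>(2) by (simp add: level_structure_def)
  have twist: "is_twist K (cubic_family t v) (\<lambda>\<sigma>. \<psi> \<sigma> ^ 3) E"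
    by (rule level_structure_twist[OF AK E \<psi>(1) levelA mA levelQ m])
  then obtain lam where "is_isomorphism lam E (cubic_family t v)" by (auto simp: is_twist_def)
  then have "discriminant (cubic_family t v) \<noteq> 0"
    using isomorphism_discriminant[of lam E "cubic_family t v"] isomorphism_u[of lam E] disc
    by (metis mult_eq_0_iff power_not_zero)
  then have "elliptic_curve K (cubic_family t v)" using AK by (simp add: elliptic_curve_def)
  then show ?thesis using vK twist by blast
qed

end

section \<open>The explicit quadratic twist\<close>

text \<open>
  Completing the square in \<open>y\<close> and scaling by \<open>1/(2 e)\<close>, where \<open>e\<close> is a square root of \<open>d\<close>.
\<close>

lemma explicit_twist_isomorphism:
  fixes d :: "'s::field"
  assumes two: "(2::'s) \<noteq> 0" and d: "e^2 = d" "d \<noteq> 0"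
  shows "is_isomorphism (CC (1 / (2 * e)) 0 (- (a1 A / 2)) (- (a3 A / 2))) (explicit_twist d A) A"
proof -
  have e: "e \<noteq> 0" using d by auto
  define h where "h = 1 / (2::'s)"
  define i where "i = 1 / e"
  have h: "2 * h = 1" using two by (simp add: h_def)
  have i: "i^2 * d = 1" using e d by (simp add: i_def power_divide)
  have u: "1 / (2 * e) = h * i" by (simp add: h_def i_def)
  have st: "- (a1 A / 2) = - (h * a1 A)" "- (a3 A / 2) = - (h * a3 A)" by (simp_all add: h_def)
  show ?thesis
    unfolding u st is_isomorphism_def explicit_twist_def coord_change.case weierstrass.sel
  proof (intro conjI)
    show "h * i \<noteq> 0" using h e by (auto simp: i_def)
    show "h * i * 0 = a1 A + 2 * - (h * a1 A)" using h by algebra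
    show "(h * i)^2 * (d * b2 A) = a2 A - - (h * a1 A) * a1 A + 3 * 0 - (- (h * a1 A))^2"
    proof -
      have "(h * i)^2 * (d * b2 A) = a2 A + h * a1 A * a1 A - h^2 * (a1 A)^2"
      proof -
        have "(h * i)^2 * (d * b2 A) = h^2 * (i^2 * d) * b2 A" by algebra
        then show ?thesis unfolding i b2_def power_one mult_1_right using h by algebra
      qed
      then show ?thesis by (simp add: power_mult_distrib)
    qed
    show "(h * i)^3 * 0 = a3 A + 0 * a1 A + 2 * - (h * a3 A)" using h by (simp flip: mult.assoc)
    show "(h * i)^4 * (8 * d^2 * b4 A) = a4 A - - (h * a1 A) * a3 A + 2 * 0 * a2 A
        - (- (h * a3 A) + 0 * - (h * a1 A)) * a1 A + 3 * 0^2 - 2 * - (h * a1 A) * - (h * a3 A)"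
    proof -
      have "(h * i)^4 * (8 * d^2 * b4 A)
          = a4 A + h * a1 A * a3 A + h * a3 A * a1 A - 2 * (h * a1 A) * (h * a3 A)"
      proof -
        have "(h * i)^4 * (8 * d^2 * b4 A) = 8 * h^4 * (i^2 * d)^2 * b4 A" by algebra
        then show ?thesis unfolding i b4_def power_one mult_1_right using h by algebra
      qed
      then show ?thesis by simp
    qed
    show "(h * i)^6 * (16 * d^3 * b6 A) = a6 A + 0 * a4 A + 0^2 * a2 A + 0^3
        - - (h * a3 A) * a3 A - (- (h * a3 A))^2 - 0 * - (h * a3 A) * a1 A"
    proof -
      have "(h * i)^6 * (16 * d^3 * b6 A) = a6 A + h * a3 A * a3 A - (h * a3 A)^2"
      proof -
        have "(h * i)^6 * (16 * d^3 * b6 A) = 16 * h^6 * (i^2 * d)^3 * b6 A" by algebra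
        then show ?thesis unfolding i b6_def power_one mult_1_right using h by algebra
      qed
      then show ?thesis by simp
    qed
  qed
qed

text \<open>
  Conjugation changes the isomorphism only through \<open>e\<close>, a square root of \<open>d\<close>, and a change of sign of \<open>e\<close>
  amounts to composition with \<open>-1\<close>. That \<open>\<sigma> e = e\<close> exactly when \<open>\<epsilon> \<sigma> = 1\<close> follows from the hypothesis on
  the field cut out by \<open>\<epsilon>\<close> and \<open>fixes_cut_out_field\<close>.
\<close>

lemma explicit_twist_is_twist:
  fixes K :: "'s::field set"
  assumes S: "separable_closure_of K" and two: "(2::'s) \<noteq> 0"
    and eps: "continuous_character K \<epsilon>" "\<And>\<sigma>. \<sigma> \<in> galois_group K \<Longrightarrow> \<epsilon> \<sigma> \<in> {1, - 1}"
    and d: "d \<in> K" "d \<noteq> 0" "cut_out_field K \<epsilon> = adjoin K {x. x ^ 2 = d}"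
    and A: "elliptic_curve K A"
  shows "is_twist K A \<epsilon> (explicit_twist d A)"
proof -
  have AK: "set_weierstrass A \<subseteq> K" and disc: "discriminant A \<noteq> 0"
    using A by (simp_all add: elliptic_curve_def)
  have sep: "\<forall>x. separable_element K x" and closed: "separably_closed TYPE('s)"
    using S by (simp_all add: separable_closure_of_def)
  have "separable_poly [:- d, 0, 1:]"
    unfolding separable_poly_def
  proof (rule coprimeI)
    fix c assume c: "c dvd [:- d, 0, 1:]" "c dvd pderiv [:- d, 0, 1:]"
    have "c dvd [:- d, 0, 1:] * [:2:] - pderiv [:- d, 0, 1:] * [:0, 1:]"
      using c by (intro dvd_diff dvd_mult2)
    also have "[:- d, 0, 1:] * [:2:] - pderiv [:- d, 0, 1:] * [:0, 1:] = [:- (2 * d):]"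
      by (simp add: pderiv_pCons)
    finally show "is_unit c"
      by (rule dvd_trans) (use two d(2) in \<open>simp add: is_unit_const_poly_iff dvd_field_iff\<close>)
  qed
  then obtain e where "poly [:- d, 0, 1:] e = 0"
    using closed unfolding separably_closed_def by fastforce
  then have e: "e^2 = d" by (simp add: power2_eq_square)
  have e0: "e \<noteq> 0" using e d(2) by auto
  have "e \<in> adjoin K {x. x ^ 2 = d}" using e by (auto simp: adjoin_def)
  then have fix1: "\<sigma> e = e" if "\<sigma> \<in> galois_group K" "\<epsilon> \<sigma> = 1" for \<sigma>
    using that unfolding d(3)[symmetric] cut_out_field_def by blast
  have sq: "\<sigma> e = e \<or> \<sigma> e = - e" if "\<sigma> \<in> galois_group K" for \<sigma>
  proof -
    have "(\<sigma> e)^2 = e^2"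
      using e galois_simps(7)[OF that, of e 2] galois_fixes[OF that d(1)] by simp
    then show ?thesis by (simp add: power2_eq_iff)
  qed
  have fix2: "\<epsilon> \<sigma> = 1" if \<sigma>: "\<sigma> \<in> galois_group K" "\<sigma> e = e" for \<sigma>
  proof (rule fixes_cut_out_field[OF sep eps(1) \<sigma>(1)])
    have roots: "x = e \<or> x = - e" if "x^2 = d" for x
      using that unfolding e[symmetric] power2_eq_iff .
    have "\<sigma> (- e) = - e" using galois_simps(5)[OF \<sigma>(1)] \<sigma>(2) by simp
    then have "\<sigma> x = x" if "x^2 = d" for x using roots[OF that] \<sigma>(2) by blast
    then have "adjoin K {x. x ^ 2 = d} \<subseteq> {x. \<sigma> x = x}"
      unfolding adjoin_def using galois_fixed_points_subfield[OF \<sigma>(1)] galois_fixes[OF \<sigma>(1)]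
      by (intro Inter_lower) auto
    then show "\<sigma> x = x" if "x \<in> cut_out_field K \<epsilon>" for x using that unfolding d(3) by blast
  qed
  define lam where "lam = CC (1 / (2 * e)) 0 (- (a1 A / 2)) (- (a3 A / 2))"
  have iso: "is_isomorphism lam (explicit_twist d A) A"
    unfolding lam_def by (rule explicit_twist_isomorphism[OF two e d(2)])
  have "cc_comp (map_coord_change \<sigma> lam) (cc_inv lam) = sign_automorphism A (\<epsilon> \<sigma>)"
    if \<sigma>: "\<sigma> \<in> galois_group K" for \<sigma>
  proof -
    note hom = galois_simps[OF \<sigma>] galois_divide[OF \<sigma>] galois_curve[OF \<sigma> AK]
    have map: "map_coord_change \<sigma> lam = CC (1 / (2 * \<sigma> e)) 0 (- (a1 A / 2)) (- (a3 A / 2))"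
      by (simp add: lam_def hom)
    have inv: "cc_comp lam (cc_inv lam) = cc_id"
      using cc_comp_inv[OF isomorphism_u[OF iso]] by simp
    show ?thesis
    proof (cases "\<epsilon> \<sigma> = 1")
      case True
      then have "map_coord_change \<sigma> lam = lam" using fix1[OF \<sigma>] map by (simp add: lam_def)
      then show ?thesis using inv True by (simp add: sign_automorphism_def)
    next
      case False
      then have "\<sigma> e = - e" using sq[OF \<sigma>] fix2[OF \<sigma>] by blast
      then have "map_coord_change \<sigma> lam = cc_comp (cc_neg A) lam"
        unfolding map unfolding lam_def using two by (simp add: cc_neg_def)
      then show ?thesis using inv False
        by (simp add: sign_automorphism_def cc_comp_assoc[symmetric])
    qed
  qed
  moreover have "elliptic_curve K (explicit_twist d A)"
  proof -
    have "map_weierstrass \<sigma> (explicit_twist d A) = explicit_twist d A" if \<sigma>: "\<sigma> \<in> galois_group K" for \<sigma>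
      by (simp add: explicit_twist_def b2_def b4_def b6_def galois_simps[OF \<sigma>]
          galois_curve[OF \<sigma> AK] galois_fixes[OF \<sigma> d(1)])
    then have "set_weierstrass (explicit_twist d A) \<subseteq> K" by (rule galois_invariant_curve[OF S])
    moreover have "discriminant (explicit_twist d A) \<noteq> 0"
      using isomorphism_discriminant[OF iso] disc by auto
    ultimately show ?thesis by (simp add: elliptic_curve_def)
  qed
  ultimately show ?thesis using iso eps(2) unfolding is_twist_def by blast
qed

lemma two_nonzero: "CHAR('s::field) \<noteq> 2 \<Longrightarrow> (2::'s) \<noteq> 0"
proof
  assume "CHAR('s) \<noteq> 2" and "(2::'s) = 0"
  then have "CHAR('s) dvd 2" using of_nat_eq_0_iff_char_dvd[of 2, where 'a = 's] by simp
  moreover have "CHAR('s) \<noteq> 1" by simp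
  ultimately show False using \<open>CHAR('s) \<noteq> 2\<close> by (metis prime_nat_iff two_is_prime_nat)
qed

section \<open>Subgroups of order seven\<close>

theorem theorem3p10:
  fixes K :: "'s::field set" and \<psi> :: "('s \<Rightarrow> 's) \<Rightarrow> 7" and t :: 's
  assumes "separable_closure_of K"
    and "CHAR('s) \<noteq> 7"
    and "continuous_character K \<psi>"
    and "\<not> trivial_character K (\<lambda>\<sigma>. \<psi> \<sigma> ^ 4) \<Longrightarrow> admissible_parameter K (\<lambda>\<sigma>. \<psi> \<sigma> ^ 4) t"
  shows "(\<forall>E. elliptic_curve K E \<longrightarrow>
            ((\<exists>C. rational_subgroup K E C \<and> card C = 7 \<and> acts_via K E C \<psi>) \<longleftrightarrow>
             (\<exists>v\<in>K. elliptic_curve K (curve_family K (\<lambda>\<sigma>. \<psi> \<sigma> ^ 4) t v) \<and>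
               (\<exists>E'. is_twist K (curve_family K (\<lambda>\<sigma>. \<psi> \<sigma> ^ 4) t v) (\<lambda>\<sigma>. \<psi> \<sigma> ^ 3) E' \<and>
                     isomorphic_over K E E')))) \<and>
         (CHAR('s) \<noteq> 2 \<longrightarrow>
            (\<forall>d\<in>K. d \<noteq> 0 \<and> cut_out_field K (\<lambda>\<sigma>. \<psi> \<sigma> ^ 3) = adjoin K {x. x ^ 2 = d} \<longrightarrow>
               (\<forall>v\<in>K. elliptic_curve K (curve_family K (\<lambda>\<sigma>. \<psi> \<sigma> ^ 4) t v) \<longrightarrow>
                  is_twist K (curve_family K (\<lambda>\<sigma>. \<psi> \<sigma> ^ 4) t v) (\<lambda>\<sigma>. \<psi> \<sigma> ^ 3)
                    (explicit_twist d (curve_family K (\<lambda>\<sigma>. \<psi> \<sigma> ^ 4) t v)))))"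
proof -
  let ?\<chi> = "\<lambda>\<sigma>. \<psi> \<sigma> ^ 4" and ?\<epsilon> = "\<lambda>\<sigma>. \<psi> \<sigma> ^ 3"
  note S = assms(1) and \<psi> = assms(3)
  have chi: "continuous_character K ?\<chi>" by (rule character_power[OF \<psi>])
  have family: "\<exists>Q. level_structure K (curve_family K ?\<chi> t v) Q ?\<chi>"
    if v: "v \<in> K" and ell: "elliptic_curve K (curve_family K ?\<chi> t v)" for v
  proof (cases "trivial_character K ?\<chi>")
    case True
    then show ?thesis using ell trivial_family_level_structure(1)[OF _ chi True]
      by (auto simp: curve_family_def elliptic_curve_def)
  next
    case False
    interpret cubic_character K ?\<chi> t
      using S chi False assms(4) F7_power_4 character_nonzero[OF \<psi>] by unfold_locales auto
    obtain g where g: "poly (simplest_cubic t) g = 0" "g^2 - g + 1 \<noteq> 0" using exists_root by blast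
    have "discriminant (cubic_family t v) \<noteq> 0"
      using ell False by (simp add: curve_family_def elliptic_curve_def)
    then show ?thesis
      using cubic_level_structure[OF v g] cubic_family_nonsingular[OF g(1)] False
      by (auto simp: curve_family_def)
  qed
  have parameter: "\<exists>v\<in>K. elliptic_curve K (curve_family K ?\<chi> t v) \<and> is_twist K (curve_family K ?\<chi> t v) ?\<epsilon> E"
    if E: "elliptic_curve K E" and level: "level_structure K E P \<psi>" for E P
  proof (cases "trivial_character K ?\<chi>")
    case True
    have EK: "set_weierstrass E \<subseteq> K" and disc: "discriminant E \<noteq> 0"
      using E by (simp_all add: elliptic_curve_def)
    \<comment> \<open>the only case is \<open>\<chi> = 1\<close>, in which every automorphism preserves \<open>P\<close> up to sign\<close>
    obtain w \<phi> where m: "tate_marking E P w \<phi>" using level by (auto simp: level_structure_def)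
    have "\<sigma> w = w" if \<sigma>: "\<sigma> \<in> galois_group K" for \<sigma>
    proof -
      have "of_nat (Suc 0) = \<psi> \<sigma> ^ 4" using True \<sigma> by (simp add: trivial_character_def)
      from galois_marking[OF \<sigma> EK \<psi> level m this] show ?thesis
        using marking_unique[OF m] by auto
    qed
    then have wK: "w \<in> K" by (rule galois_fixed_field[OF S])
    have AK: "set_weierstrass (trivial_family w) \<subseteq> K"
      using galois_invariant_curve[OF S] galois_trivial_family galois_fixes wK by metis
    have iso: "is_isomorphism \<phi> (trivial_family w) E" using m by (simp add: tate_marking_def)
    have discA: "discriminant (trivial_family w) \<noteq> 0"
      using isomorphism_discriminant[OF iso] disc by auto
    note A = trivial_family_level_structure[OF discA chi True]
    have "is_twist K (trivial_family w) ?\<epsilon> E"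
      by (rule level_structure_twist[OF AK E \<psi> A level m])
    then show ?thesis using wK AK discA True by (auto simp: curve_family_def elliptic_curve_def)
  next
    case False
    interpret cubic_character K ?\<chi> t
      using S chi False assms(4) F7_power_4 character_nonzero[OF \<psi>] by unfold_locales auto
    show ?thesis
      using level_structure_parameter[OF E \<psi> refl level] False by (simp add: curve_family_def)
  qed
  have "(\<exists>C. rational_subgroup K E C \<and> card C = 7 \<and> acts_via K E C \<psi>) \<longleftrightarrow>
     (\<exists>v\<in>K. elliptic_curve K (curve_family K ?\<chi> t v) \<and>
       (\<exists>E'. is_twist K (curve_family K ?\<chi> t v) ?\<epsilon> E' \<and> isomorphic_over K E E'))"
    if E: "elliptic_curve K E" for E
  proof -
    have EK: "set_weierstrass E \<subseteq> K" using E by (simp add: elliptic_curve_def)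
    have K01: "0 \<in> K" "1 \<in> K" using S by (auto simp: separable_closure_of_def is_subfield_def)
    \<comment> \<open>\<open>E\<close> itself serves as the twist in the forward direction\<close>
    have "isomorphic_over K E E"
      unfolding isomorphic_over_def
      by (rule exI[of _ cc_id]) (use K01 cc_id_isomorphism in \<open>auto simp: cc_id_def\<close>)
    moreover have "\<exists>P. level_structure K E P \<psi>"
      if v: "v \<in> K" and ell: "elliptic_curve K (curve_family K ?\<chi> t v)"
        and twist: "is_twist K (curve_family K ?\<chi> t v) ?\<epsilon> E'" and isoK: "isomorphic_over K E E'" for v E'
    proof -
      let ?A = "curve_family K ?\<chi> t v"
      obtain Q where Q: "level_structure K ?A Q ?\<chi>" using family[OF v ell] by blast
      have AK: "set_weierstrass ?A \<subseteq> K" using ell by (simp add: elliptic_curve_def)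
      obtain lam where lam: "is_isomorphism lam E' ?A"
        and tw: "\<And>\<sigma>. \<sigma> \<in> galois_group K \<Longrightarrow>
          cc_comp (map_coord_change \<sigma> lam) (cc_inv lam) = sign_automorphism ?A (\<psi> \<sigma> ^ 3)"
        using twist by (auto simp: is_twist_def)
      obtain \<phi> where \<phi>: "set_coord_change \<phi> \<subseteq> K" "is_isomorphism \<phi> E E'"
        using isoK by (auto simp: isomorphic_over_def)
      have iso: "is_isomorphism (cc_comp lam \<phi>) E ?A" by (rule cc_comp_isomorphism[OF lam \<phi>(2)])
      have "map_coord_change \<sigma> (cc_comp lam \<phi>) = cc_comp (sign_automorphism ?A (\<psi> \<sigma> ^ 3)) (cc_comp lam \<phi>)"
        if \<sigma>: "\<sigma> \<in> galois_group K" for \<sigma>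
      proof -
        have "map_coord_change \<sigma> (cc_comp lam \<phi>) = cc_comp (map_coord_change \<sigma> lam) (map_coord_change \<sigma> \<phi>)"
          by (cases lam; cases \<phi>) (simp add: galois_simps[OF \<sigma>])
        also have "map_coord_change \<sigma> \<phi> = \<phi>"
          using \<phi>(1) galois_fixes[OF \<sigma>] by (cases \<phi>) auto
        also have "map_coord_change \<sigma> lam = cc_comp (sign_automorphism ?A (\<psi> \<sigma> ^ 3)) lam"
          using tw[OF \<sigma>, symmetric] cc_comp_inv[OF isomorphism_u[OF lam]]
          by (simp add: cc_comp_assoc[symmetric])
        finally show ?thesis by (simp add: cc_comp_assoc)
      qed
      from twist_level_structure[OF AK EK \<psi> Q iso this] show ?thesis by blast
    qed
    ultimately show ?thesis
      unfolding rational_subgroup_iff_level_structure[OF EK \<psi>] using parameter[OF E] by blast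
  qed
  moreover have "is_twist K (curve_family K ?\<chi> t v) ?\<epsilon> (explicit_twist d (curve_family K ?\<chi> t v))"
    if "CHAR('s) \<noteq> 2" "d \<in> K" "d \<noteq> 0" "cut_out_field K ?\<epsilon> = adjoin K {x. x ^ 2 = d}"
      "elliptic_curve K (curve_family K ?\<chi> t v)" for d v
    using F7_power_3 character_nonzero[OF \<psi>]
    by (intro explicit_twist_is_twist[OF S two_nonzero character_power[OF \<psi>]]) (use that in auto)
  ultimately show ?thesis by blast
qed

end
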